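(* Let $\Omega\subset\mathbb{R}^n$ be open and bounded, let $\mu$ be a finite positive Borel measure on $\Omega$, and let $1\le p<\infty$. Let $F'\subset BC(\Omega)$ and $G'\subset BC(\mathbb{B}^d)$ be closed separable subalgebras that contain the constants and separate points from closed sets, with associated compactifications $e_{F'}\Omega$ of $\Omega$ and $e_{G'}\mathbb{B}^d$ of $\mathbb{B}^d$. Let $(u_n)_{n\in\mathbb{N}}$ be a norm-bounded sequence in $L^p(\Omega,\mu,\mathbb{R}^d)$. Then there exist a subsequence (not relabelled) and a triple $\big((\nu_x)_{x\in\Omega},\lambda,(\nu_x^\infty)_{x\in e_{F'}\Omega}\big)$ such that (i) $(\nu_x)_{x\in\Omega}$ is $\mu$-measurable and $\nu_x$ is a Borel probability measure on $\mathbb{R}^d$ for $\mu$-a.e. $x\in\Omega$; (ii) $\lambda$ is a finite positive Borel measure on $e_{F'}\Omega$; (iii) $(\nu^\infty_x)_{x\in e_{F'}\Omega}$ is $\lambda$-measurable and $\nu_x^\infty$ is a Borel probability measure on $\partial e_{G'}\mathbb{B}^d$ for $\lambda$-a.e. $x$; and for every $\Phi\in A$, $$\lim_{n\to\infty}\int_\Omega \Phi(x,u_n(x))\,d\mu(x)=\int_\Omega\int_{\mathbb{R}^d}\Phi(x,z)\,d\nu_x(z)\,d\mu(x)+\int_{e_{F'}\Omega}\int_{\partial e_{G'}\mathbb{B}^d}\Phi^\infty(x,w)\,d\nu_x^\infty(w)\,d\lambda(x).$$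
   Context: $\mathbb{B}^d$ is the open unit ball of $\mathbb{R}^d$; $BC(X)$ is the space of bounded continuous real functions on $X$ with the sup norm. A family $H\subset BC(X)$ separates points from closed sets if for each closed $C\subset X$ and $x\in X\setminus C$ there is $f\in H$ with $f(x)\notin\overline{f(C)}$. For such a family, $e_H:X\to\prod_{f\in H}[\inf f,\sup f]$, $x\mapsto (f(x))_{f\in H}$ (product topology) is an embedding, and $e_HX:=\overline{e_H(X)}$ is the compactification of $X$ generated by $H$; $X$ is identified with $e_H(X)$, and $\partial e_{G'}\mathbb{B}^d:=e_{G'}\mathbb{B}^d\setminus e_{G'}(\mathbb{B}^d)$. For a continuous $\Phi:\Omega\times\mathbb{R}^d\to\mathbb{R}$ with $\sup_{(x,z)}|\Phi(x,z)|/(1+|z|)^p<\infty$ put $(T\Phi)(x,\hat z)=(1-|\hat z|)^p\,\Phi\big(x,\tfrac{\hat z}{1-|\hat z|}\big)$ for $(x,\hat z)\in\Omega\times\mathbb{B}^d$. $A$ is the set of such $\Phi$ for which $T\Phi$ extends to a continuous function on $e_{F'}\Omega\times e_{G'}\mathbb{B}^d$; for $\Phi\in A$, $\Phi^\infty$ denotes the restriction of this extension to $e_{F'}\Omega\times\partial e_{G'}\mathbb{B}^d$. A family of measures $(\eta_x)_x$ on a space $Z$ is $\lambda$-measurable if $x\mapsto\int\phi\,d\eta_x$ is $\lambda$-measurable for each $\phi\in C_0(Z)$. *)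

theory Defs
  imports "HOL-Analysis.Analysis" "HOL-Probability.Probability"
begin

section \<open>Bounded continuous functions and generated compactifications\<close>

text \<open>Functions on a space \<open>X\<close> are represented by elements of \<open>extensional (topspace X)\<close>, as in the
  library's metric space \<open>cfunspace\<close>, whose metric is the supremum distance.\<close>

definition BC :: "'a topology \<Rightarrow> ('a \<Rightarrow> real) metric" where
  "BC X = cfunspace X euclidean_metric"

definition subalgebra_BC :: "'a topology \<Rightarrow> ('a \<Rightarrow> real) set \<Rightarrow> bool" where
  "subalgebra_BC X H \<longleftrightarrow>
     H \<subseteq> mspace (BC X) \<and> H \<noteq> {} \<and>
     (\<forall>f\<in>H. \<forall>g\<in>H. (\<lambda>x\<in>topspace X. f x + g x) \<in> H) \<and>
     (\<forall>f\<in>H. \<forall>g\<in>H. (\<lambda>x\<in>topspace X. f x * g x) \<in> H) \<and>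
     (\<forall>c. \<forall>f\<in>H. (\<lambda>x\<in>topspace X. c * f x) \<in> H)"

definition contains_constants :: "'a topology \<Rightarrow> ('a \<Rightarrow> real) set \<Rightarrow> bool" where
  "contains_constants X H \<longleftrightarrow> (\<forall>c. (\<lambda>x\<in>topspace X. c) \<in> H)"

definition separates_points_from_closed :: "'a topology \<Rightarrow> ('a \<Rightarrow> real) set \<Rightarrow> bool" where
  "separates_points_from_closed X H \<longleftrightarrow>
     (\<forall>C x. closedin X C \<and> x \<in> topspace X - C \<longrightarrow> (\<exists>f\<in>H. f x \<notin> closure (f ` C)))"

definition eval_map :: "('a \<Rightarrow> real) set \<Rightarrow> 'a \<Rightarrow> ('a \<Rightarrow> real) \<Rightarrow> real" where
  "eval_map H x = (\<lambda>f\<in>H. f x)"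

definition eval_cube :: "'a topology \<Rightarrow> ('a \<Rightarrow> real) set \<Rightarrow> (('a \<Rightarrow> real) \<Rightarrow> real) topology" where
  "eval_cube X H =
     product_topology (\<lambda>f. top_of_set {(INF x\<in>topspace X. f x)..(SUP x\<in>topspace X. f x)}) H"

definition compactification :: "'a topology \<Rightarrow> ('a \<Rightarrow> real) set \<Rightarrow> (('a \<Rightarrow> real) \<Rightarrow> real) topology" where
  "compactification X H =
     subtopology (eval_cube X H) (eval_cube X H closure_of (eval_map H ` topspace X))"

definition remainder :: "'a topology \<Rightarrow> ('a \<Rightarrow> real) set \<Rightarrow> (('a \<Rightarrow> real) \<Rightarrow> real) topology" where
  "remainder X H =
     subtopology (compactification X H)
       (topspace (compactification X H) - eval_map H ` topspace X)"


section \<open>Borel measures, measurable families and Lebesgue spaces\<close>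

definition borel_of :: "'a topology \<Rightarrow> 'a measure" where
  "borel_of X = sigma (topspace X) {U. openin X U}"

lemma borel_of_euclidean: "borel_of euclidean = borel"
  by (simp add: borel_of_def borel_def)

definition C0 :: "'a topology \<Rightarrow> ('a \<Rightarrow> real) set" where
  "C0 Z = {\<phi>. continuous_map Z euclideanreal \<phi> \<and>
              (\<forall>\<epsilon>>0. compactin Z {z \<in> topspace Z. \<epsilon> \<le> \<bar>\<phi> z\<bar>})}"

definition measurable_family ::
    "'a measure \<Rightarrow> 'b topology \<Rightarrow> ('a \<Rightarrow> 'b measure) \<Rightarrow> bool" where
  "measurable_family l Z \<eta> \<longleftrightarrow>
     (\<forall>x\<in>space l. sets (\<eta> x) = sets (borel_of Z)) \<and>
     (\<forall>\<phi>\<in>C0 Z. (\<lambda>x. LINT z|\<eta> x. \<phi> z) \<in> borel_measurable l)"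

text \<open>Elements of \<open>L\<^sup>p\<close> are given by Borel representatives.\<close>

definition Lp_space :: "real \<Rightarrow> 'a measure \<Rightarrow> ('a \<Rightarrow> 'b::euclidean_space) set" where
  "Lp_space p M = {u \<in> borel_measurable M. integrable M (\<lambda>x. norm (u x) powr p)}"

definition Lp_norm :: "real \<Rightarrow> 'a measure \<Rightarrow> ('a \<Rightarrow> 'b::euclidean_space) \<Rightarrow> real" where
  "Lp_norm p M u = (LINT x|M. norm (u x) powr p) powr (1 / p)"


section \<open>Integrands and their recession functions\<close>

definition T_op :: "real \<Rightarrow> ('a \<times> 'b \<Rightarrow> real) \<Rightarrow> 'a \<times> 'b::real_normed_vector \<Rightarrow> real" where
  "T_op p \<Phi> = (\<lambda>(x, w). (1 - norm w) powr p * \<Phi> (x, w /\<^sub>R (1 - norm w)))"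

abbreviation unit_ball_top :: "'b::euclidean_space topology" where
  "unit_ball_top \<equiv> top_of_set (ball 0 1)"

text \<open>\<open>g\<close> is a continuous extension of \<open>T_op p \<Phi>\<close>, where \<open>\<Omega>\<close> and the unit ball are identified
  with their images under the evaluation maps.\<close>

definition is_T_extension ::
    "'a::euclidean_space set \<Rightarrow> real \<Rightarrow> ('a \<Rightarrow> real) set \<Rightarrow> ('b::euclidean_space \<Rightarrow> real) set \<Rightarrow>
     ('a \<times> 'b \<Rightarrow> real) \<Rightarrow> ((('a \<Rightarrow> real) \<Rightarrow> real) \<times> (('b \<Rightarrow> real) \<Rightarrow> real) \<Rightarrow> real) \<Rightarrow> bool" where
  "is_T_extension \<Omega> p F G \<Phi> g \<longleftrightarrow>
     continuous_map
       (prod_topology (compactification (top_of_set \<Omega>) F) (compactification unit_ball_top G))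
       euclideanreal g \<and>
     (\<forall>x\<in>\<Omega>. \<forall>w\<in>ball 0 1. g (eval_map F x, eval_map G w) = T_op p \<Phi> (x, w))"

definition integrands ::
    "'a::euclidean_space set \<Rightarrow> real \<Rightarrow> ('a \<Rightarrow> real) set \<Rightarrow> ('b::euclidean_space \<Rightarrow> real) set \<Rightarrow>
     ('a \<times> 'b \<Rightarrow> real) set" where
  "integrands \<Omega> p F G =
     {\<Phi>. continuous_on (\<Omega> \<times> UNIV) \<Phi> \<and>
         bdd_above ((\<lambda>(x, z). \<bar>\<Phi> (x, z)\<bar> / (1 + norm z) powr p) ` (\<Omega> \<times> UNIV)) \<and>
         (\<exists>g. is_T_extension \<Omega> p F G \<Phi> g)}"

text \<open>A continuous extension is unique on the product of the compactifications
  (lemma \<open>is_T_extension_unique\<close> below), so the restriction does not depend on the choice.\<close>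

definition recession ::
    "'a::euclidean_space set \<Rightarrow> real \<Rightarrow> ('a \<Rightarrow> real) set \<Rightarrow> ('b::euclidean_space \<Rightarrow> real) set \<Rightarrow>
     ('a \<times> 'b \<Rightarrow> real) \<Rightarrow> (('a \<Rightarrow> real) \<Rightarrow> real) \<times> (('b \<Rightarrow> real) \<Rightarrow> real) \<Rightarrow> real" where
  "recession \<Omega> p F G \<Phi> =
     restrict (SOME g. is_T_extension \<Omega> p F G \<Phi> g)
       (topspace (compactification (top_of_set \<Omega>) F) \<times> topspace (remainder unit_ball_top G))"

lemma eval_map_in_cube:
  assumes "H \<subseteq> mspace (BC X)"
  shows "eval_map H ` topspace X \<subseteq> topspace (eval_cube X H)"
proof -
  have bdd: "bounded (f ` topspace X)" if "f \<in> H" for f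
    using that assms by (auto simp: BC_def Met_TC.fspace_def)
  have "(INF y\<in>topspace X. f y) \<le> f x \<and> f x \<le> (SUP y\<in>topspace X. f y)"
    if "f \<in> H" "x \<in> topspace X" for f x
    using bdd[OF that(1)] that(2)
    by (meson bounded_imp_bdd_above bounded_imp_bdd_below cINF_lower cSUP_upper)
  then show ?thesis
    by (simp add: eval_map_def eval_cube_def image_subset_iff PiE_iff)
qed

lemma eval_map_dense:
  assumes "H \<subseteq> mspace (BC X)"
  shows "compactification X H closure_of (eval_map H ` topspace X) = topspace (compactification X H)"
proof -
  let ?S = "eval_map H ` topspace X" and ?K = "eval_cube X H"
  have "?S \<subseteq> ?K closure_of ?S"
    by (rule closure_of_subset[OF eval_map_in_cube[OF assms]])
  moreover have "topspace ?K \<inter> (?K closure_of ?S) = ?K closure_of ?S"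
    by (simp add: closure_of_subset_topspace inf.absorb2)
  ultimately show ?thesis
    by (simp add: compactification_def closure_of_subtopology Int_absorb1)
qed

lemma is_T_extension_unique:
  assumes F: "F \<subseteq> mspace (BC (top_of_set \<Omega>))" and G: "G \<subseteq> mspace (BC unit_ball_top)"
    and g: "is_T_extension \<Omega> p F G \<Phi> g" and h: "is_T_extension \<Omega> p F G \<Phi> h"
    and y: "y \<in> topspace (compactification (top_of_set \<Omega>) F) \<times>
                topspace (compactification unit_ball_top G)"
  shows "g y = h y"
proof -
  let ?P = "prod_topology (compactification (top_of_set \<Omega>) F) (compactification unit_ball_top G)"
  let ?S = "(eval_map F ` \<Omega>) \<times> (eval_map G ` ball 0 1)"
  have y': "y \<in> ?P closure_of ?S"
    using y eval_map_dense[OF F] eval_map_dense[OF G] by (simp add: closure_of_Times)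
  have cg: "continuous_map ?P euclideanreal g" and ch: "continuous_map ?P euclideanreal h"
    using g h by (simp_all add: is_T_extension_def)
  have eq: "g s = h s" if s: "s \<in> ?S" for s
  proof -
    obtain x w where "x \<in> \<Omega>" "w \<in> ball 0 1" "s = (eval_map F x, eval_map G w)"
      using s by blast
    then show ?thesis
      using g h unfolding is_T_extension_def by metis
  qed
  have "Hausdorff_space euclideanreal" by simp
  from forall_in_closure_of_eq[OF y' this cg ch eq] show ?thesis .
qed

end

theory Submission
  imports Defs
begin

text \<open>The points \<open>(x, u\<^sub>n(x) / (1 + |u\<^sub>n(x)|))\<close>, with weight \<open>(1 + |u\<^sub>n|)\<^sup>p d\<mu>\<close>, give
  measures of bounded mass on the compact metrizable space \<open>e\<^sub>F\<Omega> \<times> e\<^sub>GB\<close>, against which the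
  extension of \<open>T\<Phi>\<close> integrates to \<open>\<integral> \<Phi>(x, u\<^sub>n) d\<mu>\<close>.  A subsequence converges weakly to some \<open>m\<close>.
  Over the remainder of the ball, disintegrating \<open>m\<close> gives \<open>\<lambda>\<close> and \<open>\<nu>\<^sup>\<infinity>\<close>.  Over the ball itself,
  the function \<open>(1 - |w|)\<^sup>p\<close> extends continuously by zero to \<open>e\<^sub>GB\<close>, so the first marginal of
  \<open>(1 - |w|)\<^sup>p m\<close> is the limit of the constant sequence \<open>\<mu>\<close>; disintegrating it gives \<open>\<nu>\<close>.

  Weak compactness and disintegration are both reduced to the real line: a compact metric space has
  an injective Borel coding by reals whose inverse extends continuously to a compact set of reals.\<close>

section \<open>Weak compactness on compact metric spaces\<close>

text \<open>Two obstacles shape the proof. The compactifications are abstract topologies on sets of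
  functions, while weak limits and kernels are handled on types; by separability, countably many
  coordinates already embed them as compact subsets of \<open>nat \<Rightarrow> real\<close>. On the
  line, weak compactness is Helly's theorem and a kernel is a family of distribution functions. A
  coding by reals cannot be continuous in general, but only the decoding \<open>c\<close> has to be,
  because a test function \<open>g\<close> enters as \<open>g \<circ> c\<close>. The weight is
  forced: for \<open>w = z / (1 + |z|)\<close> one has \<open>1 - |w| = 1 / (1 + |z|)\<close>, hence
  \<open>\<Phi>(x, z) = (1 + |z|)^p * T\<Phi>(x, w)\<close>. Multiplying the limit by
  \<open>(1 - |w|)^p\<close> cancels this weight, so the part over the ball has marginal exactly
  \<open>\<mu>\<close> (carried along the embedding) and its fibres are probabilities. The mass over
  the remainder may concentrate anywhere in the compactified domain and needs a measure of its own.
  One subsequence serves every \<open>\<Phi>\<close> because weak convergence of the lifted measures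
  is extracted, not convergence of single integrals.\<close>

lemma ternary_summable: "summable (\<lambda>n. of_bool (P n) / 3 ^ n :: real)"
proof (rule summable_comparison_test')
  show "summable (\<lambda>n. (1/3::real) ^ n)"
    by (rule summable_geometric) simp
  show "norm (of_bool (P n) / 3 ^ n :: real) \<le> (1/3) ^ n" if "n \<ge> 0" for n
    by (simp add: power_one_over)
qed

text \<open>Base 3 leaves gaps: the digits after position \<open>n\<close> contribute at most half
  of \<open>1 / 3 ^ n\<close>, so the first disagreement decides. In base 2 the tail could make up
  for the digit, and codes would not be injective.\<close>

lemma ternary_gap:
  assumes P: "\<And>m. m < n \<Longrightarrow> P m \<longleftrightarrow> Q m" and n: "P n" "\<not> Q n"
  shows "(\<Sum>m. of_bool (P m) / 3 ^ m :: real) - (\<Sum>m. of_bool (Q m) / 3 ^ m) \<ge> (1/3)^n / 2"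
proof -
  let ?f = "\<lambda>P m. of_bool (P m) / 3 ^ m :: real"
  \<comment> \<open>Worst case: \<open>P\<close> has no digit after \<open>n\<close>,
    \<open>Q\<close> has all of them.\<close>
  have "(\<Sum>m. ?f (\<lambda>m. m < n \<and> P m \<or> m = n) m) \<le> (\<Sum>m. ?f P m)"
    by (intro suminf_le ternary_summable) (auto simp: n)
  moreover have "(\<Sum>m. ?f Q m) \<le> (\<Sum>m. ?f (\<lambda>m. m < n \<and> P m \<or> m > n) m)"
    by (intro suminf_le ternary_summable) (auto simp: P n linorder_neq_iff)
  moreover have "(\<Sum>m. ?f (\<lambda>m. m < n \<and> P m \<or> m = n) m) = (\<Sum>m<n. ?f P m) + 1/3^n"
    by (subst suminf_finite[of "{..n}"]) (auto simp: lessThan_Suc_atMost[symmetric])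
  moreover have "(\<Sum>m. ?f (\<lambda>m. m < n \<and> P m \<or> m > n) m) = (\<Sum>m<n. ?f P m) + (1/3)^n/2"
  proof -
    have "(\<Sum>m. ?f (\<lambda>m. m < n \<and> P m \<or> m > n) m) =
      (\<Sum>m. ?f (\<lambda>m. m < n \<and> P m \<or> m > n) (m + Suc n)) + (\<Sum>m<Suc n. ?f (\<lambda>m. m < n \<and> P m \<or> m > n) m)"
      by (rule suminf_split_initial_segment[OF ternary_summable])
    also have "(\<Sum>m<Suc n. ?f (\<lambda>m. m < n \<and> P m \<or> m > n) m) = (\<Sum>m<n. ?f P m)"
      by simp
    also have "(\<Sum>m. ?f (\<lambda>m. m < n \<and> P m \<or> m > n) (m + Suc n)) = (\<Sum>m. (1/3)^Suc n * (1/3)^m)"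
      by (simp add: power_add power_one_over mult.commute mult.left_commute)
    also have "\<dots> = (1/3)^Suc n * (1 / (1 - 1/3))"
      by (subst suminf_mult) (auto intro!: summable_geometric simp: suminf_geometric)
    finally show ?thesis by simp
  qed
  ultimately show ?thesis by (simp add: power_one_over)
qed

text \<open>At the least disagreeing position \<open>n \<le> m \<le> N\<close> the gap would be at
  least \<open>(1/3)^n / 2\<close>, which is no smaller than the allowed distance.\<close>

lemma ternary_close_imp_eq:
  assumes "\<bar>(\<Sum>m. of_bool (P m) / 3 ^ m) - (\<Sum>m. of_bool (Q m) / 3 ^ m)\<bar> < (1/3::real) ^ N / 2"
    and "m \<le> N"
  shows "P m \<longleftrightarrow> Q m"
proof (rule ccontr)
  assume neq: "P m \<noteq> Q m"
  define n where "n = (LEAST m. P m \<noteq> Q m)"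
  have n: "P n \<noteq> Q n" unfolding n_def using neq by (rule LeastI)
  have nm: "n \<le> m" unfolding n_def using neq by (rule Least_le)
  have eq: "P k \<longleftrightarrow> Q k" if "k < n" for k
    using not_less_Least[of k "\<lambda>m. P m \<noteq> Q m"] that by (auto simp: n_def)
  have "(1/3::real)^N \<le> (1/3)^n"
    using nm assms(2) by (intro power_decreasing) auto
  moreover have "(1/3)^n / 2 \<le> \<bar>(\<Sum>m. of_bool (P m) / 3 ^ m) - (\<Sum>m. of_bool (Q m) / 3 ^ m) :: real\<bar>"
  proof (cases "P n")
    case True
    then show ?thesis using ternary_gap[of n P Q, OF eq True] n by linarith
  next
    case False
    then have "Q n" using n by simp
    then show ?thesis using ternary_gap[of n Q P, OF eq[symmetric] \<open>Q n\<close> False] by linarith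
  qed
  ultimately show False using assms(1) by linarith
qed

text \<open>The \<open>n\<close>-th ternary digit of the code of \<open>x\<close> records whether \<open>x\<close> lies in the \<open>n\<close>-th basic open
  set.  Close codes agree on many digits, and finitely many small basic sets cover \<open>S\<close>, so the
  decoding is uniformly continuous and extends to the closure of the set of codes.\<close>

lemma compact_real_coding:
  fixes S :: "'a::{complete_space, second_countable_topology} set"
  assumes S: "compact S"
  obtains b :: "'a \<Rightarrow> real" and c C where "b \<in> borel_measurable borel" "compact C" "b ` S \<subseteq> C"
    "continuous_on C c" "c ` C \<subseteq> S" "\<And>x. x \<in> S \<Longrightarrow> c (b x) = x"
proof -
  obtain B :: "'a set set" where B: "countable B" "topological_basis B"
    using ex_countable_basis by blast
  \<comment> \<open>Adding \<open>{}\<close> makes the enumerated set visibly nonempty; it only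
    contributes digits 0.\<close>
  define U where "U = from_nat_into (insert {} B)"
  have rU: "range U = insert {} B"
    unfolding U_def using B(1) by (intro range_from_nat_into) auto
  have oU: "open (U n)" for n
    using rU B(2) topological_basis_open[OF B(2)] by (metis insertE open_empty rangeI)
  define b where "b x = (\<Sum>n. of_bool (x \<in> U n) / 3 ^ n :: real)" for x
  have meas: "b \<in> borel_measurable borel"
  proof -
    have "(\<lambda>x. of_bool (x \<in> U n) / 3 ^ n :: real) \<in> borel_measurable borel" for n
    proof -
      have "(\<lambda>x. indicator (U n) x / 3 ^ n :: real) \<in> borel_measurable borel"
        using borel_open[OF oU, of n] by measurable
      then show ?thesis by (simp add: indicator_def of_bool_def)
    qed
    then show ?thesis unfolding b_def by (intro borel_measurable_suminf)
  qed
  have b_range: "b x \<in> {0..3/2}" for x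
  proof -
    have "b x \<le> (\<Sum>n. (1/3)^n)"
      unfolding b_def by (intro suminf_le ternary_summable summable_geometric) (auto simp: power_one_over)
    then show ?thesis
      using suminf_nonneg[OF ternary_summable[of "\<lambda>n. x \<in> U n"]]
      by (simp add: suminf_geometric b_def)
  qed
  have key: "\<exists>d>0. \<forall>x\<in>S. \<forall>y\<in>S. \<bar>b x - b y\<bar> < d \<longrightarrow> dist x y < e" if "e > 0" for e
  proof -
    define I where "I = {n. \<forall>x\<in>U n. \<forall>y\<in>U n. dist x y < e}"
    have "S \<subseteq> (\<Union>n\<in>I. U n)"
    proof
      fix x assume "x \<in> S"
      obtain V where V: "V \<in> B" "x \<in> V" "V \<subseteq> ball x (e/2)"
        using topological_basisE[OF B(2), of "ball x (e/2)" x] \<open>e > 0\<close> by auto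
      then obtain n where n: "U n = V" using rU by (metis insertI2 rangeE)
      have "dist y z < e" if "y \<in> V" "z \<in> V" for y z
        using V(3) that dist_triangle_half_r[of x y e z] by (auto simp: subset_iff)
      then have "n \<in> I" by (auto simp: I_def n)
      then show "x \<in> (\<Union>n\<in>I. U n)" using n V by auto
    qed
    then obtain J where J: "J \<subseteq> I" "finite J" "S \<subseteq> (\<Union>n\<in>J. U n)"
      using compactE_image[OF S, of I U] oU by metis
    define N where "N = Max (insert 0 J)"
    have N: "n \<le> N" if "n \<in> J" for n using J(2) that by (simp add: N_def)
    show ?thesis
    proof (intro exI[of _ "(1/3)^N/2"] conjI ballI impI)
      fix x y assume xy: "x \<in> S" "y \<in> S" "\<bar>b x - b y\<bar> < (1/3)^N/2"
      obtain n where n: "n \<in> J" "x \<in> U n" using J xy by blast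
      have "y \<in> U n"
        using ternary_close_imp_eq[of "\<lambda>n. x \<in> U n" "\<lambda>n. y \<in> U n" N n] xy(3) N n by (simp add: b_def)
      then show "dist x y < e" using n J by (auto simp: I_def)
    qed auto
  qed
  have inj: "inj_on b S"
  proof (rule inj_onI, rule ccontr)
    fix x y assume xy: "x \<in> S" "y \<in> S" "b x = b y" "x \<noteq> y"
    then show False using key[of "dist x y"] by force
  qed
  have "uniformly_continuous_on (b ` S) (the_inv_into S b)"
    unfolding uniformly_continuous_on_def
  proof (intro allI impI)
    fix e :: real assume "e > 0"
    from key[OF this] obtain d where d: "d > 0" "\<forall>x\<in>S. \<forall>y\<in>S. \<bar>b x - b y\<bar> < d \<longrightarrow> dist x y < e" by blast
    then show "\<exists>d>0. \<forall>x\<in>b ` S. \<forall>x'\<in>b ` S. dist x' x < d \<longrightarrow>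
        dist (the_inv_into S b x') (the_inv_into S b x) < e"
      by (intro exI[of _ d]) (auto simp: the_inv_into_f_f[OF inj] dist_real_def)
  qed
  \<comment> \<open>Completeness of the target lets the uniformly continuous decoding extend to the
    closure of the codes; \<open>S\<close> is closed, so the extension still takes values in
    \<open>S\<close>.\<close>
  then obtain c where c: "uniformly_continuous_on (closure (b ` S)) c"
    "\<And>t. t \<in> b ` S \<Longrightarrow> the_inv_into S b t = c t"
    using uniformly_continuous_on_extension_on_closure by metis
  have cb: "c (b x) = x" if "x \<in> S" for x
    using c(2)[of "b x"] that the_inv_into_f_f[OF inj that] by auto
  have "bounded (b ` S)"
    by (rule bounded_subset[of "{0..3/2}"]) (use b_range in auto)
  then have "compact (closure (b ` S))" by (simp add: compact_closure)
  moreover have "continuous_on (closure (b ` S)) c"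
    by (rule uniformly_continuous_imp_continuous[OF c(1)])
  moreover have "c ` closure (b ` S) \<subseteq> S"
    by (rule image_closure_subset) (use calculation cb compact_imp_closed[OF S] in auto)
  ultimately show thesis
    by (intro that[of b "closure (b ` S)" c] meas cb closure_subset)
qed

text \<open>The measures are pushed to the line by the Borel coding \<open>b\<close>, Helly
  selection is applied there, and the limit is pulled back by the decoding. For a test function
  \<open>g\<close>, the function \<open>g \<circ> c\<close> is continuous on \<open>C\<close> and
  Tietze extends it to a bounded continuous \<open>h\<close> on the line; \<open>h \<circ> b\<close>
  agrees with \<open>g\<close> on \<open>S\<close>, so the discontinuity of \<open>b\<close> does no
  harm.\<close>

lemma prob_measures_on_compact_weakly_convergent_subseq:
  fixes S :: "'a::{complete_space, second_countable_topology} set"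
  assumes S: "compact S" and P: "\<And>k. prob_space (P k)" and sets_P: "\<And>k. sets (P k) = sets borel"
    and PS: "\<And>k. AE x in P k. x \<in> S"
  shows "\<exists>r Q. strict_mono (r :: nat \<Rightarrow> nat) \<and> prob_space Q \<and> sets Q = sets borel \<and> (AE x in Q. x \<in> S) \<and>
    (\<forall>g :: 'a \<Rightarrow> real. continuous_on S g \<longrightarrow>
      (\<lambda>k. LINT x:S|P (r k). g x) \<longlonglongrightarrow> (LINT x:S|Q. g x))"
proof -
  obtain b :: "'a \<Rightarrow> real" and c C where bc: "b \<in> borel_measurable borel" "compact C" "b ` S \<subseteq> C"
    "continuous_on C c" "c ` C \<subseteq> S" "\<And>x. x \<in> S \<Longrightarrow> c (b x) = x"
    using compact_real_coding[OF S] by metis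
  have b [measurable]: "b \<in> borel_measurable (P k)" for k
    using bc(1) sets_P by (simp cong: measurable_cong_sets)
  have [measurable]: "S \<in> sets borel" "C \<in> sets borel"
    using S bc(2) by (auto intro: borel_compact)
  have S_meas [measurable]: "S \<in> sets (P k)" for k using sets_P by simp
  define R where "R k = distr (P k) borel b" for k
  have R: "real_distribution (R k)" for k
    unfolding R_def by (rule prob_space.real_distribution_distr[OF P b])
  have R_C: "AE t in R k. t \<in> C" for k
    unfolding R_def using PS[of k] bc(3) by (subst AE_distr_iff) auto
  \<comment> \<open>Tightness is immediate: all images are carried by the one compact set
    \<open>C\<close>.\<close>
  have "tight R"
    unfolding tight_def
  proof (intro conjI allI impI R)
    fix e :: real assume "e > 0"
    obtain B where B: "\<And>t. t \<in> C \<Longrightarrow> \<bar>t\<bar> \<le> B"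
      using compact_imp_bounded[OF bc(2)] by (auto simp: bounded_iff)
    show "\<exists>a b. a < b \<and> (\<forall>n. 1 - e < measure (R n) {a<..b})"
    proof (rule exI[of _ "-\<bar>B\<bar>-1"], rule exI[of _ "\<bar>B\<bar>+1"], intro conjI allI)
      fix n
      interpret R: real_distribution "R n" by (rule R)
      have "AE t in R n. t \<in> {-\<bar>B\<bar>-1<..\<bar>B\<bar>+1}"
        using R_C[of n] by eventually_elim (use B in fastforce)
      then have "measure (R n) {-\<bar>B\<bar>-1<..\<bar>B\<bar>+1} = 1"
        by (subst R.prob_eq_1) (auto simp: R_def)
      then show "1 - e < measure (R n) {-\<bar>B\<bar>-1<..\<bar>B\<bar>+1}" using \<open>e > 0\<close> by simp
    qed auto
  qed
  from tight_imp_convergent_subsubsequence[OF this strict_mono_id]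
  obtain r N where r: "strict_mono (r :: nat \<Rightarrow> nat)" and N: "real_distribution N"
    and conv: "weak_conv_m (R \<circ> id \<circ> r) N" by blast
  interpret N: real_distribution N by (rule N)
  have conv: "(\<lambda>k. integral\<^sup>L (R (r k)) h) \<longlonglongrightarrow> integral\<^sup>L N h"
    if "continuous_on UNIV h" "\<And>t. norm (h t) \<le> B" for h :: "real \<Rightarrow> real" and B
    using weak_conv_imp_integral_bdd_continuous_conv[of "R \<circ> id \<circ> r" N h B] R N conv that
    by (auto simp: continuous_on_eq_continuous_at)
  have C_ne: "C \<noteq> {}"
  proof
    assume "C = {}"
    interpret R0: real_distribution "R 0" by (rule R)
    show False using R0.AE_False R_C[of 0] \<open>C = {}\<close> by simp
  qed
  have N_C: "AE t in N. t \<in> C"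
  proof -
    \<comment> \<open>The truncated distance to \<open>C\<close> is a bounded continuous test
      function with integral 0 against every \<open>R k\<close>, hence against the limit.\<close>
    define h where "h t = min 1 (infdist t C)" for t
    have cont_h: "continuous_on UNIV h" unfolding h_def by (intro continuous_intros)
    have h_bd: "0 \<le> h t" "h t \<le> 1" for t by (auto simp: h_def infdist_nonneg)
    have "integral\<^sup>L (R k) h = 0" for k
      by (rule integral_eq_zero_AE) (use R_C[of k] in \<open>auto simp: h_def\<close>)
    then have "integral\<^sup>L N h = 0"
      using LIMSEQ_unique[OF conv[OF cont_h, of 1]] h_bd by (simp add: abs_le_iff)
    moreover have "integrable N h"
      by (rule N.integrable_const_bound[of _ 1])
        (use h_bd borel_measurable_continuous_onI[OF cont_h] in auto)
    ultimately have "AE t in N. h t = 0"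
      using h_bd by (subst (asm) integral_nonneg_eq_0_iff_AE) auto
    then show ?thesis
    proof eventually_elim
      case (elim t)
      then have "infdist t C = 0" by (auto simp: h_def min_def split: if_splits)
      then show "t \<in> C"
        using in_closed_iff_infdist_zero[OF compact_imp_closed[OF bc(2)] C_ne] by simp
    qed
  qed
  obtain s0 where s0: "s0 \<in> S" using C_ne bc(5) by blast
  \<comment> \<open>The arbitrary value \<open>s0\<close> off \<open>C\<close> gives a Borel map on
    the whole line with all values in \<open>S\<close>.\<close>
  define c' where "c' t = (if t \<in> C then c t else s0)" for t
  have c' [measurable]: "c' \<in> borel_measurable borel"
    unfolding c'_def
    by (rule borel_measurable_continuous_on_if) (use bc(4) in \<open>auto intro: continuous_on_const\<close>)
  have c'_S: "c' t \<in> S" for t using bc(5) s0 by (auto simp: c'_def)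
  have c'_b: "c' (b x) = x" if "x \<in> S" for x using that bc(3,6) by (auto simp: c'_def)
  have c'_N: "c' \<in> borel_measurable N" by simp
  define Q where "Q = distr N borel c'"
  have "(\<lambda>k. LINT x:S|P (r k). g x) \<longlonglongrightarrow> (LINT x:S|Q. g x)"
    if g: "continuous_on S g" for g :: "'a \<Rightarrow> real"
  proof -
    have gS [measurable]: "(\<lambda>x. indicator S x *\<^sub>R g x) \<in> borel_measurable borel"
      using borel_measurable_continuous_on_indicator[OF _ g] by simp
    have "compact (g ` S)" by (rule compact_continuous_image[OF g S])
    then obtain B where B: "\<And>x. x \<in> S \<Longrightarrow> \<bar>g x\<bar> \<le> B"
      using compact_imp_bounded by (force simp: bounded_iff)
    have "B \<ge> 0" using B[OF s0] by simp
    have gc: "continuous_on C (g \<circ> c)"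
      using bc(4,5) g continuous_on_subset by (intro continuous_on_compose) auto
    have C_closed: "closedin (top_of_set UNIV) C" using compact_imp_closed[OF bc(2)] by simp
    have gc_bd: "norm ((g \<circ> c) t) \<le> B" if "t \<in> C" for t using that bc(5) B by auto
    obtain h where h: "continuous_on UNIV h"
      "\<And>t. t \<in> C \<Longrightarrow> h t = (g \<circ> c) t" and h_bd: "\<And>t. t \<in> UNIV \<Longrightarrow> norm (h t) \<le> B"
      by (rule Tietze[OF gc C_closed \<open>B \<ge> 0\<close> gc_bd]) (assumption, rule that)
    have [measurable]: "h \<in> borel_measurable borel" by (rule borel_measurable_continuous_onI[OF h(1)])
    have "(LINT x:S|P k. g x) = integral\<^sup>L (R k) h" for k
    proof -
      have "integral\<^sup>L (R k) h = (LINT x|P k. h (b x))"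
        unfolding R_def by (rule integral_distr) auto
      also have "\<dots> = (LINT x|P k. indicator S x *\<^sub>R g x)"
      proof (rule integral_cong_AE)
        show "(\<lambda>x. indicator S x *\<^sub>R g x) \<in> borel_measurable (P k)"
          using gS sets_P by (simp cong: measurable_cong_sets)
        show "AE x in P k. h (b x) = indicator S x *\<^sub>R g x"
          using PS[of k] by eventually_elim (use h(2) bc(3,6) in auto)
      qed measurable
      finally show ?thesis by (simp add: set_lebesgue_integral_def)
    qed
    moreover have "(LINT x:S|Q. g x) = integral\<^sup>L N h"
    proof -
      have "(LINT x:S|Q. g x) = (LINT t|N. indicator S (c' t) *\<^sub>R g (c' t))"
        unfolding Q_def set_lebesgue_integral_def by (rule integral_distr[OF c'_N gS])
      also have "\<dots> = integral\<^sup>L N h"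
      proof (rule integral_cong_AE)
        show "(\<lambda>t. indicator S (c' t) *\<^sub>R g (c' t)) \<in> borel_measurable N"
          using measurable_compose[OF c' gS] by simp
        show "AE t in N. indicator S (c' t) *\<^sub>R g (c' t) = h t"
          using N_C
        proof eventually_elim
          case (elim t)
          then show ?case using h(2) c'_S[of t] by (simp add: c'_def)
        qed
      qed simp
      finally show ?thesis .
    qed
    ultimately show ?thesis using conv[OF h(1) h_bd] by simp
  qed
  moreover have "prob_space Q" unfolding Q_def by (rule N.prob_space_distr[OF c'_N])
  moreover have "AE x in Q. x \<in> S"
    unfolding Q_def using c'_S by (subst AE_distr_iff[OF c'_N]) auto
  ultimately show ?thesis
    using r by (intro exI[of _ r] exI[of _ Q]) (auto simp: Q_def)
qed

text \<open>The total masses lie in \<open>{0..B}\<close>, so they converge to some \<open>m\<close>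
  along a subsequence. For \<open>m > 0\<close> the normalised measures reduce to the probability
  case; for \<open>m = 0\<close> no normalisation is possible, but every integral tends to 0 and the
  null measure is the limit.\<close>

lemma finite_measures_on_compact_weakly_convergent_subseq:
  fixes S :: "'a::{complete_space, second_countable_topology} set"
  assumes S: "compact S" and P: "\<And>k. finite_measure (P k)" and sets_P: "\<And>k. sets (P k) = sets borel"
    and PS: "\<And>k. AE x in P k. x \<in> S" and mass: "\<And>k. measure (P k) UNIV \<le> B"
  shows "\<exists>r Q. strict_mono (r :: nat \<Rightarrow> nat) \<and> finite_measure Q \<and> sets Q = sets borel \<and> (AE x in Q. x \<in> S) \<and>
    (\<forall>g :: 'a \<Rightarrow> real. continuous_on S g \<longrightarrow>
      (\<lambda>k. LINT x:S|P (r k). g x) \<longlonglongrightarrow> (LINT x:S|Q. g x))"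
proof -
  define M where "M k = measure (P k) UNIV" for k
  have "compact {0..B}" by simp
  then obtain m r where r: "strict_mono (r :: nat \<Rightarrow> nat)" and m: "(M \<circ> r) \<longlonglongrightarrow> m"
    using mass by (auto simp: compact_eq_seq_compact_metric seq_compact_def M_def dest!: spec[of _ M])
  have space_P: "space (P k) = UNIV" for k using sets_eq_imp_space_eq[OF sets_P] by simp
  have "m \<ge> 0" using m by (rule LIMSEQ_le_const) (auto simp: M_def)
  have [measurable]: "S \<in> sets borel" using S by (auto intro: borel_compact)
  have gS: "(\<lambda>x. indicator S x *\<^sub>R g x) \<in> borel_measurable borel"
    if "continuous_on S g" for g :: "'a \<Rightarrow> real"
    using borel_measurable_continuous_on_indicator[OF _ that] by simp
  show ?thesis
  proof (cases "m = 0")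
    case True
    have "(\<lambda>k. LINT x:S|P (r k). g x) \<longlonglongrightarrow> 0" if g: "continuous_on S g" for g :: "'a \<Rightarrow> real"
    proof -
      have "compact (g ` S)" by (rule compact_continuous_image[OF g S])
      then obtain C where C: "\<And>x. x \<in> S \<Longrightarrow> \<bar>g x\<bar> \<le> C"
        using compact_imp_bounded by (force simp: bounded_iff)
      have bound: "\<bar>LINT x:S|P k. g x\<bar> \<le> \<bar>C\<bar> * M k" for k
      proof -
        interpret finite_measure "P k" by (rule P)
        have meas: "(\<lambda>x. indicator S x *\<^sub>R g x) \<in> borel_measurable (P k)"
          using gS[OF g] sets_P by (simp cong: measurable_cong_sets)
        have bd: "norm (indicator S x *\<^sub>R g x) \<le> \<bar>C\<bar>" for x
          using C[of x] by (auto simp: indicator_def)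
        have int: "integrable (P k) (\<lambda>x. indicator S x *\<^sub>R g x)"
          by (rule integrable_const_bound[OF _ meas]) (use bd in auto)
        have "norm (LINT x:S|P k. g x) \<le> (LINT x|P k. norm (indicator S x *\<^sub>R g x))"
          unfolding set_lebesgue_integral_def by (rule integral_norm_bound)
        also have "\<dots> \<le> (LINT x|P k. \<bar>C\<bar>)"
          by (intro integral_mono integrable_norm int bd) simp
        finally show ?thesis by (simp add: M_def space_P mult.commute)
      qed
      have lim: "(\<lambda>k. \<bar>C\<bar> * M (r k)) \<longlonglongrightarrow> 0"
        using tendsto_mult_right_zero[of "M \<circ> r" sequentially "\<bar>C\<bar>"] m True by (simp add: o_def)
      show ?thesis
        by (rule Lim_null_comparison[OF _ lim]) (simp add: bound)
    qed
    then show ?thesis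
      using r by (intro exI[of _ r] exI[of _ "null_measure borel"])
        (auto simp: set_lebesgue_integral_def AE_iff_null intro!: finite_measureI)
  next
    case False
    then have "m > 0" using \<open>m \<ge> 0\<close> by simp
    then have "\<forall>\<^sub>F k in sequentially. M (r k) > 0"
      using m order_tendstoD(1)[of "M \<circ> r" m sequentially 0] by (simp add: o_def)
    then obtain K where K: "M (r k) > 0" if "k \<ge> K" for k by (auto simp: eventually_sequentially)
    \<comment> \<open>The masses are known to be positive only from index \<open>K\<close> on; the
      shift makes every normalising factor legitimate.\<close>
    define r' where "r' k = r (k + K)" for k
    have r': "strict_mono r'" using r by (auto simp: r'_def strict_mono_def)
    have M_pos: "M (r' k) > 0" for k using K by (simp add: r'_def)
    have m': "(\<lambda>k. M (r' k)) \<longlonglongrightarrow> m"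
      using LIMSEQ_ignore_initial_segment[OF m, of K] by (simp add: r'_def)
    define R where "R k = scale_measure (1 / M (r' k)) (P (r' k))" for k
    have R: "prob_space (R k)" for k
    proof
      interpret finite_measure "P (r' k)" by (rule P)
      show "emeasure (R k) (space (R k)) = 1"
        using M_pos[of k] by (simp add: R_def space_scale_measure space_P emeasure_eq_measure
            ennreal_mult[symmetric] M_def)
    qed
    have sets_R: "sets (R k) = sets borel" for k by (simp add: R_def sets_P)
    have R_S: "AE x in R k. x \<in> S" for k
    proof -
      have "{x. x \<notin> S} \<in> null_sets (P (r' k))"
        using PS[of "r' k"] by (subst (asm) AE_iff_null) (auto simp: space_P sets_P)
      then show ?thesis
        by (intro AE_I'[of "{x. x \<notin> S}"]) (auto simp: R_def null_sets_def)
    qed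
    obtain s Q where s: "strict_mono (s :: nat \<Rightarrow> nat)" and Q: "prob_space Q" "sets Q = sets borel" "AE x in Q. x \<in> S"
      and conv: "\<And>g :: 'a \<Rightarrow> real. continuous_on S g \<Longrightarrow>
        (\<lambda>k. LINT x:S|R (s k). g x) \<longlonglongrightarrow> (LINT x:S|Q. g x)"
      using prob_measures_on_compact_weakly_convergent_subseq[of S R, OF S R sets_R R_S] by metis
    have scale: "(LINT x:S|scale_measure (ennreal a) N. g x) = a * (LINT x:S|N. g x)"
      if "continuous_on S g" "a \<ge> 0" "sets N = sets borel" for g :: "'a \<Rightarrow> real" and a N
    proof -
      have "scale_measure (ennreal a) N = density N (\<lambda>_. ennreal a)"
        by (rule measure_eqI) (auto simp: emeasure_density_const)
      then show ?thesis
        using gS[OF that(1)] that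
        by (simp add: set_lebesgue_integral_def integral_density cong: measurable_cong_sets)
    qed
    define Q' where "Q' = scale_measure (ennreal m) Q"
    have "finite_measure Q'"
    proof
      interpret prob_space Q by (rule Q)
      show "emeasure Q' (space Q') \<noteq> \<infinity>"
        by (simp add: Q'_def space_scale_measure emeasure_space_1)
    qed
    moreover have "AE x in Q'. x \<in> S"
    proof -
      have "{x. x \<notin> S} \<in> null_sets Q"
        using Q(3) sets_eq_imp_space_eq[OF Q(2)] Q(2) by (subst (asm) AE_iff_null) auto
      then show ?thesis
        by (intro AE_I'[of "{x. x \<notin> S}"]) (auto simp: Q'_def null_sets_def)
    qed
    moreover have "(\<lambda>k. LINT x:S|P (r' (s k)). g x) \<longlonglongrightarrow> (LINT x:S|Q'. g x)"
      if g: "continuous_on S g" for g :: "'a \<Rightarrow> real"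
    proof -
      have "(\<lambda>k. M (r' (s k)) * (LINT x:S|R (s k). g x)) \<longlonglongrightarrow> m * (LINT x:S|Q. g x)"
        using LIMSEQ_subseq_LIMSEQ[OF m' s] by (intro tendsto_mult conv g) (simp add: o_def)
      moreover have "M (r' (s k)) * (LINT x:S|R (s k). g x) = (LINT x:S|P (r' (s k)). g x)" for k
        unfolding R_def using M_pos[of "s k"] by (subst scale) (auto simp: g sets_P)
      ultimately show ?thesis
        unfolding Q'_def using g Q(2) \<open>m > 0\<close> by (subst scale) auto
    qed
    ultimately show ?thesis
      using strict_mono_compose[OF r' s] Q(2)
      by (intro exI[of _ "r' \<circ> s"] exI[of _ Q'] conjI allI impI) (simp_all add: Q'_def o_def)
  qed
qed

section \<open>Disintegration\<close>

text \<open>Conditional distribution functions are controlled off a null set only at countably many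
  points, so they are first given on the rationals. The infimum over strictly larger rationals is
  right-continuous by construction, and \<open>right\<close> prevents it from exceeding
  \<open>\<rho>\<close> at a rational point.\<close>

lemma rational_cdf_extension:
  fixes \<rho> :: "rat \<Rightarrow> real"
  assumes mono: "\<And>q q'. q \<le> q' \<Longrightarrow> \<rho> q \<le> \<rho> q'"
    and bot: "\<And>e. e > 0 \<Longrightarrow> \<exists>q. \<rho> q < e" and top: "\<And>e. e > 0 \<Longrightarrow> \<exists>q. \<rho> q > 1 - e"
    and bounds: "\<And>q. 0 \<le> \<rho> q" "\<And>q. \<rho> q \<le> 1"
    and right: "\<And>q e. e > 0 \<Longrightarrow> \<exists>q'>q. \<rho> q' < \<rho> q + e"
  defines "F \<equiv> \<lambda>t::real. INF q\<in>{q. t < of_rat q}. \<rho> q"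
  shows "\<And>s t. s \<le> t \<Longrightarrow> F s \<le> F t" "\<And>t. continuous (at_right t) F"
    "(F \<longlongrightarrow> 0) at_bot" "(F \<longlongrightarrow> 1) at_top" "\<And>q. F (of_rat q) = \<rho> q"
proof -
  have ne: "{q. t < of_rat q} \<noteq> {}" for t :: real
    using of_rat_dense[of t "t + 1"] by auto
  have bdd: "bdd_below (\<rho> ` A)" for A using bounds by (intro bdd_belowI[of _ 0]) auto
  have lower: "F t \<le> \<rho> q" if "t < of_rat q" for t q
    unfolding F_def by (intro cINF_lower bdd) (use that in auto)
  have greater: "c \<le> F t" if "\<And>q. t < of_rat q \<Longrightarrow> c \<le> \<rho> q" for c t
    unfolding F_def by (rule cINF_greatest[OF ne]) (simp add: that)
  have less: "\<exists>q. t < of_rat q \<and> \<rho> q < c" if "F t < c" for t c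
    using greater[of t c] that by (auto simp: not_less[symmetric])
  show F_mono: "F s \<le> F t" if "s \<le> t" for s t
    by (rule greater) (use that in \<open>auto intro!: lower\<close>)
  show F_rat: "F (of_rat q) = \<rho> q" for q
  proof (rule antisym)
    show "\<rho> q \<le> F (of_rat q)" by (rule greater) (auto simp: of_rat_less intro: mono)
    show "F (of_rat q) \<le> \<rho> q"
    proof (rule field_le_epsilon)
      fix e :: real assume "e > 0"
      from right[OF this, of q] obtain q' where "q' > q" "\<rho> q' < \<rho> q + e" by auto
      then show "F (of_rat q) \<le> \<rho> q + e" using lower[of "of_rat q" q'] by (simp add: of_rat_less)
    qed
  qed
  have F_bounds: "0 \<le> F t" "F t \<le> 1" for t :: real
  proof -
    show "0 \<le> F t" by (rule greater) (rule bounds)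
    obtain q where "t < of_rat q" using ne[of t] by auto
    then show "F t \<le> 1" using lower bounds(2) order_trans by blast
  qed
  show "continuous (at_right t) F" for t
    unfolding continuous_within
  proof (rule order_tendstoI)
    fix a assume a: "a < F t"
    have "a < F s" if "t < s" for s using F_mono[of t s] that a by simp
    then show "\<forall>\<^sub>F s in at_right t. a < F s" by (simp add: eventually_at_filter)
  next
    fix a assume "F t < a"
    then obtain q where q: "t < of_rat q" "\<rho> q < a" using less by blast
    have "F s < a" if "s < of_rat q" for s using lower[OF that] q(2) by simp
    then show "\<forall>\<^sub>F s in at_right t. F s < a"
      using eventually_at_right[OF q(1)] q(1) by blast
  qed
  show "(F \<longlongrightarrow> 0) at_bot"
  proof (rule order_tendstoI)
    fix a :: real assume "a < 0"
    then have "a < F s" for s using F_bounds(1)[of s] by simp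
    then show "\<forall>\<^sub>F s in at_bot. a < F s" by simp
  next
    fix a :: real assume "0 < a"
    from bot[OF this] obtain q where q: "\<rho> q < a" by blast
    show "\<forall>\<^sub>F s in at_bot. F s < a"
      using eventually_le_at_bot[of "of_rat q :: real"]
    proof eventually_elim
      case (elim s)
      then show ?case using F_mono[OF elim] F_rat[of q] q by simp
    qed
  qed
  show "(F \<longlongrightarrow> 1) at_top"
  proof (rule order_tendstoI)
    fix a :: real assume "1 < a"
    then have "F s < a" for s using F_bounds(2)[of s] by simp
    then show "\<forall>\<^sub>F s in at_top. F s < a" by simp
  next
    fix a :: real assume "a < 1"
    with top[of "1 - a"] obtain q where q: "\<rho> q > a" by auto
    show "\<forall>\<^sub>F s in at_top. a < F s"
      using eventually_ge_at_top[of "of_rat q :: real"]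
    proof eventually_elim
      case (elim s)
      then show ?case using F_mono[OF elim] F_rat[of q] q by simp
    qed
  qed
qed

text \<open>Half-lines with rational endpoints are closed under intersection, and every
  \<open>{..t}\<close> is a countable intersection of them, so they form a generator on which finite
  measures can be compared.\<close>

lemma real_measure_eqI_rat:
  fixes M N :: "real measure"
  assumes M: "finite_measure M" "sets M = sets borel" and N: "sets N = sets borel"
    and eq: "\<And>q. emeasure M {..of_rat q} = emeasure N {..of_rat q}"
  shows "M = N"
proof -
  interpret finite_measure M by (rule M)
  define E where "E = range (\<lambda>q. {..of_rat q :: real})"
  have E: "(borel :: real measure) = sigma UNIV E"
    unfolding E_def
  proof (rule borel_eq_sigmaI1[OF borel_eq_atMost], clarify)
    fix t :: real
    interpret sigma_algebra UNIV "sigma_sets UNIV (range (\<lambda>q. {..of_rat q :: real}))"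
      by (rule sigma_algebra_sigma_sets) auto
    have "{..t} = (\<Inter>q\<in>{q. t < of_rat q}. {..of_rat q})"
    proof (intro equalityI subsetI)
      fix s assume "s \<in> (\<Inter>q\<in>{q. t < of_rat q}. {..of_rat q :: real})"
      then show "s \<in> {..t}"
        using of_rat_dense[of t s] by (force simp: not_le[symmetric])
    qed auto
    also have "\<dots> \<in> sigma_sets UNIV (range (\<lambda>q. {..of_rat q :: real}))"
      using of_rat_dense[of t "t + 1"] by (intro countable_INT'') auto
    finally show "{..t} \<in> sets (sigma UNIV (range (\<lambda>q. {..of_rat q :: real})))" by simp
  qed auto
  have "sets borel = sigma_sets UNIV E" by (subst E) (simp add: E_def)
  moreover have "Int_stable E"
    unfolding Int_stable_def E_def
    by (auto simp: image_iff min_def)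
  moreover have "\<Union>E = UNIV"
  proof -
    have "\<exists>q. t \<le> of_rat q" for t :: real using of_rat_dense[of t "t + 1"] by (auto intro: less_imp_le)
    then show ?thesis by (auto simp: E_def)
  qed
  ultimately show ?thesis
    using M(2) N eq by (intro measure_eqI_generator_eq_countable[of E UNIV M N E]) (auto simp: E_def)
qed

text \<open>Test the integral inequality on the set \<open>X\<close> where the pointwise one fails.
  There \<open>g\<close> lies below \<open>f\<close>, so its integral is finite, the subtraction is
  legitimate, and \<open>f - g\<close> has integral 0 on \<open>X\<close>.\<close>

lemma (in finite_measure) AE_le_of_set_nn_integral_le:
  assumes [measurable]: "f \<in> borel_measurable M" "g \<in> borel_measurable M"
    and fin: "(\<integral>\<^sup>+x. f x \<partial>M) \<noteq> \<infinity>"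
    and le: "\<And>X. X \<in> sets M \<Longrightarrow> (\<integral>\<^sup>+x. f x * indicator X x \<partial>M) \<le> (\<integral>\<^sup>+x. g x * indicator X x \<partial>M)"
  shows "AE x in M. f x \<le> (g x :: ennreal)"
proof -
  define X where "X = {x\<in>space M. g x < f x}"
  have [measurable]: "X \<in> sets M" unfolding X_def by measurable
  have fin_g: "(\<integral>\<^sup>+x. g x * indicator X x \<partial>M) \<noteq> \<infinity>"
  proof -
    have "(\<integral>\<^sup>+x. g x * indicator X x \<partial>M) \<le> (\<integral>\<^sup>+x. f x \<partial>M)"
      by (rule nn_integral_mono) (auto simp: X_def indicator_def)
    then show ?thesis using fin by (auto simp: top_unique)
  qed
  have "(\<integral>\<^sup>+x. f x * indicator X x - g x * indicator X x \<partial>M) =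
      (\<integral>\<^sup>+x. f x * indicator X x \<partial>M) - (\<integral>\<^sup>+x. g x * indicator X x \<partial>M)"
    by (rule nn_integral_diff) (use fin_g in \<open>auto simp: X_def indicator_def\<close>)
  also have "\<dots> = 0" using le[of X] fin_g by (intro diff_eq_0_ennreal) (auto simp: less_top[symmetric] top_unique)
  finally have "AE x in M. f x * indicator X x - g x * indicator X x = 0"
    by (subst (asm) nn_integral_0_iff_AE) auto
  then show ?thesis
  proof (rule AE_mp, intro AE_I2 impI)
    fix x assume "x \<in> space M" "f x * indicator X x - g x * indicator X x = 0"
    then show "f x \<le> g x"
      by (cases "x \<in> X") (auto simp: X_def ennreal_minus_eq_0)
  qed
qed


text \<open>The kernel is built from conditional distribution functions: \<open>\<rho> q\<close> is
  the Radon-Nikodym derivative of \<open>X \<mapsto> M (X \<times> {..q})\<close> with respect to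
  the first marginal. Only rational \<open>q\<close> are used, so all monotonicity and limit
  properties hold simultaneously off one null set.\<close>

lemma real_disintegration:
  fixes M :: "('a \<times> real) measure"
  assumes M: "finite_measure M" and sets_M: "sets M = sets (A \<Otimes>\<^sub>M borel)"
  shows "\<exists>\<kappa>\<in>A \<rightarrow>\<^sub>M prob_algebra borel. \<forall>X\<in>sets A. \<forall>Y\<in>sets borel.
    emeasure M (X \<times> Y) = (\<integral>\<^sup>+x. indicator X x * emeasure (\<kappa> x) Y \<partial>distr M A fst)"
proof -
  interpret M: finite_measure M by (rule M)
  have space_M: "space M = space A \<times> UNIV"
    using sets_eq_imp_space_eq[OF sets_M] by (simp add: space_pair_measure)
  have [measurable]: "fst \<in> M \<rightarrow>\<^sub>M A" "snd \<in> M \<rightarrow>\<^sub>M borel"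
    by (simp_all add: measurable_cong_sets[OF sets_M refl])
  define D where "D = distr M A fst"
  have sets_D [measurable_cong]: "sets D = sets A" by (simp add: D_def)
  have space_D: "space D = space A" by (simp add: D_def)
  interpret D: finite_measure D unfolding D_def by (rule M.finite_measure_distr) simp
  have rect: "X \<times> Y \<in> sets M" if "X \<in> sets A" "Y \<in> sets borel" for X Y using that sets_M by simp
  \<comment> \<open>The set function \<open>X \<mapsto> M (X \<times> Y)\<close>, written as a
    pushforward so that it is a measure by construction.\<close>
  define N where "N Y = distr (density M (\<lambda>p. indicator Y (snd p))) A fst" for Y
  have sets_N: "sets (N Y) = sets D" for Y by (simp add: N_def D_def)
  have N: "emeasure (N Y) X = emeasure M (X \<times> Y)"
    if [measurable]: "X \<in> sets A" "Y \<in> sets borel" for X Y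
  proof -
    have "emeasure (N Y) X = emeasure (density M (\<lambda>p. indicator Y (snd p))) (fst -` X \<inter> space M)"
      by (simp add: N_def emeasure_distr)
    also have "\<dots> = (\<integral>\<^sup>+p. indicator (X \<times> Y) p \<partial>M)"
      by (subst emeasure_density) (auto intro!: nn_integral_cong simp: indicator_def)
    also have "\<dots> = emeasure M (X \<times> Y)" using rect[OF that] by simp
    finally show ?thesis .
  qed
  have D: "emeasure D X = emeasure M (X \<times> UNIV)" if "X \<in> sets A" for X
    using that sets.sets_into_space[OF that]
    by (auto simp: D_def emeasure_distr space_M intro!: arg_cong[where f = "emeasure M"])
  have ac: "absolutely_continuous D (N Y)" if "Y \<in> sets borel" for Y
    unfolding absolutely_continuous_def
  proof
    fix X assume "X \<in> null_sets D"
    then have X: "X \<in> sets A" "emeasure M (X \<times> UNIV) = 0"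
      using D by (auto simp: null_sets_def sets_D)
    then have "emeasure M (X \<times> Y) \<le> 0"
      using emeasure_mono[of "X \<times> Y" "X \<times> UNIV" M] rect[of X UNIV] by auto
    then show "X \<in> null_sets (N Y)" using X N that by (auto simp: null_sets_def sets_N sets_D)
  qed

  \<comment> \<open>Conditional distribution functions at rational points\<close>
  define \<rho> where "\<rho> q = RN_deriv D (N {..of_rat q})" for q
  have \<rho>_meas [measurable]: "\<rho> q \<in> borel_measurable A" for q
    unfolding \<rho>_def by (simp add: measurable_cong_sets[OF sets_D[symmetric] refl])
  have \<rho>: "(\<integral>\<^sup>+x. \<rho> q x * indicator X x \<partial>D) = emeasure M (X \<times> {..of_rat q})" if "X \<in> sets A" for q X
  proof -
    have "emeasure (density D (\<rho> q)) X = emeasure (N {..of_rat q}) X"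
      unfolding \<rho>_def using D.density_RN_deriv[OF ac sets_N] by simp
    then show ?thesis using that N by (simp add: emeasure_density sets_D)
  qed
  have fin: "(\<integral>\<^sup>+x. \<rho> q x \<partial>D) \<noteq> \<infinity>" for q
    using \<rho>[of "space A" q] nn_integral_cong[of D "\<lambda>x. \<rho> q x * indicator (space A) x" "\<rho> q"]
    by (auto simp: space_D)
  have mono: "AE x in D. \<rho> q x \<le> \<rho> q' x" if "q \<le> q'" for q q'
  proof (rule D.AE_le_of_set_nn_integral_le[OF _ _ fin])
    fix X assume X: "X \<in> sets D"
    have "X \<times> {..of_rat q :: real} \<subseteq> X \<times> {..of_rat q'}"
      using that by (intro Sigma_mono) (simp_all add: of_rat_less_eq)
    then show "(\<integral>\<^sup>+x. \<rho> q x * indicator X x \<partial>D) \<le> (\<integral>\<^sup>+x. \<rho> q' x * indicator X x \<partial>D)"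
      using X by (simp add: \<rho> sets_D rect emeasure_mono)
  qed auto
  have le1: "AE x in D. \<rho> q x \<le> 1" for q
  proof (rule D.AE_le_of_set_nn_integral_le[OF _ _ fin])
    fix X assume X: "X \<in> sets D"
    have "emeasure M (X \<times> {..of_rat q}) \<le> emeasure M (X \<times> UNIV)"
      by (rule emeasure_mono) (use X in \<open>auto simp: rect sets_D\<close>)
    then show "(\<integral>\<^sup>+x. \<rho> q x * indicator X x \<partial>D) \<le> (\<integral>\<^sup>+x. 1 * indicator X x \<partial>D)"
      using X by (simp add: \<rho> sets_D D)
  qed auto
  have top: "AE x in D. 1 \<le> (SUP n. \<rho> (of_nat n) x)"
  proof (rule D.AE_le_of_set_nn_integral_le)
    fix X assume X: "X \<in> sets D"
    have "(\<integral>\<^sup>+x. 1 * indicator X x \<partial>D) = emeasure M (\<Union>n::nat. X \<times> {..of_rat (of_nat n)})"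
    proof -
      have "X \<times> UNIV = (\<Union>n::nat. X \<times> {..of_rat (of_nat n) :: real})"
        using real_arch_simple by auto
      then show ?thesis using X D by (simp add: sets_D)
    qed
    also have "\<dots> = (SUP n::nat. emeasure M (X \<times> {..of_rat (of_nat n)}))"
      using X rect by (intro SUP_emeasure_incseq[symmetric]) (auto simp: sets_D incseq_def)
    also have "\<dots> = (SUP n::nat. \<integral>\<^sup>+x. \<rho> (of_nat n) x * indicator X x \<partial>D)"
      using X by (simp add: \<rho> sets_D)
    \<comment> \<open>This direction holds for any sequence, which matters because
      \<open>\<rho>\<close> is monotone in its index only almost everywhere.\<close>
    also have "\<dots> \<le> (\<integral>\<^sup>+x. (SUP n. \<rho> (of_nat n) x) * indicator X x \<partial>D)"
      by (intro SUP_least nn_integral_mono mult_right_mono SUP_upper) auto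
    finally show "(\<integral>\<^sup>+x. 1 * indicator X x \<partial>D) \<le> (\<integral>\<^sup>+x. (SUP n. \<rho> (of_nat n) x) * indicator X x \<partial>D)" .
  qed auto
  have bot: "AE x in D. (INF n. \<rho> (- of_nat n) x) \<le> 0"
  proof (rule D.AE_le_of_set_nn_integral_le)
    fix X assume X: "X \<in> sets D"
    have "(\<integral>\<^sup>+x. (INF n. \<rho> (- of_nat n) x) * indicator X x \<partial>D) \<le> (INF n::nat. \<integral>\<^sup>+x. \<rho> (- of_nat n) x * indicator X x \<partial>D)"
      by (intro INF_greatest nn_integral_mono mult_right_mono INF_lower) auto
    also have "\<dots> = (INF n::nat. emeasure M (X \<times> {..of_rat (- of_nat n)}))"
      using X by (simp add: \<rho> sets_D)
    also have "\<dots> = emeasure M (\<Inter>n::nat. X \<times> {..of_rat (- of_nat n)})"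
      using X rect by (intro INF_emeasure_decseq) (auto simp: sets_D decseq_def of_rat_minus)
    also have "(\<Inter>n::nat. X \<times> {..of_rat (- of_nat n) :: real}) = {}"
    proof -
      have "\<exists>n. - real n < t" for t
        using reals_Archimedean2[of "-t"] by (simp add: minus_less_iff)
      then have "\<not> (\<forall>n. t \<le> - real n)" for t using leD by blast
      then show ?thesis by (auto simp: of_rat_minus)
    qed
    finally show "(\<integral>\<^sup>+x. (INF n. \<rho> (- of_nat n) x) * indicator X x \<partial>D) \<le> (\<integral>\<^sup>+x. 0 * indicator X x \<partial>D)"
      by simp
  next
    have "(\<integral>\<^sup>+x. (INF n. \<rho> (- of_nat n) x) \<partial>D) \<le> (\<integral>\<^sup>+x. \<rho> (- of_nat 0) x \<partial>D)"
      by (intro nn_integral_mono INF_lower) auto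
    then show "(\<integral>\<^sup>+x. (INF n. \<rho> (- of_nat n) x) \<partial>D) \<noteq> \<infinity>"
      using fin[of "- of_nat 0"] by (auto simp: top_unique)
  qed auto
  \<comment> \<open>Right continuity at \<open>q\<close> is tested along a sequence decreasing to
    \<open>q\<close>; \<open>Suc n\<close> keeps it strictly above \<open>q\<close>, since
    \<open>1 / 0 = 0\<close>.\<close>
  have right: "AE x in D. (INF n. \<rho> (q + 1 / of_nat (Suc n)) x) \<le> \<rho> q x" for q
  proof (rule D.AE_le_of_set_nn_integral_le)
    fix X assume X: "X \<in> sets D"
    have "(\<integral>\<^sup>+x. (INF n. \<rho> (q + 1 / of_nat (Suc n)) x) * indicator X x \<partial>D)
        \<le> (INF n::nat. \<integral>\<^sup>+x. \<rho> (q + 1 / of_nat (Suc n)) x * indicator X x \<partial>D)"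
      by (intro INF_greatest nn_integral_mono mult_right_mono INF_lower) auto
    also have "\<dots> = (INF n::nat. emeasure M (X \<times> {..of_rat (q + 1 / of_nat (Suc n))}))"
      using X by (simp add: \<rho> sets_D)
    also have "\<dots> = emeasure M (\<Inter>n::nat. X \<times> {..of_rat (q + 1 / of_nat (Suc n))})"
    proof (rule INF_emeasure_decseq)
      show "decseq (\<lambda>n. X \<times> {..of_rat (q + 1 / of_nat (Suc n)) :: real})"
      proof (unfold decseq_def, intro allI impI Sigma_mono)
        fix m n :: nat assume "m \<le> n"
        then have "1 / (1 + real n) \<le> 1 / (1 + real m)" by (intro divide_left_mono) auto
        then show "{..of_rat (q + 1 / of_nat (Suc n)) :: real} \<subseteq> {..of_rat (q + 1 / of_nat (Suc m))}"
          by (simp add: of_rat_add of_rat_divide)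
      qed simp
    qed (use X rect in \<open>auto simp: sets_D\<close>)
    also have "(\<Inter>n::nat. X \<times> {..of_rat (q + 1 / of_nat (Suc n)) :: real}) = X \<times> {..of_rat q}"
    proof -
      have "t \<le> of_rat q" if "\<And>n. t \<le> of_rat q + 1 / (1 + real n)" for t :: real
      proof (rule field_le_epsilon)
        fix e :: real assume "e > 0"
        then obtain n where "inverse (real (Suc n)) < e" using reals_Archimedean by blast
        then show "t \<le> of_rat q + e" using that[of n] by (simp add: inverse_eq_divide)
      qed
      then show ?thesis by (auto simp: of_rat_add of_rat_divide intro: add_increasing2)
    qed
    finally show "(\<integral>\<^sup>+x. (INF n. \<rho> (q + 1 / of_nat (Suc n)) x) * indicator X x \<partial>D) \<le> (\<integral>\<^sup>+x. \<rho> q x * indicator X x \<partial>D)"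
      using X by (simp add: \<rho> sets_D)
  next
    have "(\<integral>\<^sup>+x. (INF n. \<rho> (q + 1 / of_nat (Suc n)) x) \<partial>D) \<le> (\<integral>\<^sup>+x. \<rho> (q + 1 / of_nat (Suc 0)) x \<partial>D)"
      by (intro nn_integral_mono INF_lower) auto
    then show "(\<integral>\<^sup>+x. (INF n. \<rho> (q + 1 / of_nat (Suc n)) x) \<partial>D) \<noteq> \<infinity>"
      using fin[of "q + 1 / of_nat (Suc 0)"] by (auto simp: top_unique)
  qed auto
  define good where "good x \<longleftrightarrow> (\<forall>q q'. q \<le> q' \<longrightarrow> \<rho> q x \<le> \<rho> q' x) \<and> (\<forall>q. \<rho> q x \<le> 1) \<and>
    1 \<le> (SUP n. \<rho> (of_nat n) x) \<and> (INF n. \<rho> (- of_nat n) x) \<le> 0 \<and>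
    (\<forall>q. (INF n. \<rho> (q + 1 / of_nat (Suc n)) x) \<le> \<rho> q x)" for x
  have AE_good: "AE x in D. good x"
    unfolding good_def using mono by (intro AE_conjI le1 top bot right AE_all_countable[THEN iffD2] allI) auto
  \<comment> \<open>All quantifiers in \<open>good\<close> range over countable types.\<close>
  have [measurable]: "Measurable.pred A good" unfolding good_def by measurable
  \<comment> \<open>on the exceptional null set, the distribution function of the point mass at \<open>0\<close>\<close>
  define \<rho>' where "\<rho>' x q = (if good x then enn2real (\<rho> q x) else of_bool (0 \<le> q))" for x and q :: rat
  have \<rho>'_meas [measurable]: "(\<lambda>x. \<rho>' x q) \<in> borel_measurable A" for q unfolding \<rho>'_def by measurable
  have \<rho>'_good: "ennreal (\<rho>' x q) = \<rho> q x" if "good x" for x q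
  proof -
    have "\<rho> q x \<le> 1" using that by (simp add: good_def)
    then have "\<rho> q x < top" using ennreal_one_less_top le_less_trans by blast
    then show ?thesis using that by (simp add: \<rho>'_def)
  qed
  have b1: "0 \<le> \<rho>' x q" for x q by (simp add: \<rho>'_def)
  define F where "F x t = (INF q\<in>{q. t < of_rat q}. \<rho>' x q)" for x and t :: real
  \<comment> \<open>The premises of \<open>rational_cdf_extension\<close> are bundled so that the
    case split on \<open>good x\<close> happens once.\<close>
  have props: "(q \<le> q' \<longrightarrow> \<rho>' x q \<le> \<rho>' x q') \<and> (e > 0 \<longrightarrow> (\<exists>q. \<rho>' x q < e)) \<and> (e > 0 \<longrightarrow> (\<exists>q. \<rho>' x q > 1 - e)) \<and>
    \<rho>' x q \<le> 1 \<and> (e > 0 \<longrightarrow> (\<exists>q'>q. \<rho>' x q' < \<rho>' x q + e))" for x q q' e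
  proof (cases "good x")
    case True
    note [simp] = \<rho>'_good[OF True, symmetric]
    have "\<rho>' x q \<le> \<rho>' x q'" if "q \<le> q'"
    proof -
      have "\<rho> q x \<le> \<rho> q' x" using True that by (simp add: good_def del: \<rho>'_good[OF True, symmetric])
      then show ?thesis by (simp add: b1)
    qed
    moreover have "\<exists>q. \<rho>' x q < e" if "e > 0"
    proof -
      have "(INF n. \<rho> (- of_nat n) x) \<le> 0" using True by (simp add: good_def)
      then have "(INF n. \<rho> (- of_nat n) x) < ennreal e" using that by (simp add: le_less_trans)
      then obtain n where "\<rho> (- of_nat n) x < ennreal e" by (auto simp: INF_less_iff)
      then show ?thesis by (auto simp: ennreal_less_iff b1)
    qed
    moreover have "\<exists>q. \<rho>' x q > 1 - e" if "e > 0"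
    proof -
      have "1 \<le> (SUP n. \<rho> (of_nat n) x)" using True by (simp add: good_def)
      moreover have "ennreal (1 - e) < 1" using that by (simp add: ennreal_less_one_iff)
      ultimately have "ennreal (1 - e) < (SUP n. \<rho> (of_nat n) x)" by (rule less_le_trans[rotated])
      then obtain n where "ennreal (1 - e) < \<rho> (of_nat n) x" by (auto simp: less_SUP_iff)
      then have "1 - e < \<rho>' x (of_nat n)" using ennreal_leI[of "\<rho>' x (of_nat n)" "1 - e"] by (auto simp: not_le[symmetric])
      then show ?thesis by blast
    qed
    moreover have "\<rho>' x q \<le> 1"
    proof -
      have "\<rho> q x \<le> 1" using True by (simp add: good_def)
      then show ?thesis by simp
    qed
    moreover have "\<exists>q'>q. \<rho>' x q' < \<rho>' x q + e" if "e > 0"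
    proof -
      have "(INF n. \<rho> (q + 1 / of_nat (Suc n)) x) \<le> \<rho> q x" using True by (simp add: good_def)
      moreover have "\<rho> q x < ennreal (\<rho>' x q + e)" using that by (simp add: ennreal_less_iff b1)
      ultimately have "(INF n. \<rho> (q + 1 / of_nat (Suc n)) x) < ennreal (\<rho>' x q + e)" by (rule le_less_trans)
      then obtain n where "\<rho> (q + 1 / of_nat (Suc n)) x < ennreal (\<rho>' x q + e)" by (auto simp: INF_less_iff)
      then have "\<rho>' x (q + 1 / of_nat (Suc n)) < \<rho>' x q + e" by (simp add: ennreal_less_iff b1)
      then show ?thesis by (intro exI[of _ "q + 1 / of_nat (Suc n)"]) simp
    qed
    ultimately show ?thesis by blast
  next
    case False
    have "\<exists>q'>q. \<rho>' x q' < \<rho>' x q + e" if "e > 0"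
      \<comment> \<open>The point mass at 0 jumps at 0: for negative \<open>q\<close> the witness
        must stay negative, where the value is still 0.\<close>
      by (rule exI[of _ "if q < 0 then q / 2 else q + 1"]) (use False that in \<open>auto simp: \<rho>'_def\<close>)
    moreover have "\<exists>q. \<rho>' x q < e" if "e > 0"
      by (rule exI[of _ "-1"]) (use False that in \<open>auto simp: \<rho>'_def\<close>)
    moreover have "\<exists>q. 1 - e < \<rho>' x q" if "e > 0"
      by (rule exI[of _ "1"]) (use False that in \<open>auto simp: \<rho>'_def\<close>)
    moreover have "q \<le> q' \<longrightarrow> \<rho>' x q \<le> \<rho>' x q'" "\<rho>' x q \<le> 1" using False by (auto simp: \<rho>'_def)
    ultimately show ?thesis by blast
  qed
  note cdf = rational_cdf_extension[of "\<rho>' x" for x, folded F_def]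
  have cdf_F: "\<And>s t. s \<le> t \<Longrightarrow> F x s \<le> F x t" "\<And>t. continuous (at_right t) (F x)"
    "(F x \<longlongrightarrow> 0) at_bot" "(F x \<longlongrightarrow> 1) at_top" "\<And>q. F x (of_rat q) = \<rho>' x q" for x
    using props b1 by (intro cdf; blast)+

  \<comment> \<open>The kernel and its identification on rectangles\<close>
  define \<kappa> where "\<kappa> x = interval_measure (F x)" for x
  have \<kappa>: "prob_space (\<kappa> x)" for x
    using real_distribution_interval_measure[OF cdf_F(1-4)] unfolding \<kappa>_def real_distribution_def by blast
  have \<kappa>_sets: "sets (\<kappa> x) = sets borel" for x by (simp add: \<kappa>_def)
  have \<kappa>_Iic: "emeasure (\<kappa> x) {..t} = F x t" for x t
    unfolding \<kappa>_def by (rule emeasure_interval_measure_Iic[OF cdf_F(1-3)])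
  have \<kappa>_meas: "\<kappa> \<in> A \<rightarrow>\<^sub>M prob_algebra borel"
  proof (rule measurable_prob_algebra_generated[where G = "range atMost" and \<Omega> = UNIV])
    show "sets borel = sigma_sets UNIV (range (atMost :: real \<Rightarrow> _))"
      by (subst borel_eq_atMost) simp
    show "Int_stable (range (atMost :: real \<Rightarrow> _))" by (auto simp: Int_stable_def)
    fix Y :: "real set" assume "Y \<in> range atMost"
    then obtain t where Y: "Y = {..t}" by auto
    have "(\<lambda>x. F x t) \<in> borel_measurable A" unfolding F_def by measurable
    then show "(\<lambda>x. emeasure (\<kappa> x) Y) \<in> borel_measurable A" by (simp add: Y \<kappa>_Iic)
  qed (auto simp: \<kappa> \<kappa>_sets)
  \<comment> \<open>With \<open>X\<close> fixed, both sides are measures in \<open>Y\<close>, namely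
    \<open>N1\<close> and \<open>N2\<close>; they are compared on rational half-lines, where
    \<open>\<kappa>\<close> returns \<open>\<rho> q\<close>. An empty space is treated apart because
    \<open>bind\<close> then yields a default measure.\<close>
  have "emeasure M (X \<times> Y) = (\<integral>\<^sup>+x. indicator X x * emeasure (\<kappa> x) Y \<partial>D)"
    if X [measurable]: "X \<in> sets A" and Y [measurable]: "Y \<in> sets borel" for X Y
  proof (cases "space A = {}")
    case True
    then have "X = {}" using sets.sets_into_space[OF X] by auto
    then show ?thesis using True by (simp add: nn_integral_empty space_D)
  next
    case False
    define N1 where "N1 = distr (density M (\<lambda>p. indicator X (fst p))) borel snd"
    define N2 where "N2 = density D (indicator X) \<bind> \<kappa>"
    have N1: "emeasure N1 Z = emeasure M (X \<times> Z)" if [measurable]: "Z \<in> sets borel" for Z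
    proof -
      have "emeasure N1 Z = emeasure (density M (\<lambda>p. indicator X (fst p))) (snd -` Z \<inter> space M)"
        by (simp add: N1_def emeasure_distr)
      also have "\<dots> = (\<integral>\<^sup>+p. indicator (X \<times> Z) p \<partial>M)"
        by (subst emeasure_density) (auto intro!: nn_integral_cong simp: indicator_def)
      also have "\<dots> = emeasure M (X \<times> Z)" using rect[OF X that] by simp
      finally show ?thesis .
    qed
    have \<kappa>_meas': "\<kappa> \<in> density D (indicator X) \<rightarrow>\<^sub>M subprob_algebra borel"
      using measurable_prob_algebraD[OF \<kappa>_meas] by (simp add: measurable_cong_sets[OF sets_D refl])
    have [measurable]: "(\<lambda>x. emeasure (\<kappa> x) Z) \<in> borel_measurable A" if "Z \<in> sets borel" for Z
      using measurable_emeasure_kernel[OF measurable_prob_algebraD[OF \<kappa>_meas] that] .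
    have N2: "emeasure N2 Z = (\<integral>\<^sup>+x. indicator X x * emeasure (\<kappa> x) Z \<partial>D)" if [measurable]: "Z \<in> sets borel" for Z
      unfolding N2_def using False
      by (subst emeasure_bind[OF _ \<kappa>_meas' that]) (auto simp: space_D nn_integral_density)
    have "N1 = N2"
    proof (rule real_measure_eqI_rat)
      show "finite_measure N1"
        by (rule finite_measureI) (auto simp: N1 N1_def[THEN arg_cong[of _ _ space]])
      show "sets N1 = sets borel" by (simp add: N1_def)
      show "sets N2 = sets borel"
        unfolding N2_def using False by (intro sets_bind) (auto simp: space_D \<kappa>_def)
      fix q
      have "AE x in D. indicator X x * emeasure (\<kappa> x) {..of_rat q} = \<rho> q x * indicator X x"
        using AE_good by eventually_elim (simp add: \<kappa>_Iic cdf_F(5) \<rho>'_good mult.commute)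
      then have "emeasure N2 {..of_rat q} = (\<integral>\<^sup>+x. \<rho> q x * indicator X x \<partial>D)"
        by (simp add: N2 nn_integral_cong_AE)
      then show "emeasure N1 {..of_rat q} = emeasure N2 {..of_rat q}" by (simp add: N1 \<rho> X)
    qed
    then show ?thesis using N1[OF Y] N2[OF Y] by simp
  qed
  then show ?thesis using \<kappa>_meas unfolding D_def by blast
qed

text \<open>Attaching the first coordinate to \<open>\<kappa> x\<close> turns the claim into the
  equality of measures \<open>M = D \<bind> k\<close>. Both sides are finite on the whole product
  and agree on rectangles, an intersection-stable generator, so the integral formula for
  \<open>bind\<close> applies.\<close>

lemma disintegration_nn_integral:
  assumes M: "finite_measure M" and sets_M: "sets M = sets (A \<Otimes>\<^sub>M B)"
    and \<kappa>: "\<kappa> \<in> A \<rightarrow>\<^sub>M prob_algebra B"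
    and rect: "\<And>X Y. X \<in> sets A \<Longrightarrow> Y \<in> sets B \<Longrightarrow>
      emeasure M (X \<times> Y) = (\<integral>\<^sup>+x. indicator X x * emeasure (\<kappa> x) Y \<partial>distr M A fst)"
    and f: "f \<in> borel_measurable (A \<Otimes>\<^sub>M B)"
  shows "(\<integral>\<^sup>+p. f p \<partial>M) = (\<integral>\<^sup>+x. \<integral>\<^sup>+y. f (x, y) \<partial>\<kappa> x \<partial>distr M A fst)"
proof (cases "space A = {}")
  case True
  then have "space M = {}" using sets_eq_imp_space_eq[OF sets_M] by (simp add: space_pair_measure)
  then show ?thesis using True by (simp add: nn_integral_empty)
next
  case False
  define D where "D = distr M A fst"
  have space_D: "space D = space A" and sets_D [measurable_cong]: "sets D = sets A" by (simp_all add: D_def)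
  define k where "k x = distr (\<kappa> x) (A \<Otimes>\<^sub>M B) (Pair x)" for x
  have k: "k \<in> D \<rightarrow>\<^sub>M subprob_algebra (A \<Otimes>\<^sub>M B)"
    unfolding k_def using \<kappa>
    by (intro measurable_prob_algebraD measurable_distr_prob_space2[where M = B])
      (auto simp: measurable_cong_sets[OF sets_D refl])
  have \<kappa>_sets: "sets (\<kappa> x) = sets B" "space (\<kappa> x) = space B" if "x \<in> space A" for x
    using subprob_measurableD(1,2)[OF measurable_prob_algebraD[OF \<kappa>] that] by auto
  have k_eq: "(\<integral>\<^sup>+p. g p \<partial>k x) = (\<integral>\<^sup>+y. g (x, y) \<partial>\<kappa> x)"
    if "x \<in> space A" "g \<in> borel_measurable (A \<Otimes>\<^sub>M B)" for x g
    unfolding k_def using that \<kappa>_sets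
    by (subst nn_integral_distr) (auto simp: measurable_cong_sets[OF \<kappa>_sets(1)[OF that(1)] refl])
  have "M = D \<bind> k"
  proof (rule measure_eqI_generator_eq_countable[where \<Omega> = "space A \<times> space B"
        and E = "{X \<times> Y | X Y. X \<in> sets A \<and> Y \<in> sets B}" and A = "{space A \<times> space B}"])
    show "Int_stable {X \<times> Y | X Y. X \<in> sets A \<and> Y \<in> sets B}" by (rule Int_stable_pair_measure_generator)
    show "{X \<times> Y |X Y. X \<in> sets A \<and> Y \<in> sets B} \<subseteq> Pow (space A \<times> space B)" by (rule pair_measure_closed)
    show "sets M = sigma_sets (space A \<times> space B) {X \<times> Y |X Y. X \<in> sets A \<and> Y \<in> sets B}"
      by (simp add: sets_M sets_pair_measure)
    have "sets (D \<bind> k) = sets (A \<Otimes>\<^sub>M B)" by (rule sets_bind) (use False in \<open>auto simp: k_def space_D\<close>)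
    then show "sets (D \<bind> k) = sigma_sets (space A \<times> space B) {X \<times> Y |X Y. X \<in> sets A \<and> Y \<in> sets B}"
      by (simp add: sets_pair_measure)
    show "emeasure M a \<noteq> \<infinity>" for a
      using finite_measure.emeasure_finite[OF M] by simp
    fix Z assume "Z \<in> {X \<times> Y |X Y. X \<in> sets A \<and> Y \<in> sets B}"
    then obtain X Y where Z: "Z = X \<times> Y" and XY [measurable]: "X \<in> sets A" "Y \<in> sets B" by auto
    have "emeasure (D \<bind> k) Z = (\<integral>\<^sup>+x. emeasure (k x) Z \<partial>D)"
      using False XY by (intro emeasure_bind[OF _ k]) (auto simp: space_D Z)
    also have "\<dots> = (\<integral>\<^sup>+x. indicator X x * emeasure (\<kappa> x) Y \<partial>D)"
    proof (rule nn_integral_cong)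
      fix x assume "x \<in> space D"
      then have x: "x \<in> space A" by (simp add: space_D)
      have "emeasure (k x) Z = emeasure (\<kappa> x) (Pair x -` Z \<inter> space (\<kappa> x))"
        unfolding k_def using x XY
        by (intro emeasure_distr) (auto simp: Z measurable_cong_sets[OF \<kappa>_sets(1)[OF x] refl])
      also have "Pair x -` Z \<inter> space (\<kappa> x) = (if x \<in> X then Y else {})"
        using sets.sets_into_space[OF XY(2)] by (auto simp: Z \<kappa>_sets(2)[OF x])
      finally show "emeasure (k x) Z = indicator X x * emeasure (\<kappa> x) Y" by simp
    qed
    also have "\<dots> = emeasure M Z" unfolding D_def using rect[OF XY] by (simp add: Z)
    finally show "emeasure M Z = emeasure (D \<bind> k) Z" by simp
  qed auto
  then have "(\<integral>\<^sup>+p. f p \<partial>M) = (\<integral>\<^sup>+x. \<integral>\<^sup>+p. f p \<partial>k x \<partial>D)" using nn_integral_bind[OF f k] by simp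
  also have "\<dots> = (\<integral>\<^sup>+x. \<integral>\<^sup>+y. f (x, y) \<partial>\<kappa> x \<partial>D)"
    by (rule nn_integral_cong) (simp add: k_eq f space_D)
  finally show ?thesis by (simp add: D_def)
qed

text \<open>Pushing \<open>\<kappa> x\<close> forward along \<open>y \<mapsto> (x, y)\<close> moves
  the dependence on \<open>x\<close> from the integrand into the measure, where measurability of
  kernels applies.\<close>

lemma integral_kernel_measurable:
  fixes f :: "'a \<times> 'b \<Rightarrow> real"
  assumes \<kappa>: "\<kappa> \<in> A \<rightarrow>\<^sub>M prob_algebra B" and f: "f \<in> borel_measurable (A \<Otimes>\<^sub>M B)"
  shows "(\<lambda>x. LINT y|\<kappa> x. f (x, y)) \<in> borel_measurable A"
proof (subst measurable_cong)
  have "(\<lambda>x. distr (\<kappa> x) (A \<Otimes>\<^sub>M B) (Pair x)) \<in> A \<rightarrow>\<^sub>M prob_algebra (A \<Otimes>\<^sub>M B)"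
    by (rule measurable_distr_prob_space2[OF \<kappa>]) simp
  then show "(\<lambda>x. LINT p|distr (\<kappa> x) (A \<Otimes>\<^sub>M B) (Pair x). f p) \<in> borel_measurable A"
    by (rule measurable_compose[OF measurable_prob_algebraD integral_measurable_subprob_algebra[OF f]])
  fix x assume x: "x \<in> space A"
  show "(LINT y|\<kappa> x. f (x, y)) = (LINT p|distr (\<kappa> x) (A \<Otimes>\<^sub>M B) (Pair x). f p)"
    using x f by (intro integral_distr[symmetric])
      (auto simp: measurable_cong_sets[OF subprob_measurableD(2)[OF measurable_prob_algebraD[OF \<kappa>] x] refl])
qed

text \<open>The positive and negative parts are treated by the nonnegative formula
  \<open>dis\<close>. Their fibre integrals are finite only almost everywhere, so integrability on
  fibres is an a.e. statement.\<close>

lemma disintegration_integral: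
  fixes f :: "'a \<times> 'b \<Rightarrow> real"
  assumes sets_M: "sets M = sets (A \<Otimes>\<^sub>M B)" and \<kappa>: "\<kappa> \<in> A \<rightarrow>\<^sub>M prob_algebra B"
    and dis: "\<And>f. f \<in> borel_measurable (A \<Otimes>\<^sub>M B) \<Longrightarrow>
      (\<integral>\<^sup>+p. f p \<partial>M) = (\<integral>\<^sup>+x. \<integral>\<^sup>+y. f (x, y) \<partial>\<kappa> x \<partial>distr M A fst)"
    and f: "integrable M f"
  shows "AE x in distr M A fst. integrable (\<kappa> x) (\<lambda>y. f (x, y))"
    "integrable (distr M A fst) (\<lambda>x. LINT y|\<kappa> x. f (x, y))"
    "(LINT x|distr M A fst. LINT y|\<kappa> x. f (x, y)) = (LINT p|M. f p)"
proof -
  define D where "D = distr M A fst"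
  have space_D: "space D = space A" and sets_D [measurable_cong]: "sets D = sets A" by (simp_all add: D_def)
  have f_meas [measurable]: "f \<in> borel_measurable (A \<Otimes>\<^sub>M B)"
    using borel_measurable_integrable[OF f] by (simp add: measurable_cong_sets[OF sets_M refl])
  have \<kappa>': "\<kappa> \<in> D \<rightarrow>\<^sub>M subprob_algebra B"
    using measurable_prob_algebraD[OF \<kappa>] by (simp add: measurable_cong_sets[OF sets_D refl])
  have nn_meas: "(\<lambda>x. \<integral>\<^sup>+y. g (x, y) \<partial>\<kappa> x) \<in> borel_measurable D" if "g \<in> borel_measurable (A \<Otimes>\<^sub>M B)" for g
    using that by (intro nn_integral_measurable_subprob_algebra2[where N = B, OF _ \<kappa>']) (simp cong: measurable_cong_sets)
  define p where "p x = (\<integral>\<^sup>+y. ennreal (f (x, y)) \<partial>\<kappa> x)" for x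
  define n where "n x = (\<integral>\<^sup>+y. ennreal (- f (x, y)) \<partial>\<kappa> x)" for x
  have [measurable]: "p \<in> borel_measurable D" "n \<in> borel_measurable D"
    unfolding p_def n_def by (intro nn_meas; measurable)+
  have p: "(\<integral>\<^sup>+x. p x \<partial>D) = (\<integral>\<^sup>+q. ennreal (f q) \<partial>M)"
    unfolding p_def D_def by (rule dis[symmetric]) measurable
  have n: "(\<integral>\<^sup>+x. n x \<partial>D) = (\<integral>\<^sup>+q. ennreal (- f q) \<partial>M)"
    unfolding n_def D_def by (rule dis[symmetric]) measurable
  have fin: "(\<integral>\<^sup>+x. p x \<partial>D) \<noteq> \<infinity>" "(\<integral>\<^sup>+x. n x \<partial>D) \<noteq> \<infinity>"
    using f by (simp_all add: p n real_integrable_def)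
  have AE_fin: "AE x in D. p x \<noteq> \<infinity>" "AE x in D. n x \<noteq> \<infinity>"
    using nn_integral_PInf_AE[of p D] nn_integral_PInf_AE[of n D] fin by simp_all
  have f_x: "(\<lambda>y. f (x, y)) \<in> borel_measurable (\<kappa> x)" if "x \<in> space D" for x
    using that subprob_measurableD(2)[OF \<kappa>' that] by (simp add: space_D cong: measurable_cong_sets)
  have AE_int: "AE x in D. integrable (\<kappa> x) (\<lambda>y. f (x, y))"
    using AE_fin AE_space
    by eventually_elim (simp add: real_integrable_def f_x p_def n_def)
  have eq: "AE x in D. (LINT y|\<kappa> x. f (x, y)) = enn2real (p x) - enn2real (n x)"
    using AE_int by eventually_elim (simp add: real_lebesgue_integral_def p_def n_def)
  have int_p: "integrable D (\<lambda>x. enn2real (p x))" and int_n: "integrable D (\<lambda>x. enn2real (n x))"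
    and eq_p: "(LINT x|D. enn2real (p x)) = enn2real (\<integral>\<^sup>+x. p x \<partial>D)"
    and eq_n: "(LINT x|D. enn2real (n x)) = enn2real (\<integral>\<^sup>+x. n x \<partial>D)"
  proof -
    have *: "integrable D (\<lambda>x. enn2real (g x)) \<and> (LINT x|D. enn2real (g x)) = enn2real (\<integral>\<^sup>+x. g x \<partial>D)"
      if [measurable]: "g \<in> borel_measurable D" and fin: "(\<integral>\<^sup>+x. g x \<partial>D) \<noteq> \<infinity>" and AE: "AE x in D. g x \<noteq> \<infinity>" for g
    proof -
      have eq: "(\<integral>\<^sup>+x. ennreal (enn2real (g x)) \<partial>D) = (\<integral>\<^sup>+x. g x \<partial>D)"
        using AE by (intro nn_integral_cong_AE) (auto simp: less_top)
      show ?thesis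
        using fin eq by (auto intro!: integrableI_nonneg simp: integral_eq_nn_integral less_top)
    qed
    show "integrable D (\<lambda>x. enn2real (p x))" "(LINT x|D. enn2real (p x)) = enn2real (\<integral>\<^sup>+x. p x \<partial>D)"
      using *[of p] fin AE_fin by auto
    show "integrable D (\<lambda>x. enn2real (n x))" "(LINT x|D. enn2real (n x)) = enn2real (\<integral>\<^sup>+x. n x \<partial>D)"
      using *[of n] fin AE_fin by auto
  qed
  have meas: "(\<lambda>x. LINT y|\<kappa> x. f (x, y)) \<in> borel_measurable D"
    using integral_kernel_measurable[OF \<kappa> f_meas] by (simp add: measurable_cong_sets[OF sets_D refl])
  show "AE x in distr M A fst. integrable (\<kappa> x) (\<lambda>y. f (x, y))" using AE_int unfolding D_def .
  have "integrable D (\<lambda>x. LINT y|\<kappa> x. f (x, y)) \<longleftrightarrow> integrable D (\<lambda>x. enn2real (p x) - enn2real (n x))"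
    by (rule integrable_cong_AE[OF meas _ eq]) measurable
  then show "integrable (distr M A fst) (\<lambda>x. LINT y|\<kappa> x. f (x, y))" using int_p int_n by (simp add: D_def)
  have "(LINT x|D. LINT y|\<kappa> x. f (x, y)) = (LINT x|D. enn2real (p x) - enn2real (n x))"
    by (rule integral_cong_AE[OF meas _ eq]) measurable
  also have "\<dots> = (LINT p|M. f p)"
    using int_p int_n eq_p eq_n f by (simp add: p n real_lebesgue_integral_def)
  finally show "(LINT x|distr M A fst. LINT y|\<kappa> x. f (x, y)) = (LINT p|M. f p)" by (simp add: D_def)
qed

text \<open>The second coordinate is coded by a real, the measure on the product with the line is
  disintegrated, and the fibres are decoded. As \<open>c'\<close> sends every real into
  \<open>S\<close>, all fibres over \<open>space A\<close> are carried by \<open>S\<close>, not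
  merely almost all.\<close>

lemma compact_disintegration:
  fixes S :: "'b::{complete_space, second_countable_topology} set" and M :: "('a \<times> 'b) measure"
  assumes M: "finite_measure M" and sets_M: "sets M = sets (A \<Otimes>\<^sub>M borel)"
    and S: "compact S" "S \<noteq> {}" and MS: "AE p in M. snd p \<in> S"
  shows "\<exists>\<kappa>\<in>A \<rightarrow>\<^sub>M prob_algebra borel. (\<forall>x\<in>space A. AE y in \<kappa> x. y \<in> S) \<and>
    (\<forall>f\<in>borel_measurable (A \<Otimes>\<^sub>M borel).
      (\<integral>\<^sup>+p. f p \<partial>M) = (\<integral>\<^sup>+x. \<integral>\<^sup>+y. f (x, y) \<partial>\<kappa> x \<partial>distr M A fst))"
proof -
  interpret M: finite_measure M by (rule M)
  obtain b :: "'b \<Rightarrow> real" and c C where bc: "b \<in> borel_measurable borel" "compact C" "b ` S \<subseteq> C"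
    "continuous_on C c" "c ` C \<subseteq> S" "\<And>x. x \<in> S \<Longrightarrow> c (b x) = x"
    using compact_real_coding[OF S(1)] by metis
  obtain s0 where s0: "s0 \<in> S" using S by auto
  define c' where "c' t = (if t \<in> C then c t else s0)" for t
  have [measurable]: "C \<in> sets borel" using bc(2) by (rule borel_compact)
  have c' [measurable]: "c' \<in> borel_measurable borel"
    unfolding c'_def
    by (rule borel_measurable_continuous_on_if) (use bc(4) in \<open>auto intro: continuous_on_const\<close>)
  have c'_b: "c' (b x) = x" if "x \<in> S" for x using that bc(3,6) by (auto simp: c'_def)
  note [measurable] = bc(1)
  have [measurable]: "fst \<in> M \<rightarrow>\<^sub>M A" "snd \<in> M \<rightarrow>\<^sub>M borel"
    by (simp_all add: measurable_cong_sets[OF sets_M refl])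
  have space_M: "space M = space A \<times> UNIV"
    using sets_eq_imp_space_eq[OF sets_M] by (simp add: space_pair_measure)
  define T where "T p = (fst p, b (snd p))" for p :: "'a \<times> 'b"
  have T [measurable]: "T \<in> M \<rightarrow>\<^sub>M A \<Otimes>\<^sub>M borel" unfolding T_def by measurable
  define M' where "M' = distr M (A \<Otimes>\<^sub>M borel) T"
  have M': "finite_measure M'" "sets M' = sets (A \<Otimes>\<^sub>M borel)"
    by (simp_all add: M'_def M.finite_measure_distr)
  have D: "distr M' A fst = distr M A fst"
    unfolding M'_def by (subst distr_distr) (auto simp: o_def T_def)
  obtain \<kappa> where \<kappa>: "\<kappa> \<in> A \<rightarrow>\<^sub>M prob_algebra borel" and rect: "\<And>X Y. X \<in> sets A \<Longrightarrow> Y \<in> sets borel \<Longrightarrow>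
    emeasure M' (X \<times> Y) = (\<integral>\<^sup>+x. indicator X x * emeasure (\<kappa> x) Y \<partial>distr M' A fst)"
    using real_disintegration[OF M'] by blast
  define k where "k x = distr (\<kappa> x) borel c'" for x
  have "k \<in> A \<rightarrow>\<^sub>M prob_algebra borel"
    unfolding k_def using \<kappa> measurable_distr_prob_space[OF c'] by (rule measurable_compose)
  moreover have "AE y in k x. y \<in> S" if "x \<in> space A" for x
  proof -
    have [measurable]: "S \<in> sets borel" using S(1) by (rule borel_compact)
    have "c' t \<in> S" for t using bc(5) s0 by (auto simp: c'_def)
    then show ?thesis
      unfolding k_def by (subst AE_distr_iff)
        (auto simp: measurable_cong_sets[OF subprob_measurableD(2)[OF measurable_prob_algebraD[OF \<kappa>] that] refl])
  qed
  moreover have "(\<integral>\<^sup>+p. f p \<partial>M) = (\<integral>\<^sup>+x. \<integral>\<^sup>+y. f (x, y) \<partial>k x \<partial>distr M A fst)"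
    if f [measurable]: "f \<in> borel_measurable (A \<Otimes>\<^sub>M borel)" for f
  proof -
    define g where "g q = f (fst q, c' (snd q))" for q
    have g [measurable]: "g \<in> borel_measurable (A \<Otimes>\<^sub>M borel)" unfolding g_def by measurable
    have "(\<integral>\<^sup>+p. f p \<partial>M) = (\<integral>\<^sup>+p. g (T p) \<partial>M)"
      by (rule nn_integral_cong_AE) (use MS in \<open>eventually_elim, auto simp: g_def T_def c'_b\<close>)
    also have "\<dots> = (\<integral>\<^sup>+q. g q \<partial>M')" unfolding M'_def by (subst nn_integral_distr) auto
    also have "\<dots> = (\<integral>\<^sup>+x. \<integral>\<^sup>+y. g (x, y) \<partial>\<kappa> x \<partial>distr M' A fst)"
      by (rule disintegration_nn_integral[OF M' \<kappa> rect g])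
    also have "\<dots> = (\<integral>\<^sup>+x. \<integral>\<^sup>+y. f (x, y) \<partial>k x \<partial>distr M A fst)"
      unfolding D
    proof (rule nn_integral_cong)
      fix x assume "x \<in> space (distr M A fst)"
      then have x: "x \<in> space A" by simp
      note sets_\<kappa> = subprob_measurableD(2)[OF measurable_prob_algebraD[OF \<kappa>] x]
      have "(\<lambda>y. f (x, y)) \<in> borel_measurable borel" using x by measurable
      then show "(\<integral>\<^sup>+y. g (x, y) \<partial>\<kappa> x) = (\<integral>\<^sup>+y. f (x, y) \<partial>k x)"
        unfolding k_def by (subst nn_integral_distr) (auto simp: g_def measurable_cong_sets[OF sets_\<kappa> refl])
    qed
    finally show ?thesis .
  qed
  ultimately show ?thesis by blast
qed

text \<open>The functions \<open>max 0 (1 - n * infdist x C)\<close> decrease to the indicator of a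
  closed set \<open>C\<close>, and the closed sets form an intersection-stable generator. This is
  how a marginal of a weak limit, known only through continuous test functions, is
  identified.\<close>

lemma finite_measure_eqI_continuous:
  fixes M N :: "'a::metric_space measure"
  assumes M: "finite_measure M" "sets M = sets borel" and N: "finite_measure N" "sets N = sets borel"
    and eq: "\<And>f. continuous_on UNIV f \<Longrightarrow> (\<And>x. 0 \<le> f x) \<Longrightarrow> (\<And>x. f x \<le> 1) \<Longrightarrow>
      (LINT x|M. f x) = (LINT x|N. f x :: real)"
  shows "M = N"
proof -
  have lim: "(\<lambda>n. LINT x|L. max 0 (1 - real n * infdist x C)) \<longlonglongrightarrow> measure L C"
    if L: "finite_measure L" "sets L = sets borel" and C: "closed C" "C \<noteq> {}" for L and C :: "'a set"
  proof -
    interpret finite_measure L by (rule L)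
    have [measurable_cong]: "sets L = sets borel" by (rule L)
    have C_meas [measurable]: "C \<in> sets borel" using C by simp
    have "(\<lambda>n. LINT x|L. max 0 (1 - real n * infdist x C)) \<longlonglongrightarrow> (LINT x|L. indicator C x)"
    proof (rule integral_dominated_convergence[where w = "\<lambda>_. 1"])
      show "(\<lambda>x. max 0 (1 - real n * infdist x C)) \<in> borel_measurable L" for n
        unfolding measurable_cong_sets[OF L(2) refl]
        by (intro borel_measurable_continuous_onI continuous_intros)
      have "(\<lambda>n. max 0 (1 - real n * infdist x C)) \<longlonglongrightarrow> indicator C x" for x
      proof (cases "x \<in> C")
        case False
        then have pos: "infdist x C > 0"
          using in_closed_iff_infdist_zero[OF C] infdist_nonneg[of x C] by (simp add: less_le)
        obtain m :: nat where m: "1 / infdist x C \<le> real m" using real_arch_simple by blast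
        have "max 0 (1 - real n * infdist x C) = 0" if "n \<ge> m" for n
        proof -
          have "1 / infdist x C \<le> real n" using m that by linarith
          then show ?thesis using pos by (simp add: field_simps)
        qed
        then have "\<forall>\<^sub>F n in sequentially. max 0 (1 - real n * infdist x C) = 0"
          unfolding eventually_sequentially by blast
        then show ?thesis using False by (simp add: tendsto_eventually)
      qed simp
      then show "AE x in L. (\<lambda>n. max 0 (1 - real n * infdist x C)) \<longlonglongrightarrow> indicator C x" by simp
      show "AE x in L. norm (max 0 (1 - real n * infdist x C)) \<le> 1" for n
        by (simp add: infdist_nonneg)
    qed auto
    moreover have "space L = UNIV" using sets_eq_imp_space_eq[OF L(2)] by simp
    ultimately show ?thesis by simp
  qed
  have eq_closed: "emeasure M C = emeasure N C" if "closed C" for C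
  \<comment> \<open>The empty set is split off because \<open>infdist x {}\<close> is 0, so the
    approximating functions would be constantly 1.\<close>
  proof (cases "C = {}")
    case False
    have "(LINT x|M. max 0 (1 - real n * infdist x C)) = (LINT x|N. max 0 (1 - real n * infdist x C))" for n
      by (intro eq continuous_intros) (auto simp: infdist_nonneg)
    then have "measure M C = measure N C"
      using LIMSEQ_unique[OF lim[OF M that False]] lim[OF N that False] by simp
    then show ?thesis
      by (simp add: finite_measure.emeasure_eq_measure[OF M(1)] finite_measure.emeasure_eq_measure[OF N(1)])
  qed simp
  have "sets (borel :: 'a measure) = sigma_sets UNIV (Collect closed)"
    by (subst borel_eq_closed) simp
  then show ?thesis
    using M(2) N(2) finite_measure.emeasure_finite[OF N(1), of UNIV]
    by (intro measure_eqI_generator_eq_countable[of "Collect closed" UNIV M N "{UNIV}"])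
      (auto simp: Int_stable_def eq_closed closed_Int)
qed

section \<open>Generated compactifications\<close>

lemma continuous_map_of_BC:
  assumes "f \<in> mspace (BC X)"
  shows "continuous_map X euclideanreal f" "bounded (f ` topspace X)"
  using assms by (auto simp: BC_def)

lemma eval_cube_compact_Hausdorff: "compact_space (eval_cube X H)" "Hausdorff_space (eval_cube X H)"
proof -
  have "compact_space (top_of_set {a..b::real})" for a b
    by (simp add: compact_space_subtopology)
  then show "compact_space (eval_cube X H)"
    by (simp add: eval_cube_def compact_space_product_topology)
  show "Hausdorff_space (eval_cube X H)"
    by (simp add: eval_cube_def Hausdorff_space_product_topology Hausdorff_space_subtopology)
qed

lemma compact_space_compactification: "compact_space (compactification X H)"
  unfolding compactification_def
  by (intro compact_space_subtopology closedin_compact_space[OF eval_cube_compact_Hausdorff(1)]) simp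

lemma Hausdorff_space_compactification: "Hausdorff_space (compactification X H)"
  unfolding compactification_def by (intro Hausdorff_space_subtopology eval_cube_compact_Hausdorff)

lemma continuous_map_compactification_proj:
  assumes "f \<in> H"
  shows "continuous_map (compactification X H) euclideanreal (\<lambda>y. y f)"
proof -
  have "continuous_map (eval_cube X H) (top_of_set {(INF x\<in>topspace X. f x)..(SUP x\<in>topspace X. f x)}) (\<lambda>y. y f)"
    unfolding eval_cube_def using assms by (rule continuous_map_product_projection)
  then show ?thesis
    unfolding compactification_def by (intro continuous_map_from_subtopology) (rule continuous_map_into_fulltopology)
qed

lemma topspace_compactification_extensional:
  "topspace (compactification X H) \<subseteq> extensional H"
  by (auto simp: compactification_def eval_cube_def PiE_def)

lemma eval_map_in_compactification:
  assumes "H \<subseteq> mspace (BC X)"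
  shows "eval_map H ` topspace X \<subseteq> topspace (compactification X H)"
  using closure_of_subset[OF eval_map_in_cube[OF assms]] eval_map_in_cube[OF assms]
  by (auto simp: compactification_def)

lemma continuous_map_eval_map:
  assumes "H \<subseteq> mspace (BC X)"
  shows "continuous_map X (compactification X H) (eval_map H)"
proof -
  have "continuous_map X (eval_cube X H) (eval_map H)"
    unfolding eval_cube_def continuous_map_componentwise
  proof (intro conjI ballI)
    show "eval_map H ` topspace X \<subseteq> extensional H" by (auto simp: eval_map_def)
    fix f assume f: "f \<in> H"
    then have "continuous_map X euclideanreal f" using assms continuous_map_of_BC by blast
    moreover have "f ` topspace X \<subseteq> {(INF x\<in>topspace X. f x)..(SUP x\<in>topspace X. f x)}"
      using eval_map_in_cube[OF assms] f by (auto simp: eval_cube_def eval_map_def PiE_iff image_subset_iff)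
    ultimately show "continuous_map X (top_of_set {(INF x\<in>topspace X. f x)..(SUP x\<in>topspace X. f x)}) (\<lambda>x. eval_map H x f)"
      using f by (auto simp: eval_map_def continuous_map_in_subtopology)
  qed
  then show ?thesis
    using closure_of_subset[OF eval_map_in_cube[OF assms]]
    by (simp add: compactification_def continuous_map_in_subtopology image_subset_iff_funcset)
qed

text \<open>The inequality is a closed condition on \<open>y\<close> and holds on the dense image of
  \<open>X\<close>. It lets a sup-norm dense set of functions determine all coordinates of a
  point.\<close>

lemma compactification_proj_dist:
  assumes H: "H \<subseteq> mspace (BC X)" and fg: "f \<in> H" "g \<in> H" and y: "y \<in> topspace (compactification X H)"
  shows "\<bar>y f - y g\<bar> \<le> mdist (BC X) f g"
proof -
  have y': "y \<in> compactification X H closure_of (eval_map H ` topspace X)"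
    using y by (simp add: eval_map_dense[OF H])
  have "continuous_map (compactification X H) euclideanreal (\<lambda>y. \<bar>y f - y g\<bar>)"
    by (intro continuous_intros continuous_map_compactification_proj fg)
  moreover have "closedin euclideanreal {..mdist (BC X) f g}" by simp
  ultimately have "closedin (compactification X H) {z \<in> topspace (compactification X H). \<bar>z f - z g\<bar> \<in> {..mdist (BC X) f g}}"
    by (rule closedin_continuous_map_preimage)
  moreover have "eval_map H ` topspace X \<subseteq> {z \<in> topspace (compactification X H). \<bar>z f - z g\<bar> \<in> {..mdist (BC X) f g}}"
  proof (clarify, intro conjI)
    fix x assume x: "x \<in> topspace X"
    then show "eval_map H x \<in> topspace (compactification X H)" using eval_map_in_compactification[OF H] by blast
    have "f \<in> mspace (cfunspace X euclidean_metric)" "g \<in> mspace (cfunspace X euclidean_metric)"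
      using H fg unfolding BC_def by blast+
    then have "mdist euclidean_metric (f x) (g x) \<le> mdist (BC X) f g"
      unfolding BC_def using order_refl x by (rule mdist_cfunspace_imp_mdist_le)
    then show "\<bar>eval_map H x f - eval_map H x g\<bar> \<in> {..mdist (BC X) f g}"
      using fg by (simp add: eval_map_def dist_real_def)
  qed
  ultimately show ?thesis using y' closure_of_minimal by blast
qed

text \<open>The coordinates at a dense sequence \<open>h\<close> in \<open>H\<close> determine a
  point, so \<open>j\<close> is a continuous injection of a compact space into a Hausdorff one,
  hence a homeomorphism onto its image. The compactification thereby becomes a compact set in the
  Polish type \<open>nat \<Rightarrow> real\<close>.\<close>

lemma compactification_embeds_into_sequences:
  assumes H: "H \<subseteq> mspace (BC X)" "H \<noteq> {}" and sep: "separable_space (subtopology (mtopology_of (BC X)) H)"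
  obtains h and K :: "(nat \<Rightarrow> real) set" and j \<phi> where "range h \<subseteq> H" "compact K"
    "homeomorphic_maps (compactification X H) (top_of_set K) j \<phi>"
    "\<And>y. j y = (\<lambda>n. y (h n))"
proof -
  let ?C = "compactification X H"
  have top: "topspace (subtopology (mtopology_of (BC X)) H) = H"
    using H(1) by auto
  obtain D where D: "countable D" "D \<subseteq> H" "subtopology (mtopology_of (BC X)) H closure_of D = H"
    using sep unfolding separable_space_def top by auto
  have "D \<noteq> {}" using D(3) H(2) by auto
  define h where "h = from_nat_into D"
  have h: "range h = D" unfolding h_def using D(1) \<open>D \<noteq> {}\<close> by (rule range_from_nat_into[rotated])
  define j where "j y = (\<lambda>n. y (h n))" for y :: "('a \<Rightarrow> real) \<Rightarrow> real"
  have approx: "\<exists>n. mdist (BC X) f (h n) < e" if "f \<in> H" "e > 0" for f e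
  proof -
    interpret Metric_space "mspace (BC X)" "mdist (BC X)" by simp
    have "openin (subtopology (mtopology_of (BC X)) H) (H \<inter> mball f e)"
      unfolding openin_subtopology mtopology_of_def by (intro exI[of _ "mball f e"]) auto
    moreover have "f \<in> H \<inter> mball f e" using that H(1) by auto
    moreover have "f \<in> subtopology (mtopology_of (BC X)) H closure_of D" using that(1) D(3) by simp
    then have "\<forall>T. f \<in> T \<and> openin (subtopology (mtopology_of (BC X)) H) T \<longrightarrow> (\<exists>g. g \<in> D \<and> g \<in> T)"
      unfolding in_closure_of by (rule conjunct2)
    ultimately obtain g where g: "g \<in> D" "g \<in> H \<inter> mball f e" by meson
    then obtain n where "g = h n" using h by auto
    then show ?thesis using g by auto
  qed
  have inj: "inj_on j (topspace ?C)"
  proof (rule inj_onI)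
    fix y z assume yz: "y \<in> topspace ?C" "z \<in> topspace ?C" "j y = j z"
    have "y f = z f" if f: "f \<in> H" for f
    proof -
      have "\<bar>y f - z f\<bar> \<le> e" if "e > 0" for e :: real
      proof -
        obtain n where n: "mdist (BC X) f (h n) < e / 2" using approx[OF f, of "e / 2"] \<open>e > 0\<close> by auto
        have "h n \<in> H" using h D(2) by auto
        then have "\<bar>y f - y (h n)\<bar> < e / 2" "\<bar>z f - z (h n)\<bar> < e / 2"
          using compactification_proj_dist[OF H(1) f _ yz(1), of "h n"]
            compactification_proj_dist[OF H(1) f _ yz(2), of "h n"] n by auto
        moreover have "y (h n) = z (h n)" using fun_cong[OF yz(3), of n] by (simp add: j_def)
        ultimately show ?thesis by linarith
      qed
      then have "\<bar>y f - z f\<bar> \<le> 0" by (rule dense_ge)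
      then show ?thesis by simp
    qed
    then show "y = z"
      using yz(1,2) topspace_compactification_extensional[of X H] by (intro extensionalityI[of y H z]) auto
  qed
  have "continuous_map ?C euclidean j"
    \<comment> \<open>The topology of \<open>nat \<Rightarrow> real\<close> is the product topology,
      so continuity is checked coordinatewise.\<close>
    unfolding j_def euclidean_product_topology[symmetric] continuous_map_componentwise_UNIV
    using h D(2) by (intro allI continuous_map_compactification_proj) auto
  then have j: "continuous_map ?C (top_of_set (j ` topspace ?C)) j"
    by (simp add: continuous_map_in_subtopology)
  have "compactin euclidean (j ` topspace ?C)"
    using compact_space_compactification[unfolded compact_space_def] \<open>continuous_map ?C euclidean j\<close>
    by (rule image_compactin)
  then have "compact (j ` topspace ?C)" by simp
  moreover have "homeomorphic_map ?C (top_of_set (j ` topspace ?C)) j"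
    by (rule continuous_imp_homeomorphic_map[OF j compact_space_compactification])
      (auto simp: inj intro: Hausdorff_space_subtopology)
  then obtain \<phi> where "homeomorphic_maps ?C (top_of_set (j ` topspace ?C)) j \<phi>"
    using homeomorphic_map_maps by blast
  ultimately show thesis using that[of h "j ` topspace ?C" j \<phi>] h D(2) by (auto simp: j_def)
qed

text \<open>A function vanishing at infinity extends by 0 to every compactification of this kind,
  whether or not it belongs to \<open>H\<close>. Where \<open>g\<close> is 0, continuity holds
  because the sets \<open>\<epsilon> \<le> norm (f x)\<close> have compact, hence closed, images.
  Where \<open>g\<close> is nonzero, a separating function supplies a neighbourhood that misses the
  remainder.\<close>

lemma zero_extension_continuous:
  fixes f :: "'a \<Rightarrow> 'b::real_normed_vector"
  assumes H: "H \<subseteq> mspace (BC X)" and sep: "separates_points_from_closed X H"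
    and inj: "inj_on (eval_map H) (topspace X)"
    and f: "continuous_map X euclidean f"
    and vanish: "\<And>\<epsilon>. \<epsilon> > 0 \<Longrightarrow> compactin X {x \<in> topspace X. \<epsilon> \<le> norm (f x)}"
  defines "g \<equiv> \<lambda>y. if y \<in> eval_map H ` topspace X then f (inv_into (topspace X) (eval_map H) y) else 0"
  shows "continuous_map (compactification X H) euclidean g"
proof -
  let ?C = "compactification X H" and ?e = "eval_map H"
  have g_e: "g (?e x) = f x" if "x \<in> topspace X" for x
    using that inv_into_f_f[OF inj that] by (simp add: g_def)
  have g_0: "g y = 0" if "y \<notin> ?e ` topspace X" for y using that by (simp add: g_def)
  have closed: "closedin ?C (?e ` {x \<in> topspace X. \<epsilon> \<le> norm (f x)})" if "\<epsilon> > 0" for \<epsilon>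
    using compactin_imp_closedin[OF Hausdorff_space_compactification
        image_compactin[OF vanish[OF that] continuous_map_eval_map[OF H]]] .
  have "\<exists>V. openin ?C V \<and> y \<in> V \<and> (\<forall>z\<in>V. dist (g z) (g y) < \<epsilon>)"
    if y: "y \<in> topspace ?C" and \<epsilon>: "\<epsilon> > 0" for y \<epsilon>
  proof (cases "g y = 0")
    case True
    define V where "V = topspace ?C - ?e ` {x \<in> topspace X. \<epsilon> \<le> norm (f x)}"
    have "openin ?C V" unfolding V_def using closed[OF \<epsilon>] by blast
    moreover have "y \<in> V" using y True \<epsilon> g_e by (force simp: V_def)
    moreover have "dist (g z) (g y) < \<epsilon>" if "z \<in> V" for z
      using that True g_e g_0 \<epsilon> by (cases "z \<in> ?e ` topspace X") (auto simp: V_def not_le)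
    ultimately show ?thesis by blast
  next
    case False
    then obtain x0 where x0: "x0 \<in> topspace X" "y = ?e x0" using g_0 by blast
    \<comment> \<open>Half the norm at \<open>x0\<close>: \<open>W\<close> is then a neighbourhood
      of \<open>x0\<close> contained in a compact superlevel set.\<close>
    define \<delta> where "\<delta> = norm (f x0) / 2"
    have "f x0 \<noteq> 0" using False g_e x0 by simp
    then have \<delta>: "\<delta> > 0" "\<delta> < norm (f x0)" by (simp_all add: \<delta>_def)
    define W where "W = {x \<in> topspace X. f x \<in> {v. \<delta> < norm v} \<inter> ball (f x0) \<epsilon>}"
    have "open ({v. \<delta> < norm v} \<inter> ball (f x0) \<epsilon>)"
      by (intro open_Int open_Collect_less continuous_intros open_ball)
    then have W: "openin X W" unfolding W_def by (intro openin_continuous_map_preimage[OF f]) simp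
    have "x0 \<in> topspace X - (topspace X - W)" using x0 \<delta> \<epsilon> by (simp add: W_def)
    then obtain h where h: "h \<in> H" "h x0 \<notin> closure (h ` (topspace X - W))"
      using sep W unfolding separates_points_from_closed_def by (metis closedin_diff closedin_topspace)
    \<comment> \<open>\<open>V\<close> meets the dense set \<open>?e ` topspace X\<close> only inside \<open>?e ` W\<close>, which lies in a compact subset of it\<close>
    define V where "V = {v \<in> topspace ?C. v h \<in> - closure (h ` (topspace X - W))}"
    have V: "openin ?C V"
      unfolding V_def by (intro openin_continuous_map_preimage[OF continuous_map_compactification_proj[OF h(1)]]) auto
    have V_W: "x \<in> W" if "x \<in> topspace X" "?e x \<in> V" for x
      using that h(1) closure_subset[of "h ` (topspace X - W)"] by (auto simp: V_def eval_map_def)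
    \<comment> \<open>An open set lies in the closure of its trace on a dense set. The trace of
      \<open>V\<close> lies in a closed subset of the image of \<open>X\<close>, so \<open>V\<close>
      contains no point of the remainder.\<close>
    have "V \<inter> topspace ?C \<subseteq> ?C closure_of (V \<inter> ?e ` topspace X)"
      using openin_Int_closure_of_subset[OF V, of "?e ` topspace X"] by (simp add: eval_map_dense[OF H])
    also have "\<dots> \<subseteq> ?e ` {x \<in> topspace X. \<delta> \<le> norm (f x)}"
    proof (rule closure_of_minimal[OF _ closed[OF \<delta>(1)]], clarify)
      fix x assume "?e x \<in> V" "x \<in> topspace X"
      then show "?e x \<in> ?e ` {x \<in> topspace X. \<delta> \<le> norm (f x)}"
        using V_W[of x] by (intro imageI) (simp add: W_def)
    qed
    finally have "V \<subseteq> ?e ` topspace X" using openin_subset[OF V] by blast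
    then have "dist (g z) (g y) < \<epsilon>" if "z \<in> V" for z
      using that V_W g_e x0 by (force simp: W_def dist_commute)
    moreover have "y \<in> V" using y h x0 by (simp add: V_def eval_map_def)
    ultimately show ?thesis using V by blast
  qed
  then have "continuous_map ?C Met_TC.mtopology g"
    unfolding Met_TC.continuous_map_to_metric by (auto simp: dist_commute)
  then show ?thesis by simp
qed

section \<open>Generalized Young measures\<close>

text \<open>Here \<open>W\<close> plays the role of \<open>(1 - |w|)\<^sup>p\<close> and \<open>g\<close> that of the extension of \<open>T\<Phi>\<close>, so that
  \<open>g / W\<close> is \<open>\<Phi>\<close> in ball coordinates; \<open>g / W\<close> takes the junk value \<open>0\<close> on the remainder, where \<open>W = 0\<close>.\<close>

lemma generalized_young_measure_core:
  fixes \<mu> :: "'a measure"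
    and e :: "'a \<Rightarrow> 's::{complete_space, second_countable_topology}"
    and v :: "nat \<Rightarrow> 'a \<Rightarrow> 't::{complete_space, second_countable_topology}"
  assumes \<mu>: "finite_measure \<mu>" and K: "compact K" and L: "compact L"
    and e [measurable]: "e \<in> borel_measurable \<mu>" and e_fun: "e \<in> space \<mu> \<rightarrow> K"
    and v [measurable]: "\<And>k. v k \<in> borel_measurable \<mu>" and v_L: "\<And>k x. x \<in> space \<mu> \<Longrightarrow> v k x \<in> L"
    and W_cont: "continuous_on L W" and W_nonneg: "\<And>y. 0 \<le> W y" and W_supp: "\<forall>y. y \<notin> L \<longrightarrow> W y = 0"
    and W_v: "\<And>k x. x \<in> space \<mu> \<Longrightarrow> 0 < W (v k x)"
    and int: "\<And>k. integrable \<mu> (\<lambda>x. 1 / W (v k x))" and B: "\<And>k. (LINT x|\<mu>. 1 / W (v k x)) \<le> B"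
    and L_ne: "L \<noteq> {}" and R_ne: "{y \<in> L. W y = 0} \<noteq> {}"
  shows "\<exists>r \<kappa>1 l \<kappa>2. strict_mono (r :: nat \<Rightarrow> nat) \<and> \<kappa>1 \<in> borel \<rightarrow>\<^sub>M prob_algebra borel \<and>
    finite_measure l \<and> sets l = sets borel \<and> (AE x in l. x \<in> K) \<and> \<kappa>2 \<in> borel \<rightarrow>\<^sub>M prob_algebra borel \<and>
    (AE x in \<mu>. AE y in \<kappa>1 (e x). 0 < W y) \<and> (\<forall>x. AE y in \<kappa>2 x. y \<in> L \<and> W y = 0) \<and>
    (\<forall>g :: 's \<times> 't \<Rightarrow> real. continuous_on (K \<times> L) g \<longrightarrow> (\<forall>p. p \<notin> K \<times> L \<longrightarrow> g p = 0) \<longrightarrow>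
      (AE x in \<mu>. integrable (\<kappa>1 (e x)) (\<lambda>y. g (e x, y) / W y)) \<and>
      integrable \<mu> (\<lambda>x. LINT y|\<kappa>1 (e x). g (e x, y) / W y) \<and>
      (AE x in l. integrable (\<kappa>2 x) (\<lambda>y. g (x, y))) \<and>
      integrable l (\<lambda>x. LINT y|\<kappa>2 x. g (x, y)) \<and>
      (\<lambda>k. LINT x|\<mu>. g (e x, v (r k) x) / W (v (r k) x)) \<longlonglongrightarrow>
        (LINT x|\<mu>. LINT y|\<kappa>1 (e x). g (e x, y) / W y) + (LINT x|l. LINT y|\<kappa>2 x. g (x, y)))"
proof -
  interpret \<mu>: finite_measure \<mu> by (rule \<mu>)
  have e_K: "e x \<in> K" if "x \<in> space \<mu>" for x using e_fun that by auto
  have W_0: "W y = 0" if "y \<notin> L" for y using W_supp that by blast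
  note W = W_cont W_nonneg W_0
  define S where "S = K \<times> L"
  have S: "compact S" unfolding S_def by (rule compact_Times[OF K L])
  have [measurable]: "L \<in> sets borel" "K \<in> sets borel" "S \<in> sets borel"
    using K L S by (auto intro: borel_compact)
  have [measurable]: "W \<in> borel_measurable borel"
  proof -
    have "(\<lambda>y. indicator L y *\<^sub>R W y) \<in> borel_measurable borel"
      by (rule borel_measurable_continuous_on_indicator[OF _ W(1)]) simp
    moreover have "(\<lambda>y. indicator L y *\<^sub>R W y) = W" using W(3) by (auto simp: indicator_def fun_eq_iff)
    ultimately show ?thesis by (simp only:)
  qed
  have g_meas: "g \<in> borel_measurable borel"
    if "continuous_on S g" "\<And>p. p \<notin> S \<Longrightarrow> g p = 0" for g :: "'s \<times> 't \<Rightarrow> real"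
  proof -
    have "(\<lambda>y. indicator S y *\<^sub>R g y) \<in> borel_measurable borel"
      by (rule borel_measurable_continuous_on_indicator[OF _ that(1)]) simp
    moreover have "(\<lambda>y. indicator S y *\<^sub>R g y) = g" using that(2) by (auto simp: indicator_def fun_eq_iff)
    ultimately show ?thesis by (simp only:)
  qed

  \<comment> \<open>Lifted measures and their weak limit\<close>
  define E where "E k x = (e x, v k x)" for k x
  have E [measurable]: "E k \<in> \<mu> \<rightarrow>\<^sub>M borel" for k unfolding E_def borel_prod[symmetric] by measurable
  have E_S: "E k x \<in> S" if "x \<in> space \<mu>" for k x using that e_K v_L by (simp add: E_def S_def)
  define P where "P k = distr (density \<mu> (\<lambda>x. ennreal (1 / W (v k x)))) borel (E k)" for k
  have P_int: "(LINT p|P k. g p) = (LINT x|\<mu>. g (E k x) / W (v k x))"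
    if [measurable]: "g \<in> borel_measurable borel" for g :: "'s \<times> 't \<Rightarrow> real" and k
    unfolding P_def using W(2)
    by (subst integral_distr) (auto simp: integral_density)
  have P_mass: "emeasure (P k) UNIV = ennreal (LINT x|\<mu>. 1 / W (v k x))" for k
  proof -
    have "emeasure (P k) UNIV = (\<integral>\<^sup>+x. ennreal (1 / W (v k x)) \<partial>\<mu>)"
      unfolding P_def by (subst emeasure_distr) (auto simp: emeasure_density intro!: nn_integral_cong)
    then show ?thesis using nn_integral_eq_integral[OF int, of k] W(2) by simp
  qed
  have P_fin: "finite_measure (P k)" for k
    by (rule finite_measureI) (use P_mass[of k] in \<open>simp add: P_def\<close>)
  have "AE p in P k. p \<in> S" for k
    unfolding P_def by (subst AE_distr_iff) (auto simp: AE_density E_S intro!: AE_I2)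
  moreover have "measure (P k) UNIV \<le> B" for k
    using P_mass[of k] B[of k] W(2) by (simp add: measure_def)
  ultimately obtain r Q where r: "strict_mono (r :: nat \<Rightarrow> nat)" and Q: "finite_measure Q"
    "sets Q = sets borel" "AE p in Q. p \<in> S" and
    conv: "\<And>g :: 's \<times> 't \<Rightarrow> real. continuous_on S g \<Longrightarrow> (\<lambda>k. LINT p:S|P (r k). g p) \<longlonglongrightarrow> (LINT p:S|Q. g p)"
    using finite_measures_on_compact_weakly_convergent_subseq[of S P B, OF S P_fin]
    by (metis P_def sets_distr)
  interpret Q: finite_measure Q by (rule Q)
  note [measurable_cong] = Q(2)
  have conv: "(\<lambda>k. LINT x|\<mu>. g (E (r k) x) / W (v (r k) x)) \<longlonglongrightarrow> (LINT p|Q. g p)"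
    if g: "continuous_on S g" "\<And>p. p \<notin> S \<Longrightarrow> g p = 0" for g :: "'s \<times> 't \<Rightarrow> real"
  proof -
    have ind: "(\<lambda>p. indicator S p *\<^sub>R g p) = g" using g(2) by (auto simp: indicator_def fun_eq_iff)
    have "(LINT p:S|P k. g p) = (LINT x|\<mu>. g (E k x) / W (v k x))" for k
      unfolding set_lebesgue_integral_def ind by (rule P_int[OF g_meas[OF g]])
    moreover have "(LINT p:S|Q. g p) = (LINT p|Q. g p)"
      unfolding set_lebesgue_integral_def ind ..
    ultimately show ?thesis using conv[OF g(1)] by simp
  qed
  have Q_int: "integrable Q g" if g: "continuous_on S g" "\<And>p. p \<notin> S \<Longrightarrow> g p = 0" for g :: "'s \<times> 't \<Rightarrow> real"
  proof -
    have "compact (g ` S)" by (rule compact_continuous_image[OF g(1) S])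
    then obtain C where C: "\<And>x. x \<in> S \<Longrightarrow> \<bar>g x\<bar> \<le> C"
      using compact_imp_bounded by (force simp: bounded_iff)
    have bd: "norm (g p) \<le> \<bar>C\<bar>" for p using C[of p] g(2)[of p] by (cases "p \<in> S") auto
    show ?thesis
      by (rule Q.integrable_const_bound[of _ "\<bar>C\<bar>"]) (use bd g_meas[OF g] in \<open>auto simp: measurable_cong_sets[OF Q(2) refl]\<close>)
  qed
  have W_snd: "continuous_on S (\<lambda>p. W (snd p))"
    by (rule continuous_on_compose2[OF W(1)]) (auto simp: S_def intro: continuous_intros)
  have sets_Q: "sets Q = sets (borel \<Otimes>\<^sub>M borel)" by (simp only: Q(2) borel_prod)
  have [measurable]: "(\<lambda>p. W (snd p)) \<in> borel_measurable (borel :: ('s \<times> 't) measure)"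
    by (subst borel_prod[symmetric]) measurable

  \<comment> \<open>Splitting of the limit along the zero set of the weight\<close>
  define R where "R = {y \<in> L. W y = 0}"
  have R_meas [measurable]: "R \<in> sets borel" unfolding R_def by measurable
  have R_snd [measurable]: "{p. snd p \<in> R} \<in> sets (borel :: ('s \<times> 't) measure)"
  proof -
    have "{p \<in> space (borel \<Otimes>\<^sub>M borel). snd p \<in> R} \<in> sets (borel \<Otimes>\<^sub>M borel :: ('s \<times> 't) measure)" by measurable
    then show ?thesis by (simp only: borel_prod space_borel) simp
  qed
  have R: "compact R"
  proof -
    have "closedin (top_of_set L) (L \<inter> W -` {0})" by (rule continuous_closedin_preimage[OF W(1)]) simp
    then show ?thesis
      using closedin_compact[OF L] by (simp add: R_def Int_def vimage_def)
  qed
  \<comment> \<open>The factor \<open>W\<close> removes the mass over \<open>R\<close> from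
    \<open>m1\<close>, and \<open>m2\<close> keeps exactly that mass. An integrand \<open>g\<close>
    must therefore be divided by \<open>W\<close> before it is integrated against
    \<open>m1\<close>.\<close>
  define m1 where "m1 = density Q (\<lambda>p. ennreal (W (snd p)))"
  define m2 where "m2 = density Q (indicator {p. snd p \<in> R})"
  have sets_m: "sets m1 = sets (borel \<Otimes>\<^sub>M borel)" "sets m2 = sets (borel \<Otimes>\<^sub>M borel)"
    by (simp_all add: m1_def m2_def sets_Q)
  have sets_m': "sets m1 = sets borel" "sets m2 = sets borel" by (simp_all only: sets_m borel_prod)
  have m1_int: "(integrable m1 h \<longleftrightarrow> integrable Q (\<lambda>p. W (snd p) * h p)) \<and> (LINT p|m1. h p) = (LINT p|Q. W (snd p) * h p)"
    if "h \<in> borel_measurable borel" for h :: "'s \<times> 't \<Rightarrow> real"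
    unfolding m1_def using that W(2) by (subst integrable_density integral_density; simp cong: measurable_cong_sets)+
  have m2_eq: "m2 = density Q (\<lambda>p. ennreal (indicator {p. snd p \<in> R} p))"
    unfolding m2_def by (rule arg_cong[where f = "density Q"]) (auto simp: indicator_def)
  have m2_int: "(integrable m2 h \<longleftrightarrow> integrable Q (\<lambda>p. indicator {p. snd p \<in> R} p * h p)) \<and>
      (LINT p|m2. h p) = (LINT p|Q. indicator {p. snd p \<in> R} p * h p)"
    if "h \<in> borel_measurable borel" for h :: "'s \<times> 't \<Rightarrow> real"
    unfolding m2_eq using that by (subst integrable_density integral_density; simp cong: measurable_cong_sets)+
  \<comment> \<open>\<open>conv\<close> admits only functions that vanish off \<open>S\<close>;
    \<open>g0\<close> is the weight cut off accordingly and equals it almost everywhere for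
    \<open>Q\<close>.\<close>
  define g0 where "g0 p = indicator S p * W (snd p)" for p
  have g0_cont: "continuous_on S g0"
    by (rule continuous_on_eq[OF W_snd]) (simp add: g0_def)
  have g0_0: "g0 p = 0" if "p \<notin> S" for p using that by (simp add: g0_def)
  note g0 = g0_cont g0_0
  have AE_g0: "AE p in Q. g0 p = W (snd p)"
    using Q(3) by eventually_elim (simp add: g0_def)
  have int_W: "integrable Q (\<lambda>p. W (snd p))"
    using Q_int[OF g0] by (rule integrable_cong_AE[THEN iffD1, rotated 3])
      (use AE_g0 g_meas[OF g0] in \<open>auto simp: measurable_cong_sets[OF Q(2) refl]\<close>)
  have m1_fin: "finite_measure m1"
  proof (rule finite_measureI)
    have "emeasure m1 (space m1) = (\<integral>\<^sup>+p. ennreal (W (snd p)) \<partial>Q)"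
      using sets_eq_imp_space_eq[OF Q(2)]
      by (simp add: m1_def emeasure_density measurable_cong_sets[OF Q(2) refl] Q(2))
    then show "emeasure m1 (space m1) \<noteq> \<infinity>" using nn_integral_eq_integral[OF int_W] W(2) by simp
  qed
  have m2_fin: "finite_measure m2"
    unfolding m2_def by (rule Q.finite_measure_restricted) (simp add: Q(2))
  have m1_L: "AE p in m1. snd p \<in> L"
    unfolding m1_def using Q(3) W(3)
    by (subst AE_density) (auto simp: S_def measurable_cong_sets[OF Q(2) refl] elim!: eventually_mono)
  have m1_W: "AE p in m1. 0 < W (snd p)"
    unfolding m1_def by (subst AE_density) (auto simp: measurable_cong_sets[OF Q(2) refl])
  have m2_R: "AE p in m2. snd p \<in> R"
    unfolding m2_def by (subst AE_density) (auto simp: indicator_def measurable_cong_sets[OF Q(2) refl])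
  have m2_S: "AE p in m2. fst p \<in> K"
    unfolding m2_def using Q(3)
    by (subst AE_density) (auto simp: S_def measurable_cong_sets[OF Q(2) refl] elim!: eventually_mono)
  have [measurable]: "fst \<in> m1 \<rightarrow>\<^sub>M borel" "fst \<in> m2 \<rightarrow>\<^sub>M borel"
    by (simp_all add: measurable_cong_sets[OF sets_m(1) refl] measurable_cong_sets[OF sets_m(2) refl])
  \<comment> \<open>For a test function of \<open>x\<close> alone, \<open>W\<close> cancels the
    density \<open>1 / W (v k x)\<close>, so the approximating integrals do not depend on
    \<open>k\<close> and their common value is the limit.\<close>
  have marg: "distr m1 borel fst = distr \<mu> borel e"
  proof (rule finite_measure_eqI_continuous)
    show "finite_measure (distr m1 borel fst)" by (rule finite_measure.finite_measure_distr[OF m1_fin]) simp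
    show "finite_measure (distr \<mu> borel e)" by (rule \<mu>.finite_measure_distr) simp
    fix f :: "'s \<Rightarrow> real" assume f: "continuous_on UNIV f"
    have [measurable]: "f \<in> borel_measurable borel" by (rule borel_measurable_continuous_onI[OF f])
    have f_fst [measurable]: "(\<lambda>p. f (fst p)) \<in> borel_measurable (borel :: ('s \<times> 't) measure)"
      by (subst borel_prod[symmetric]) measurable
    define g where "g p = f (fst p) * g0 p" for p
    have "continuous_on S g" unfolding g_def
      by (intro continuous_on_mult g0 continuous_on_compose2[OF f]) (auto intro: continuous_intros)
    moreover have "g p = 0" if "p \<notin> S" for p using g0(2)[OF that] by (simp add: g_def)
    ultimately have lim: "(\<lambda>k. LINT x|\<mu>. g (E (r k) x) / W (v (r k) x)) \<longlonglongrightarrow> (LINT p|Q. g p)"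
      and g_m [measurable]: "g \<in> borel_measurable borel"
      using conv[of g] g_meas[of g] by blast+
    have const: "(LINT x|\<mu>. g (E k x) / W (v k x)) = (LINT x|\<mu>. f (e x))" for k
    proof (rule Bochner_Integration.integral_cong)
      fix x assume "x \<in> space \<mu>"
      then show "g (E k x) / W (v k x) = f (e x)"
        using E_S[of x k] W_v[of x k] by (simp add: g_def g0_def E_def)
    qed simp
    have "(LINT p|Q. g p) = (LINT x|\<mu>. f (e x))" using lim by (simp add: const LIMSEQ_const_iff)
    moreover have "(LINT p|Q. g p) = (LINT p|Q. W (snd p) * f (fst p))"
    proof (rule integral_cong_AE)
      show "g \<in> borel_measurable Q" "(\<lambda>p. W (snd p) * f (fst p)) \<in> borel_measurable Q"
        unfolding measurable_cong_sets[OF Q(2) refl] by measurable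
      show "AE p in Q. g p = W (snd p) * f (fst p)"
        using AE_g0 by eventually_elim (simp add: g_def)
    qed
    moreover have "(LINT p|Q. W (snd p) * f (fst p)) = (LINT x|distr m1 borel fst. f x)"
      by (subst integral_distr) (use m1_int[OF f_fst] in auto)
    moreover have "(LINT x|distr \<mu> borel e. f x) = (LINT x|\<mu>. f (e x))"
      by (rule integral_distr) auto
    ultimately show "(LINT x|distr m1 borel fst. f x) = (LINT x|distr \<mu> borel e. f x)" by simp
  qed auto
  \<comment> \<open>The disintegration is over the compact set \<open>L\<close>, as
    \<open>{y. 0 < W y}\<close> is not known to be compact; positivity on the fibres is recovered
    through \<open>AE_dis\<close>.\<close>
  obtain \<kappa>1 where \<kappa>1: "\<kappa>1 \<in> borel \<rightarrow>\<^sub>M prob_algebra borel" and dis1: "\<And>f. f \<in> borel_measurable (borel \<Otimes>\<^sub>M borel) \<Longrightarrow>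
    (\<integral>\<^sup>+p. f p \<partial>m1) = (\<integral>\<^sup>+x. \<integral>\<^sup>+y. f (x, y) \<partial>\<kappa>1 x \<partial>distr m1 borel fst)"
    using compact_disintegration[OF m1_fin sets_m(1) L L_ne m1_L] by blast
  \<comment> \<open>Here \<open>R\<close> itself is compact and nonempty, so every fibre is a
    probability carried by \<open>R\<close>, even if \<open>m2\<close> is zero.\<close>
  obtain \<kappa>2 where \<kappa>2: "\<kappa>2 \<in> borel \<rightarrow>\<^sub>M prob_algebra borel" and dis2: "\<And>f. f \<in> borel_measurable (borel \<Otimes>\<^sub>M borel) \<Longrightarrow>
    (\<integral>\<^sup>+p. f p \<partial>m2) = (\<integral>\<^sup>+x. \<integral>\<^sup>+y. f (x, y) \<partial>\<kappa>2 x \<partial>distr m2 borel fst)"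
    and \<kappa>2_R: "\<And>x. AE y in \<kappa>2 x. y \<in> R"
    using compact_disintegration[OF m2_fin sets_m(2) R R_ne[folded R_def] m2_R] unfolding space_borel by blast
  have AE_dis: "AE x in distr m borel fst. AE y in \<kappa> x. y \<in> Y"
    if m: "sets m = sets (borel \<Otimes>\<^sub>M borel)" and \<kappa>: "\<kappa> \<in> borel \<rightarrow>\<^sub>M prob_algebra borel" and dis: "\<And>f. f \<in> borel_measurable (borel \<Otimes>\<^sub>M borel) \<Longrightarrow>
      (\<integral>\<^sup>+p. f p \<partial>m) = (\<integral>\<^sup>+x. \<integral>\<^sup>+y. f (x, y) \<partial>\<kappa> x \<partial>distr m borel fst)"
      and Y [measurable]: "Y \<in> sets borel" and AE: "AE p in m. snd p \<in> Y" for m :: "('s \<times> 't) measure" and \<kappa> Y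
  proof -
    have sets_\<kappa>: "sets (\<kappa> x) = sets borel" for x
      using subprob_measurableD(2)[OF measurable_prob_algebraD[OF \<kappa>], of x] by simp
    have em: "(\<lambda>x. emeasure (\<kappa> x) (- Y)) \<in> borel_measurable borel"
      by (rule measurable_emeasure_kernel[OF measurable_prob_algebraD[OF \<kappa>]]) simp
    have "AE p in m. indicator (- Y) (snd p) = (0 :: ennreal)" using AE by eventually_elim simp
    then have "(\<integral>\<^sup>+p. indicator (- Y) (snd p) \<partial>m) = 0" by (simp add: nn_integral_cong_AE)
    then have "(\<integral>\<^sup>+x. \<integral>\<^sup>+y. indicator (- Y) y \<partial>\<kappa> x \<partial>distr m borel fst) = 0"
      by (subst (asm) dis) auto
    then have "(\<integral>\<^sup>+x. emeasure (\<kappa> x) (- Y) \<partial>distr m borel fst) = 0"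
      by (simp add: sets_\<kappa>)
    then have "AE x in distr m borel fst. emeasure (\<kappa> x) (- Y) = 0"
      by (subst (asm) nn_integral_0_iff_AE) (simp_all add: em)
    then show ?thesis
      by eventually_elim (auto intro!: AE_I'[of "- Y"] simp: null_sets_def sets_\<kappa>)
  qed
  have W_pos: "{y. 0 < W y} \<in> sets borel" by measurable
  have c1: "AE x in \<mu>. AE y in \<kappa>1 (e x). 0 < W y"
  proof -
    have "AE x in distr \<mu> borel e. AE y in \<kappa>1 x. y \<in> {y. 0 < W y}"
      using AE_dis[OF sets_m(1) \<kappa>1 dis1 W_pos] m1_W unfolding marg by simp
    from AE_distrD[OF e this] show ?thesis by simp
  qed
  define l where "l = distr m2 borel fst"
  have l: "finite_measure l" "sets l = sets borel"
    by (simp_all add: l_def finite_measure.finite_measure_distr[OF m2_fin])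
  have l_K: "AE x in l. x \<in> K"
    unfolding l_def by (subst AE_distr_iff) (use m2_S in auto)
  have c2: "\<forall>x. AE y in \<kappa>2 x. y \<in> L \<and> W y = 0"
    using \<kappa>2_R by (simp add: R_def)

  \<comment> \<open>Limit formula for a fixed test function\<close>
  have main: "(AE x in \<mu>. integrable (\<kappa>1 (e x)) (\<lambda>y. g (e x, y) / W y)) \<and>
      integrable \<mu> (\<lambda>x. LINT y|\<kappa>1 (e x). g (e x, y) / W y) \<and>
      (AE x in l. integrable (\<kappa>2 x) (\<lambda>y. g (x, y))) \<and>
      integrable l (\<lambda>x. LINT y|\<kappa>2 x. g (x, y)) \<and>
      (\<lambda>k. LINT x|\<mu>. g (e x, v (r k) x) / W (v (r k) x)) \<longlonglongrightarrow>
        (LINT x|\<mu>. LINT y|\<kappa>1 (e x). g (e x, y) / W y) + (LINT x|l. LINT y|\<kappa>2 x. g (x, y))"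
    if "continuous_on (K \<times> L) g" "\<forall>p. p \<notin> K \<times> L \<longrightarrow> g p = 0" for g :: "'s \<times> 't \<Rightarrow> real"
  proof -
    have g: "continuous_on S g" "\<And>p. p \<notin> S \<Longrightarrow> g p = 0" using that unfolding S_def by blast+
    have [measurable]: "g \<in> borel_measurable borel" by (rule g_meas[OF g])
    define h where "h p = g p / W (snd p)" for p
    have [measurable]: "h \<in> borel_measurable borel" unfolding h_def by measurable
    have int_g: "integrable Q g" by (rule Q_int[OF g])
    have pos: "{p. 0 < W (snd p)} \<in> sets (borel :: ('s \<times> 't) measure)" by measurable
    \<comment> \<open>Division by zero gives 0, so multiplying back by \<open>W\<close> restores
      \<open>g\<close> only where \<open>W\<close> is positive; the rest of \<open>g\<close> on
      \<open>S\<close> sits over \<open>R\<close> and is collected by \<open>m2\<close>.\<close>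
    have Wh: "W (snd p) * h p = indicator {p. 0 < W (snd p)} p * g p" for p
      using W(2)[of "snd p"] by (auto simp: h_def indicator_def less_le)
    have int1: "integrable Q (\<lambda>p. indicator {p. 0 < W (snd p)} p * g p)"
      using integrable_mult_indicator[OF _ int_g, of "{p. 0 < W (snd p)}"] pos by (simp add: Q(2))
    have int2: "integrable Q (\<lambda>p. indicator {p. snd p \<in> R} p * g p)"
      using integrable_mult_indicator[OF _ int_g, of "{p. snd p \<in> R}"] R_snd by (simp add: Q(2))
    have int_h: "integrable m1 h" using m1_int[of h] int1 by (simp add: Wh)
    have int_g2: "integrable m2 g" using m2_int[of g] int2 by simp
    have sum: "(LINT p|m1. h p) + (LINT p|m2. g p) = (LINT p|Q. g p)"
    proof -
      have "indicator {p. 0 < W (snd p)} p * g p + indicator {p. snd p \<in> R} p * g p = g p" for p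
        using g(2)[of p] W(2)[of "snd p"] by (cases "p \<in> S") (auto simp: indicator_def R_def S_def less_le)
      then show ?thesis
        using m1_int[of h] m2_int[of g] Bochner_Integration.integral_add[OF int1 int2] by (simp add: Wh)
    qed
    note d1 = disintegration_integral[OF sets_m(1) \<kappa>1 dis1 int_h, unfolded marg]
    note d2 = disintegration_integral[OF sets_m(2) \<kappa>2 dis2 int_g2, folded l_def]
    have "(\<lambda>x. LINT y|\<kappa>1 x. h (x, y)) \<in> borel_measurable borel"
      using borel_measurable_integrable[OF d1(2)] by simp
    then have "integrable \<mu> (\<lambda>x. LINT y|\<kappa>1 (e x). h (e x, y))"
      and "(LINT x|\<mu>. LINT y|\<kappa>1 (e x). h (e x, y)) = (LINT p|m1. h p)"
      using d1(2,3) by (simp_all add: integrable_distr_eq integral_distr)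
    moreover have "AE x in \<mu>. integrable (\<kappa>1 (e x)) (\<lambda>y. h (e x, y))"
      using AE_distrD[OF e d1(1)] .
    ultimately show ?thesis
      using d2 conv[OF g] sum by (simp add: h_def E_def)
  qed
  show ?thesis
    using r \<kappa>1 l l_K \<kappa>2 c1 c2 main by (intro exI[of _ r] exI[of _ \<kappa>1] exI[of _ l] exI[of _ \<kappa>2]) blast
qed

section \<open>Borel sets of an abstract topology, and functions on the compactified ball\<close>

lemma space_borel_of: "space (borel_of X) = topspace X"
  by (simp add: borel_of_def space_measure_of_conv)

lemma sets_borel_of: "sets (borel_of X) = sigma_sets (topspace X) {U. openin X U}"
  unfolding borel_of_def by (rule sets_measure_of) (auto dest: openin_subset)

lemma continuous_map_borel_of_measurable:
  assumes "continuous_map X (euclidean :: 'b::topological_space topology) f"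
  shows "f \<in> borel_measurable (borel_of X)"
proof (rule borel_measurableI)
  fix S :: "'b set" assume "open S"
  then have "openin X {x \<in> topspace X. f x \<in> S}"
    by (intro openin_continuous_map_preimage[OF assms]) simp
  moreover have "f -` S \<inter> space (borel_of X) = {x \<in> topspace X. f x \<in> S}" by (auto simp: space_borel_of)
  ultimately show "f -` S \<inter> space (borel_of X) \<in> sets (borel_of X)" by (simp add: sets_borel_of)
qed

lemma continuous_map_measurable_borel_of:
  assumes "continuous_map (top_of_set S) X f"
  shows "f \<in> restrict_space borel S \<rightarrow>\<^sub>M borel_of X"
  unfolding borel_of_def
proof (rule measurable_measure_of)
  show "f \<in> space (restrict_space borel S) \<rightarrow> topspace X"
    using continuous_map_funspace[OF assms] by (simp add: space_restrict_space)
  fix U assume "U \<in> {U. openin X U}"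
  then have "openin (top_of_set S) {x \<in> S. f x \<in> U}"
    using openin_continuous_map_preimage[OF assms, of U] by simp
  then obtain T where T: "open T" "{x \<in> S. f x \<in> U} = S \<inter> T" by (auto simp: openin_open)
  moreover have "f -` U \<inter> space (restrict_space borel S) = {x \<in> S. f x \<in> U}" by (auto simp: space_restrict_space)
  ultimately show "f -` U \<inter> space (restrict_space borel S) \<in> sets (restrict_space borel S)"
    by (auto simp: sets_restrict_space)
qed (auto dest: openin_subset)

lemma inj_on_eval_map:
  assumes "t1_space X" and sep: "separates_points_from_closed X H"
  shows "inj_on (eval_map H) (topspace X)"
proof (rule inj_onI, rule ccontr)
  fix x y assume xy: "x \<in> topspace X" "y \<in> topspace X" "eval_map H x = eval_map H y" "x \<noteq> y"
  then have "closedin X {y}" using assms(1) by (simp add: t1_space_closedin_singleton)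
  then obtain f where f: "f \<in> H" "f x \<notin> closure (f ` {y})"
    using sep xy unfolding separates_points_from_closed_def by blast
  have "f x = f y" using fun_cong[OF xy(3), of f] f(1) by (simp add: eval_map_def)
  then show False using f(2) by simp
qed

text \<open>The bound places each set \<open>\<epsilon> \<le> norm (f w)\<close> in the closed ball
  of radius \<open>1 - \<epsilon>\<close>, hence makes it compact. It serves for
  \<open>1 - norm w\<close> and \<open>(1 - norm w) *\<^sub>R w\<close>, from which the weight and
  the point \<open>z\<close> are recovered.\<close>

lemma ball_compactification_zero_extension:
  fixes G :: "('b::euclidean_space \<Rightarrow> real) set" and f :: "'b \<Rightarrow> 'c::real_normed_vector"
  assumes G: "G \<subseteq> mspace (BC unit_ball_top)" and sep: "separates_points_from_closed unit_ball_top G"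
    and f: "continuous_on UNIV f" and le: "\<And>w. norm w < 1 \<Longrightarrow> norm (f w) \<le> 1 - norm w"
  obtains g where "continuous_map (compactification unit_ball_top G) euclidean g"
    "\<And>w. w \<in> ball 0 1 \<Longrightarrow> g (eval_map G w) = f w" "\<And>y. y \<notin> eval_map G ` ball 0 1 \<Longrightarrow> g y = 0"
proof -
  have inj: "inj_on (eval_map G) (topspace unit_ball_top)"
    by (rule inj_on_eval_map[OF _ sep]) (simp add: Hausdorff_imp_t1_space Hausdorff_space_subtopology)
  define g where "g y = (if y \<in> eval_map G ` ball 0 1 then f (inv_into (ball 0 1) (eval_map G) y) else 0)" for y
  have vanish: "compactin unit_ball_top {w \<in> topspace unit_ball_top. \<epsilon> \<le> norm (f w)}" if "\<epsilon> > 0" for \<epsilon>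
  proof -
    have eq: "{w \<in> topspace unit_ball_top. \<epsilon> \<le> norm (f w)} = cball 0 (1 - \<epsilon>) \<inter> {w. \<epsilon> \<le> norm (f w)}"
    proof (intro equalityI subsetI)
      fix w assume "w \<in> {w \<in> topspace unit_ball_top. \<epsilon> \<le> norm (f w)}"
      then show "w \<in> cball 0 (1 - \<epsilon>) \<inter> {w. \<epsilon> \<le> norm (f w)}" using le[of w] by auto
    next
      fix w assume "w \<in> cball 0 (1 - \<epsilon>) \<inter> {w. \<epsilon> \<le> norm (f w)}"
      then show "w \<in> {w \<in> topspace unit_ball_top. \<epsilon> \<le> norm (f w)}" using \<open>\<epsilon> > 0\<close> by auto
    qed
    have "closed {w. \<epsilon> \<le> norm (f w)}" by (intro closed_Collect_le continuous_intros f)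
    then have "compact {w \<in> topspace unit_ball_top. \<epsilon> \<le> norm (f w)}"
      unfolding eq by (intro compact_Int_closed compact_cball)
    then show ?thesis by (auto simp: compactin_subtopology)
  qed
  have "continuous_map unit_ball_top euclidean f"
    using f continuous_on_subset by auto
  from zero_extension_continuous[OF G sep inj this vanish]
  have "continuous_map (compactification unit_ball_top G) euclidean g"
    unfolding topspace_euclidean_subtopology g_def .
  moreover have "g (eval_map G w) = f w" if "w \<in> ball 0 1" for w
    using inv_into_f_f[of "eval_map G" "ball 0 1" w] inj that by (simp add: g_def)
  moreover have "g y = 0" if "y \<notin> eval_map G ` ball 0 1" for y
    using that by (simp add: g_def)
  ultimately show thesis by (rule that)
qed

text \<open>The integrability clauses guarantee that the iterated integrals in the limit are
  genuine, since the Bochner integral of a non-integrable function is 0 by convention.\<close>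

theorem mainTheorem1:
  fixes \<Omega> :: "(real ^ 'n) set"
    and \<mu> :: "(real ^ 'n) measure"
    and p :: real
    and F :: "(real ^ 'n \<Rightarrow> real) set"
    and G :: "(real ^ 'd \<Rightarrow> real) set"
    and u :: "nat \<Rightarrow> real ^ 'n \<Rightarrow> real ^ 'd"
  assumes "open \<Omega>" and "bounded \<Omega>"
    and "sets \<mu> = sets (restrict_space borel \<Omega>)" and "finite_measure \<mu>"
    and "1 \<le> p"
    and "subalgebra_BC (top_of_set \<Omega>) F" and "closedin (mtopology_of (BC (top_of_set \<Omega>))) F"
    and "separable_space (subtopology (mtopology_of (BC (top_of_set \<Omega>))) F)"
    and "contains_constants (top_of_set \<Omega>) F" and "separates_points_from_closed (top_of_set \<Omega>) F"
    and "subalgebra_BC unit_ball_top G" and "closedin (mtopology_of (BC unit_ball_top)) G"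
    and "separable_space (subtopology (mtopology_of (BC unit_ball_top)) G)"
    and "contains_constants unit_ball_top G" and "separates_points_from_closed unit_ball_top G"
    and "\<And>k. u k \<in> Lp_space p \<mu>" and "bdd_above (range (\<lambda>k. Lp_norm p \<mu> (u k)))"
  shows "\<exists>(r :: nat \<Rightarrow> nat)
           (\<nu> :: real ^ 'n \<Rightarrow> (real ^ 'd) measure)
           (l :: ((real ^ 'n \<Rightarrow> real) \<Rightarrow> real) measure)
           (\<nu>inf :: ((real ^ 'n \<Rightarrow> real) \<Rightarrow> real) \<Rightarrow> ((real ^ 'd \<Rightarrow> real) \<Rightarrow> real) measure).
      strict_mono r \<and>
      measurable_family \<mu> euclidean \<nu> \<and> (AE x in \<mu>. prob_space (\<nu> x)) \<and>
      sets l = sets (borel_of (compactification (top_of_set \<Omega>) F)) \<and> finite_measure l \<and>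
      measurable_family l (remainder unit_ball_top G) \<nu>inf \<and> (AE x in l. prob_space (\<nu>inf x)) \<and>
      (\<forall>\<Phi>\<in>integrands \<Omega> p F G.
         (AE x in \<mu>. integrable (\<nu> x) (\<lambda>z. \<Phi> (x, z))) \<and>
         integrable \<mu> (\<lambda>x. LINT z|\<nu> x. \<Phi> (x, z)) \<and>
         (AE x in l. integrable (\<nu>inf x) (\<lambda>w. recession \<Omega> p F G \<Phi> (x, w))) \<and>
         integrable l (\<lambda>x. LINT w|\<nu>inf x. recession \<Omega> p F G \<Phi> (x, w)) \<and>
         (\<lambda>k. LINT x|\<mu>. \<Phi> (x, u (r k) x)) \<longlonglongrightarrow>
           (LINT x|\<mu>. LINT z|\<nu> x. \<Phi> (x, z)) +
           (LINT x|l. LINT w|\<nu>inf x. recession \<Omega> p F G \<Phi> (x, w)))"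
proof -
  define KF where "KF = compactification (top_of_set \<Omega>) F"
  define LG where "LG = compactification (unit_ball_top :: (real ^ 'd) topology) G"
  define rem where "rem = remainder (unit_ball_top :: (real ^ 'd) topology) G"
  have F: "F \<subseteq> mspace (BC (top_of_set \<Omega>))" "F \<noteq> {}" and G: "G \<subseteq> mspace (BC unit_ball_top)" "G \<noteq> {}"
    using assms(6,11) unfolding subalgebra_BC_def by blast+
  note sep_G = assms(15)
  have p: "1 \<le> p" by (rule assms(5))
  interpret \<mu>: finite_measure \<mu> by (rule assms(4))
  have sets_\<mu>: "sets \<mu> = sets (restrict_space borel \<Omega>)" by (rule assms(3))
  have \<Omega>_meas [measurable]: "\<Omega> \<in> sets borel" using assms(1) by simp
  have space_\<mu>: "space \<mu> = \<Omega>" using sets_eq_imp_space_eq[OF sets_\<mu>] by (simp add: space_restrict_space)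

  \<comment> \<open>Coordinates of the two compactifications\<close>
  obtain hF and K :: "(nat \<Rightarrow> real) set" and jF \<phi>F where hF: "range hF \<subseteq> F" and K: "compact K"
    and homF: "homeomorphic_maps KF (top_of_set K) jF \<phi>F" and jF: "\<And>y. jF y = (\<lambda>n. y (hF n))"
    by (rule compactification_embeds_into_sequences[OF F assms(8), folded KF_def], rule that)
  obtain hG and L :: "(nat \<Rightarrow> real) set" and jG \<phi>G where hG: "range hG \<subseteq> G" and L: "compact L"
    and homG: "homeomorphic_maps LG (top_of_set L) jG \<phi>G" and jG: "\<And>y. jG y = (\<lambda>n. y (hG n))"
    by (rule compactification_embeds_into_sequences[OF G assms(13), folded LG_def], rule that)
  have cont_F: "continuous_map KF (top_of_set K) jF" "continuous_map (top_of_set K) KF \<phi>F"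
    and inv_F: "\<And>y. y \<in> topspace KF \<Longrightarrow> \<phi>F (jF y) = y" "\<And>t. t \<in> K \<Longrightarrow> jF (\<phi>F t) = t"
    using homF by (auto simp: homeomorphic_maps_def)
  have cont_G: "continuous_map LG (top_of_set L) jG" "continuous_map (top_of_set L) LG \<phi>G"
    and inv_G: "\<And>y. y \<in> topspace LG \<Longrightarrow> \<phi>G (jG y) = y" "\<And>t. t \<in> L \<Longrightarrow> jG (\<phi>G t) = t"
    using homG by (auto simp: homeomorphic_maps_def)
  have jF_K: "jF y \<in> K" if "y \<in> topspace KF" for y using continuous_map_funspace[OF cont_F(1)] that by auto
  have jG_L: "jG y \<in> L" if "y \<in> topspace LG" for y using continuous_map_funspace[OF cont_G(1)] that by auto
  have \<phi>F_KF: "\<phi>F t \<in> topspace KF" if "t \<in> K" for t using continuous_map_funspace[OF cont_F(2)] that by auto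
  have \<phi>G_LG: "\<phi>G t \<in> topspace LG" if "t \<in> L" for t using continuous_map_funspace[OF cont_G(2)] that by auto
  have KL_borel [measurable]: "K \<in> sets borel" "L \<in> sets borel" using K L by (auto intro: borel_compact)
  have eval_F: "eval_map F x \<in> topspace KF" if "x \<in> \<Omega>" for x
    using eval_map_in_compactification[OF F(1)] that by (auto simp: KF_def)
  have eval_G: "eval_map G w \<in> topspace LG" if "w \<in> ball 0 1" for w
    using eval_map_in_compactification[OF G(1)] that by (auto simp: LG_def)

  \<comment> \<open>Weight and remainder in the compactified ball\<close>
  obtain \<theta> where \<theta>: "continuous_map LG euclideanreal \<theta>" "\<And>w. w \<in> ball 0 1 \<Longrightarrow> \<theta> (eval_map G w) = 1 - norm w"
    "\<And>y. y \<notin> eval_map G ` ball 0 1 \<Longrightarrow> \<theta> y = 0"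
    unfolding LG_def
    by (rule ball_compactification_zero_extension[OF G(1) sep_G, of "\<lambda>w. 1 - norm w"])
      (auto intro!: continuous_intros)
  \<comment> \<open>The identity \<open>w\<close> does not vanish at the boundary, so zero extension
    does not apply to it; the damped map does extend, and \<open>\<zeta> / \<theta>^2\<close> gives
    back \<open>w / (1 - norm w)\<close> inside the ball.\<close>
  obtain \<zeta> where \<zeta>: "continuous_map LG euclidean \<zeta>" "\<And>w. w \<in> ball 0 1 \<Longrightarrow> \<zeta> (eval_map G w) = (1 - norm w) *\<^sub>R w"
    unfolding LG_def
    by (rule ball_compactification_zero_extension[OF G(1) sep_G, of "\<lambda>w. (1 - norm w) *\<^sub>R w"])
      (auto intro!: continuous_intros simp: mult_left_le)
  have \<theta>_nonneg: "0 \<le> \<theta> y" for y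
    using \<theta>(2,3) by (cases "y \<in> eval_map G ` ball 0 1") auto

  define \<theta>' where "\<theta>' y = (if y \<in> L then \<theta> (\<phi>G y) else 0)" for y
  define \<zeta>' where "\<zeta>' y = (if y \<in> L then \<zeta> (\<phi>G y) else 0)" for y
  define W where "W y = \<theta>' y powr p" for y
  have cont_\<theta>: "continuous_on L (\<lambda>y. \<theta> (\<phi>G y))" and cont_\<zeta>: "continuous_on L (\<lambda>y. \<zeta> (\<phi>G y))"
    using continuous_map_compose[OF cont_G(2) \<theta>(1)] continuous_map_compose[OF cont_G(2) \<zeta>(1)]
    by (simp_all add: o_def)
  have [measurable]: "\<theta>' \<in> borel_measurable borel" "\<zeta>' \<in> borel_measurable borel"
    unfolding \<theta>'_def \<zeta>'_def using cont_\<theta> cont_\<zeta>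
    by (auto intro!: borel_measurable_continuous_on_if continuous_on_const)
  have \<theta>'_nonneg: "0 \<le> \<theta>' y" for y using \<theta>_nonneg by (simp add: \<theta>'_def)
  have W_cont: "continuous_on L W"
  proof (rule continuous_on_eq)
    show "continuous_on L (\<lambda>y. \<theta> (\<phi>G y) powr p)"
      using p \<theta>_nonneg by (intro continuous_on_powr' cont_\<theta> continuous_on_const) auto
  qed (simp add: W_def \<theta>'_def)
  have W_nonneg: "0 \<le> W y" for y by (simp add: W_def)
  have W_0: "\<forall>y. y \<notin> L \<longrightarrow> W y = 0" by (simp add: W_def \<theta>'_def)
  have W_pos: "0 < W y \<longleftrightarrow> 0 < \<theta>' y" for y using \<theta>'_nonneg[of y] by (auto simp: W_def powr_gt_zero less_le)
  have ball_point: "\<theta>' (jG (eval_map G w)) = 1 - norm w" "\<zeta>' (jG (eval_map G w)) = (1 - norm w) *\<^sub>R w"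
    if "w \<in> ball 0 1" for w
    using that eval_G[OF that] jG_L inv_G \<theta>(2) \<zeta>(2) by (auto simp: \<theta>'_def \<zeta>'_def)
  have W_posD: "\<exists>w\<in>ball 0 1. y = jG (eval_map G w)" if "0 < W y" for y
  proof -
    have y: "y \<in> L" using that W_0 by (cases "y \<in> L") auto
    then have "0 < \<theta> (\<phi>G y)" using that W_pos by (simp add: \<theta>'_def)
    then have "\<phi>G y \<in> eval_map G ` ball 0 1" using \<theta>(3)[of "\<phi>G y"] by (cases "\<phi>G y \<in> eval_map G ` ball 0 1") auto
    then show ?thesis using inv_G(2)[OF y] by force
  qed
  have topspace_rem: "topspace rem = topspace LG - eval_map G ` ball 0 1"
    by (auto simp: rem_def remainder_def LG_def)
  have R_rem: "\<phi>G y \<in> topspace rem" if "y \<in> L" "W y = 0" for y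
  proof -
    have "\<phi>G y \<noteq> eval_map G w" if "w \<in> ball 0 1" for w
      using that \<theta>(2)[OF that] \<open>y \<in> L\<close> \<open>W y = 0\<close> W_pos[of y] by (auto simp: \<theta>'_def)
    then show ?thesis using \<phi>G_LG[OF that(1)] unfolding topspace_rem by blast
  qed
  have L_ne: "L \<noteq> {}" using jG_L[OF eval_G[of 0]] by auto
  \<comment> \<open>The ball is not compact: otherwise \<open>\<theta>\<close> would have a positive
    minimum on \<open>L\<close>, but it takes the smaller value \<open>m\<close> at a vector of norm
    \<open>1 - m\<close>. A nonempty remainder is what gives the fibres \<open>\<nu>inf\<close> a
    place to live.\<close>
  have R_ne: "{y \<in> L. W y = 0} \<noteq> {}"
  proof
    assume R: "{y \<in> L. W y = 0} = {}"
    obtain y0 where y0: "y0 \<in> L" "\<And>y. y \<in> L \<Longrightarrow> \<theta> (\<phi>G y0) \<le> \<theta> (\<phi>G y)"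
      using continuous_attains_inf[OF L L_ne cont_\<theta>] by auto
    have "0 < W y0" using R y0(1) W_nonneg[of y0] by (auto simp: less_le)
    then have pos: "0 < \<theta> (\<phi>G y0)" using y0(1) W_pos by (simp add: \<theta>'_def)
    define m where "m = min 1 (\<theta> (\<phi>G y0)) / 2"
    have m: "0 < m" "m < 1" "m < \<theta> (\<phi>G y0)" using pos by (auto simp: m_def min_def)
    obtain w :: "real ^ 'd" where w: "norm w = 1 - m" using vector_choose_size[of "1 - m"] m by auto
    then have wb: "w \<in> ball 0 1" using m by simp
    have "\<theta> (\<phi>G (jG (eval_map G w))) = m" using inv_G(1)[OF eval_G[OF wb]] \<theta>(2)[OF wb] w by simp
    then show False using y0(2)[OF jG_L[OF eval_G[OF wb]]] m by simp
  qed

  \<comment> \<open>The sequence in ball coordinates and its mass bound\<close>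
  define s where "s z = z /\<^sub>R (1 + norm z)" for z :: "real ^ 'd"
  have s_ball: "s z \<in> ball 0 1" for z
    by (simp add: s_def divide_simps add_pos_nonneg)
  have s_norm: "1 - norm (s z) = 1 / (1 + norm z)" for z
    using add_pos_nonneg[of 1 "norm z"] by (simp add: s_def field_simps)
  have s_inv: "s z /\<^sub>R (1 - norm (s z)) = z" for z
    unfolding s_norm using add_pos_nonneg[of 1 "norm z"] by (simp add: s_def)
  have s_cont: "continuous_on UNIV s"
  proof -
    have "1 + norm z \<noteq> 0" for z :: "real ^ 'd" using norm_ge_zero[of z] by linarith
    then show ?thesis unfolding s_def by (intro continuous_intros) auto
  qed
  \<comment> \<open>Written through the coordinate functions so that measurability is checked
    coordinate by coordinate; \<open>e_eq\<close> and \<open>v_eq\<close> identify these maps with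
    the embedded points.\<close>
  define e where "e x = (\<lambda>n. hF n x)" for x
  define v where "v k x = (\<lambda>n. hG n (s (u k x)))" for k x
  have e_eq: "e x = jF (eval_map F x)" for x
    using hF by (auto simp: e_def jF eval_map_def fun_eq_iff)
  have v_eq: "v k x = jG (eval_map G (s (u k x)))" for k x
    using hG by (auto simp: v_def jG eval_map_def fun_eq_iff)
  have e_K: "e \<in> space \<mu> \<rightarrow> K" using jF_K[OF eval_F] by (simp add: e_eq space_\<mu>)
  have v_L: "v k x \<in> L" for k x using jG_L[OF eval_G[OF s_ball]] by (simp add: v_eq)
  have u_meas [measurable]: "u k \<in> borel_measurable \<mu>" for k using assms(16)[of k] by (simp add: Lp_space_def)
  have e_meas [measurable]: "e \<in> borel_measurable \<mu>"
  proof (rule measurable_coordinatewise_then_product)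
    fix n
    have "continuous_on \<Omega> (hF n)" using continuous_map_of_BC(1)[of "hF n" "top_of_set \<Omega>"] hF F(1) by auto
    then show "(\<lambda>x. e x n) \<in> borel_measurable \<mu>"
      unfolding e_def measurable_cong_sets[OF sets_\<mu> refl] by (rule borel_measurable_continuous_on_restrict)
  qed
  have v_meas [measurable]: "v k \<in> borel_measurable \<mu>" for k
  proof (rule measurable_coordinatewise_then_product)
    fix n
    have "continuous_on (ball 0 1) (hG n)" using continuous_map_of_BC(1)[of "hG n" unit_ball_top] hG G(1) by auto
    then have "continuous_on UNIV (\<lambda>z. hG n (s z))"
      by (rule continuous_on_compose2[OF _ s_cont]) (use s_ball in auto)
    then have "(\<lambda>z. hG n (s z)) \<in> borel_measurable borel" by (rule borel_measurable_continuous_onI)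
    then show "(\<lambda>x. v k x n) \<in> borel_measurable \<mu>" unfolding v_def by measurable
  qed
  have W_v: "W (v k x) = (1 / (1 + norm (u k x))) powr p" for k x
    using ball_point(1)[OF s_ball, of "u k x"] by (simp add: W_def v_eq s_norm)
  have W_v': "1 / W (v k x) = (1 + norm (u k x)) powr p" for k x
    using add_pos_nonneg[of 1 "norm (u k x)"] by (simp add: W_v powr_divide)
  have W_v_pos: "0 < W (v k x)" for k x
    using add_pos_nonneg[of 1 "norm (u k x)"] by (simp add: W_v)
  \<comment> \<open>From \<open>1 + norm z \<le> 2 * max 1 (norm z)\<close>; this is the source of
    the factor \<open>2 powr p\<close> in the bound on the total masses.\<close>
  have bound: "(1 + norm z) powr p \<le> 2 powr p * (1 + norm z powr p)" for z :: "real ^ 'd"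
  proof -
    have "(1 + norm z) powr p \<le> (2 * max 1 (norm z)) powr p"
      using p by (intro powr_mono2) auto
    also have "\<dots> = 2 powr p * max 1 (norm z) powr p" by (simp add: powr_mult)
    also have "\<dots> \<le> 2 powr p * (1 + norm z powr p)"
      by (intro mult_left_mono) (auto simp: max_def)
    finally show ?thesis .
  qed
  have int_u: "integrable \<mu> (\<lambda>x. norm (u k x) powr p)" for k using assms(16)[of k] by (simp add: Lp_space_def)
  have int_bd: "integrable \<mu> (\<lambda>x. 2 powr p * (1 + norm (u k x) powr p))" for k
    using int_u by (intro integrable_mult_right Bochner_Integration.integrable_add) auto
  have int: "integrable \<mu> (\<lambda>x. 1 / W (v k x))" for k
    unfolding W_v' by (rule Bochner_Integration.integrable_bound[OF int_bd]) (use bound in auto)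
  obtain C where C: "\<And>k. Lp_norm p \<mu> (u k) \<le> C" using assms(17) by (auto simp: bdd_above_def)
  have B: "(LINT x|\<mu>. 1 / W (v k x)) \<le> 2 powr p * (measure \<mu> \<Omega> + C powr p)" for k
  proof -
    have nn: "0 \<le> (LINT x|\<mu>. norm (u k x) powr p)" by (rule integral_nonneg_AE) simp
    have "(LINT x|\<mu>. norm (u k x) powr p) = Lp_norm p \<mu> (u k) powr p"
      using p nn by (simp add: Lp_norm_def powr_powr)
    also have "\<dots> \<le> C powr p" using C p by (intro powr_mono2) (auto simp: Lp_norm_def)
    finally have le: "(LINT x|\<mu>. norm (u k x) powr p) \<le> C powr p" .
    have "(LINT x|\<mu>. 1 / W (v k x)) \<le> (LINT x|\<mu>. 2 powr p * (1 + norm (u k x) powr p))"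
      using bound by (intro integral_mono int int_bd) (simp add: W_v')
    also have "\<dots> = 2 powr p * (measure \<mu> \<Omega> + (LINT x|\<mu>. norm (u k x) powr p))"
      using int_u by (simp add: space_\<mu>)
    also have "\<dots> \<le> 2 powr p * (measure \<mu> \<Omega> + C powr p)" using le by simp
    finally show ?thesis .
  qed

  \<comment> \<open>Limit objects on sequence space\<close>
  obtain r \<kappa>1 l' \<kappa>2 where r: "strict_mono (r :: nat \<Rightarrow> nat)" and \<kappa>1: "\<kappa>1 \<in> borel \<rightarrow>\<^sub>M prob_algebra borel"
    and l': "finite_measure l'" "sets l' = sets borel" "AE x in l'. x \<in> K"
    and \<kappa>2: "\<kappa>2 \<in> borel \<rightarrow>\<^sub>M prob_algebra borel"
    and \<kappa>1_pos: "AE x in \<mu>. AE y in \<kappa>1 (e x). 0 < W y" and \<kappa>2_R: "\<And>x. AE y in \<kappa>2 x. y \<in> L \<and> W y = 0"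
    and main: "\<And>g. continuous_on (K \<times> L) g \<Longrightarrow> \<forall>p. p \<notin> K \<times> L \<longrightarrow> g p = 0 \<Longrightarrow>
      (AE x in \<mu>. integrable (\<kappa>1 (e x)) (\<lambda>y. g (e x, y) / W y)) \<and>
      integrable \<mu> (\<lambda>x. LINT y|\<kappa>1 (e x). g (e x, y) / W y) \<and>
      (AE x in l'. integrable (\<kappa>2 x) (\<lambda>y. g (x, y))) \<and>
      integrable l' (\<lambda>x. LINT y|\<kappa>2 x. g (x, y)) \<and>
      (\<lambda>k. LINT x|\<mu>. g (e x, v (r k) x) / W (v (r k) x)) \<longlonglongrightarrow>
        (LINT x|\<mu>. LINT y|\<kappa>1 (e x). g (e x, y) / W y) + (LINT x|l'. LINT y|\<kappa>2 x. g (x, y) :: real)"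
    using generalized_young_measure_core[where v = v, OF assms(4) K L e_meas e_K v_meas v_L W_cont W_nonneg W_0 W_v_pos int B L_ne R_ne]
    by blast

  \<comment> \<open>recovers \<open>z = w / (1 - |w|)\<close> from \<open>w\<close> in the ball; zero elsewhere because \<open>1 / 0 = 0\<close>\<close>
  define q where "q y = \<zeta>' y /\<^sub>R (\<theta>' y)\<^sup>2" for y
  have q_meas [measurable]: "q \<in> borel_measurable borel" unfolding q_def by measurable
  have q_eval: "q (jG (eval_map G w)) = w /\<^sub>R (1 - norm w)" if "w \<in> ball 0 1" for w
    using ball_point[OF that] that by (simp add: q_def power2_eq_square divide_simps)
  obtain y0 where y0: "y0 \<in> L" "W y0 = 0" using R_ne by auto
  define R where "R = {y \<in> L. W y = 0}"
  \<comment> \<open>\<open>\<phi>G\<close> reaches the remainder only from \<open>R\<close>; the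
    fixed remainder point \<open>\<phi>G y0\<close> elsewhere makes \<open>q2\<close> a total map
    into the remainder.\<close>
  define q2 where "q2 y = (if y \<in> R then \<phi>G y else \<phi>G y0)" for y
  have R_meas: "R \<in> sets borel"
  proof -
    have "W \<in> borel_measurable borel" unfolding W_def by measurable
    then show ?thesis unfolding R_def by measurable
  qed
  have q2_meas [measurable]: "q2 \<in> borel \<rightarrow>\<^sub>M borel_of rem"
  proof -
    have "continuous_map (top_of_set R) rem \<phi>G"
      using continuous_map_from_subtopology_mono[OF cont_G(2), of R] R_rem
      by (auto simp: rem_def remainder_def LG_def[symmetric] continuous_map_in_subtopology R_def topspace_rem[unfolded rem_def remainder_def LG_def[symmetric]])
    then have "\<phi>G \<in> restrict_space borel R \<rightarrow>\<^sub>M borel_of rem" by (rule continuous_map_measurable_borel_of)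
    moreover have "(\<lambda>y. \<phi>G y0) \<in> restrict_space borel (- R) \<rightarrow>\<^sub>M borel_of rem"
      using R_rem[OF y0] by (simp add: space_borel_of)
    ultimately show ?thesis
      unfolding q2_def using R_meas by (subst measurable_If_restrict_space_iff) (simp_all add: Compl_eq)
  qed

  \<comment> \<open>The triple of the theorem\<close>
  define \<nu> where "\<nu> x = distr (\<kappa>1 (e x)) borel q" for x
  \<comment> \<open>\<open>l'\<close> lives on all of \<open>nat \<Rightarrow> real\<close> but is
    carried by \<open>K\<close>, the only set on which \<open>\<phi>F\<close> is continuous;
    restricting loses no mass.\<close>
  define l where "l = distr (restrict_space l' K) (borel_of KF) \<phi>F"
  define \<nu>inf where "\<nu>inf y = distr (\<kappa>2 (jF y)) (borel_of rem) q2" for y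
  have \<kappa>1_e: "(\<lambda>x. \<kappa>1 (e x)) \<in> \<mu> \<rightarrow>\<^sub>M prob_algebra borel" by (rule measurable_compose[OF e_meas \<kappa>1])
  have \<nu>: "\<nu> \<in> \<mu> \<rightarrow>\<^sub>M prob_algebra borel"
    unfolding \<nu>_def by (rule measurable_compose[OF \<kappa>1_e measurable_distr_prob_space[OF q_meas]])
  have jF_meas: "jF \<in> borel_of KF \<rightarrow>\<^sub>M borel"
    by (rule continuous_map_borel_of_measurable) (use cont_F(1) in \<open>simp add: continuous_map_in_subtopology\<close>)
  have sets_l: "sets l = sets (borel_of KF)" by (simp add: l_def)
  have space_l: "space l = topspace KF" by (simp add: l_def space_borel_of)
  have jF_l: "jF \<in> l \<rightarrow>\<^sub>M borel" using jF_meas by (simp add: measurable_cong_sets[OF sets_l refl])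
  have \<kappa>2_jF: "(\<lambda>y. \<kappa>2 (jF y)) \<in> l \<rightarrow>\<^sub>M prob_algebra borel" by (rule measurable_compose[OF jF_l \<kappa>2])
  have \<nu>inf: "\<nu>inf \<in> l \<rightarrow>\<^sub>M prob_algebra (borel_of rem)"
    unfolding \<nu>inf_def by (rule measurable_compose[OF \<kappa>2_jF measurable_distr_prob_space[OF q2_meas]])
  have prob_kernel: "prob_space (k x)" "sets (k x) = sets N"
    if "k \<in> M \<rightarrow>\<^sub>M prob_algebra N" "x \<in> space M" for k x and M :: "'x measure" and N :: "'y measure"
    using measurable_space[OF that] by (simp_all add: space_prob_algebra)
  have fam1: "measurable_family \<mu> euclidean \<nu>"
    unfolding measurable_family_def
  proof (intro conjI ballI)
    fix \<phi> :: "real ^ 'd \<Rightarrow> real" assume "\<phi> \<in> C0 euclidean"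
    then have "continuous_on UNIV \<phi>" by (simp add: C0_def)
    then have "\<phi> \<in> borel_measurable borel" by (rule borel_measurable_continuous_onI)
    then show "(\<lambda>x. LINT z|\<nu> x. \<phi> z) \<in> borel_measurable \<mu>"
      by (rule measurable_compose[OF measurable_prob_algebraD[OF \<nu>] integral_measurable_subprob_algebra])
  qed (simp add: \<nu>_def borel_of_euclidean)
  have fam2: "measurable_family l rem \<nu>inf"
    unfolding measurable_family_def
  proof (intro conjI ballI)
    fix \<phi> assume "\<phi> \<in> C0 rem"
    then have "continuous_map rem euclideanreal \<phi>" by (simp add: C0_def)
    then have "\<phi> \<in> borel_measurable (borel_of rem)" by (rule continuous_map_borel_of_measurable)
    then show "(\<lambda>x. LINT z|\<nu>inf x. \<phi> z) \<in> borel_measurable l"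
      by (rule measurable_compose[OF measurable_prob_algebraD[OF \<nu>inf] integral_measurable_subprob_algebra])
  qed (simp add: \<nu>inf_def)
  have K_l: "K \<in> sets l'" unfolding l'(2) by (rule KL_borel)
  then have K_l': "K \<inter> space l' \<in> sets l'" by blast
  have \<phi>F_meas: "\<phi>F \<in> restrict_space l' K \<rightarrow>\<^sub>M borel_of KF"
    using continuous_map_measurable_borel_of[OF cont_F(2)]
    by (simp add: measurable_cong_sets[OF sets_restrict_space_cong[OF l'(2)] refl])
  have fin_l: "finite_measure l"
    unfolding l_def
    by (intro finite_measure.finite_measure_distr[OF _ \<phi>F_meas] finite_measure_restrict_space l'(1) K_l)
  \<comment> \<open>Change of variables: \<open>jF \<circ> \<phi>F\<close> is the identity on
    \<open>K\<close>, and the complement of \<open>K\<close> is null for \<open>l'\<close>.\<close>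
  have int_l: "integrable l (\<lambda>x. h (jF x))" "(LINT x|l. h (jF x)) = (LINT t|l'. h t)"
    if h: "integrable l' h" for h :: "_ \<Rightarrow> real"
  proof -
    have [measurable]: "h \<in> borel_measurable borel"
      using borel_measurable_integrable[OF h] by (simp add: measurable_cong_sets[OF l'(2) refl])
    have hj: "(\<lambda>x. h (jF x)) \<in> borel_measurable (borel_of KF)"
      by (rule measurable_compose[OF jF_meas]) simp
    have ind: "indicator K t *\<^sub>R h (jF (\<phi>F t)) = indicator K t *\<^sub>R h t" for t
      using inv_F(2)[of t] by (cases "t \<in> K") auto
    have h_K: "integrable l' (\<lambda>t. indicator K t *\<^sub>R h t)"
      by (rule integrable_mult_indicator[OF K_l h])
    show "integrable l (\<lambda>x. h (jF x))"
      unfolding l_def integrable_distr_eq[OF \<phi>F_meas hj] integrable_restrict_space[OF K_l'] ind by (rule h_K)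
    have "(LINT x|l. h (jF x)) = (LINT t|l'. indicator K t *\<^sub>R h t)"
      unfolding l_def integral_distr[OF \<phi>F_meas hj] integral_restrict_space[OF K_l'] ind ..
    also have "\<dots> = (LINT t|l'. h t)"
      by (rule integral_cong_AE)
        (use l'(3) borel_measurable_integrable[OF h] borel_measurable_integrable[OF h_K] in \<open>auto elim!: eventually_mono\<close>)
    finally show "(LINT x|l. h (jF x)) = (LINT t|l'. h t)" .
  qed

  \<comment> \<open>Limit formula for a fixed integrand\<close>
  have limit: "(AE x in \<mu>. integrable (\<nu> x) (\<lambda>z. \<Phi> (x, z))) \<and>
      integrable \<mu> (\<lambda>x. LINT z|\<nu> x. \<Phi> (x, z)) \<and>
      (AE x in l. integrable (\<nu>inf x) (\<lambda>w. recession \<Omega> p F G \<Phi> (x, w))) \<and>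
      integrable l (\<lambda>x. LINT w|\<nu>inf x. recession \<Omega> p F G \<Phi> (x, w)) \<and>
      (\<lambda>k. LINT x|\<mu>. \<Phi> (x, u (r k) x)) \<longlonglongrightarrow>
        (LINT x|\<mu>. LINT z|\<nu> x. \<Phi> (x, z)) + (LINT x|l. LINT w|\<nu>inf x. recession \<Omega> p F G \<Phi> (x, w))"
    if \<Phi>: "\<Phi> \<in> integrands \<Omega> p F G" for \<Phi>
  proof -
    have \<Phi>_cont: "continuous_on (\<Omega> \<times> UNIV) \<Phi>" and ex: "\<exists>g. is_T_extension \<Omega> p F G \<Phi> g"
      using \<Phi> by (auto simp: integrands_def)
    \<comment> \<open>The same choice as in \<open>recession\<close>, so the two agree over the
      remainder by unfolding.\<close>
    define E where "E = (SOME g. is_T_extension \<Omega> p F G \<Phi> g)"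
    have E: "is_T_extension \<Omega> p F G \<Phi> E" unfolding E_def using ex by (rule someI_ex)
    have E_cont: "continuous_map (prod_topology KF LG) euclideanreal E"
      and E_T: "\<And>x w. x \<in> \<Omega> \<Longrightarrow> w \<in> ball 0 1 \<Longrightarrow> E (eval_map F x, eval_map G w) = T_op p \<Phi> (x, w)"
      using E unfolding is_T_extension_def KF_def LG_def by blast+
    have rec: "recession \<Omega> p F G \<Phi> (x, w) = E (x, w)" if "x \<in> topspace KF" "w \<in> topspace rem" for x w
      using that by (simp add: recession_def E_def KF_def rem_def)
    define g where "g t = (if t \<in> K \<times> L then E (\<phi>F (fst t), \<phi>G (snd t)) else 0)" for t
    have g_cont: "continuous_on (K \<times> L) g"
    proof (rule continuous_on_eq)
      have "continuous_map (prod_topology (top_of_set K) (top_of_set L)) KF (\<lambda>t. \<phi>F (fst t))"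
        "continuous_map (prod_topology (top_of_set K) (top_of_set L)) LG (\<lambda>t. \<phi>G (snd t))"
        using continuous_map_compose[OF continuous_map_fst cont_F(2)] continuous_map_compose[OF continuous_map_snd cont_G(2)]
        unfolding o_def by blast+
      from continuous_map_compose[OF continuous_map_pairedI[OF this] E_cont]
      have "continuous_map (prod_topology (top_of_set K) (top_of_set L)) euclideanreal (\<lambda>t. E (\<phi>F (fst t), \<phi>G (snd t)))"
        unfolding o_def .
      then show "continuous_on (K \<times> L) (\<lambda>t. E (\<phi>F (fst t), \<phi>G (snd t)))"
        by (simp add: prod_topology_subtopology subtopology_subtopology Times_Int_Times)
    qed (simp add: g_def)
    have g_0: "\<forall>t. t \<notin> K \<times> L \<longrightarrow> g t = 0" by (simp add: g_def)
    note main_g = main[OF g_cont g_0]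
    \<comment> \<open>The weight \<open>(1 - norm w) powr p\<close> in \<open>T_op\<close> is
      precisely \<open>W\<close> at that point, so the quotient is \<open>\<Phi>\<close>
      itself.\<close>
    have g_eval: "g (e x, jG (eval_map G w)) / W (jG (eval_map G w)) = \<Phi> (x, w /\<^sub>R (1 - norm w))"
      if "x \<in> \<Omega>" "w \<in> ball 0 1" for x w
    proof -
      have "g (e x, jG (eval_map G w)) = T_op p \<Phi> (x, w)"
        using that jF_K[OF eval_F] jG_L[OF eval_G] inv_F(1)[OF eval_F] inv_G(1)[OF eval_G] E_T[OF that]
        by (simp add: g_def e_eq)
      moreover have "W (jG (eval_map G w)) = (1 - norm w) powr p" using ball_point[OF that(2)] by (simp add: W_def)
      ultimately show ?thesis using that(2) by (simp add: T_op_def)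
    qed
    have \<Phi>_q: "\<Phi> (x, q y) = g (e x, y) / W y" if "x \<in> \<Omega>" "0 < W y" for x y
      using W_posD[OF that(2)] g_eval[OF that(1)] q_eval by auto
    have \<Phi>_u: "\<Phi> (x, u k x) = g (e x, v k x) / W (v k x)" if "x \<in> \<Omega>" for k x
      using g_eval[OF that s_ball, of "u k x"] by (simp add: v_eq s_inv)
    \<comment> \<open>\<open>\<Phi>\<close> is continuous only on
      \<open>\<Omega> \<times> UNIV\<close>, which is the whole space of the product because
      \<open>\<mu>\<close> lives on \<open>\<Omega>\<close>.\<close>
    have \<Phi>_pair: "\<Phi> \<in> borel_measurable (\<mu> \<Otimes>\<^sub>M borel)"
    proof -
      have "\<Phi> \<in> borel_measurable (restrict_space borel (\<Omega> \<times> UNIV))"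
        by (rule borel_measurable_continuous_on_restrict[OF \<Phi>_cont])
      moreover have "(\<lambda>t :: (real ^ 'n) \<times> (real ^ 'd). t) \<in> \<mu> \<Otimes>\<^sub>M borel \<rightarrow>\<^sub>M restrict_space borel (\<Omega> \<times> UNIV)"
      proof (rule measurable_restrict_space2)
        have "(\<lambda>x. x) \<in> \<mu> \<rightarrow>\<^sub>M borel"
          unfolding measurable_cong_sets[OF sets_\<mu> refl] by (rule measurable_restrict_space1) simp
        then have "(\<lambda>t. (fst t, snd t)) \<in> \<mu> \<Otimes>\<^sub>M borel \<rightarrow>\<^sub>M borel \<Otimes>\<^sub>M (borel :: (real ^ 'd) measure)" by measurable
        then show "(\<lambda>t. t) \<in> \<mu> \<Otimes>\<^sub>M borel \<rightarrow>\<^sub>M (borel :: ((real ^ 'n) \<times> (real ^ 'd)) measure)"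
          by (simp only: borel_prod prod.collapse)
      qed (auto simp: space_pair_measure space_\<mu>)
      ultimately show ?thesis using measurable_compose by blast
    qed
    have sets_\<kappa>1: "sets (\<kappa>1 t) = sets borel" and sets_\<kappa>2: "sets (\<kappa>2 t) = sets borel" for t
      using prob_kernel(2)[OF \<kappa>1] prob_kernel(2)[OF \<kappa>2] by simp_all
    have g_meas: "g \<in> borel_measurable borel"
    proof -
      have "(\<lambda>t. if t \<in> K \<times> L then g t else 0) \<in> borel_measurable borel"
        by (intro borel_measurable_continuous_on_if g_cont continuous_on_const borel_compact compact_Times K L)
      moreover have "(\<lambda>t. if t \<in> K \<times> L then g t else 0) = g" using g_0 by auto
      ultimately show ?thesis by simp
    qed
    have g_sec: "(\<lambda>y. g (t, y)) \<in> borel_measurable borel" for t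
      by (rule measurable_compose[OF _ g_meas]) (simp add: borel_prod[symmetric])
    have W_meas: "W \<in> borel_measurable borel" unfolding W_def by measurable
    \<comment> \<open>\<open>\<Phi> (x, q y)\<close> equals \<open>g (e x, y) / W y\<close> only
      where \<open>W y\<close> is positive, hence the a.e. premise on the fibre.\<close>
    have \<nu>_int: "(integrable (\<nu> x) (\<lambda>z. \<Phi> (x, z)) \<longleftrightarrow> integrable (\<kappa>1 (e x)) (\<lambda>y. g (e x, y) / W y)) \<and>
        (LINT z|\<nu> x. \<Phi> (x, z)) = (LINT y|\<kappa>1 (e x). g (e x, y) / W y)"
      if x: "x \<in> \<Omega>" and AE: "AE y in \<kappa>1 (e x). 0 < W y" for x
    proof -
      have \<Phi>_x: "(\<lambda>z. \<Phi> (x, z)) \<in> borel_measurable borel"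
        by (rule measurable_compose[OF _ \<Phi>_pair]) (use x in \<open>simp add: space_\<mu>\<close>)
      have q': "q \<in> \<kappa>1 (e x) \<rightarrow>\<^sub>M borel" by (simp add: measurable_cong_sets[OF sets_\<kappa>1 refl])
      have m1: "(\<lambda>y. \<Phi> (x, q y)) \<in> borel_measurable (\<kappa>1 (e x))" by (rule measurable_compose[OF q' \<Phi>_x])
      have m2: "(\<lambda>y. g (e x, y) / W y) \<in> borel_measurable (\<kappa>1 (e x))"
        unfolding measurable_cong_sets[OF sets_\<kappa>1 refl] by (intro borel_measurable_divide g_sec W_meas)
      have eq: "AE y in \<kappa>1 (e x). \<Phi> (x, q y) = g (e x, y) / W y"
        using AE by eventually_elim (rule \<Phi>_q[OF x])
      show ?thesis
        unfolding \<nu>_def integrable_distr_eq[OF q' \<Phi>_x] integral_distr[OF q' \<Phi>_x]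
        using integrable_cong_AE[OF m1 m2 eq] integral_cong_AE[OF m1 m2 eq] by simp
    qed
    have AE_\<mu>: "AE x in \<mu>. x \<in> \<Omega>" using AE_space[of \<mu>] by (simp add: space_\<mu>)
    have "AE x in \<mu>. integrable (\<nu> x) (\<lambda>z. \<Phi> (x, z))"
      using AE_\<mu> \<kappa>1_pos conjunct1[OF main_g] by eventually_elim (simp add: \<nu>_int)
    moreover have eq_\<mu>: "AE x in \<mu>. (LINT z|\<nu> x. \<Phi> (x, z)) = (LINT y|\<kappa>1 (e x). g (e x, y) / W y)"
      using AE_\<mu> \<kappa>1_pos by eventually_elim (simp add: \<nu>_int)
    have \<nu>_meas: "(\<lambda>x. LINT z|\<nu> x. \<Phi> (x, z)) \<in> borel_measurable \<mu>"
      by (rule integral_kernel_measurable[OF \<nu> \<Phi>_pair])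
    have int_g: "integrable \<mu> (\<lambda>x. LINT y|\<kappa>1 (e x). g (e x, y) / W y)" using main_g by blast
    have "integrable \<mu> (\<lambda>x. LINT z|\<nu> x. \<Phi> (x, z))"
      using integrable_cong_AE[OF \<nu>_meas borel_measurable_integrable[OF int_g] eq_\<mu>] int_g by blast
    moreover have eq1: "(LINT x|\<mu>. LINT z|\<nu> x. \<Phi> (x, z)) = (LINT x|\<mu>. LINT y|\<kappa>1 (e x). g (e x, y) / W y)"
      by (rule integral_cong_AE[OF \<nu>_meas borel_measurable_integrable[OF int_g] eq_\<mu>])
    obtain B where B: "\<And>t. t \<in> K \<times> L \<Longrightarrow> \<bar>g t\<bar> \<le> B"
      using compact_imp_bounded[OF compact_continuous_image[OF g_cont compact_Times[OF K L]]]
      by (force simp: bounded_iff)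
    have g_bd: "\<bar>g t\<bar> \<le> \<bar>B\<bar>" for t using B[of t] g_0[rule_format, of t] by (cases "t \<in> K \<times> L") auto
    \<comment> \<open>Valid for every \<open>x\<close>: \<open>g\<close> is bounded and each
      \<open>\<kappa>2\<close> fibre is carried by \<open>R\<close>, where \<open>q2\<close> is
      \<open>\<phi>G\<close>.\<close>
    have \<nu>inf_int: "integrable (\<nu>inf x) (\<lambda>w. recession \<Omega> p F G \<Phi> (x, w)) \<and>
        (LINT w|\<nu>inf x. recession \<Omega> p F G \<Phi> (x, w)) = (LINT y|\<kappa>2 (jF x). g (jF x, y))"
      if x: "x \<in> topspace KF" for x
    proof -
      interpret \<kappa>2: prob_space "\<kappa>2 (jF x)" using prob_kernel(1)[OF \<kappa>2] by simp
      have rem_KF: "continuous_map rem (prod_topology KF LG) (\<lambda>w. (x, w))"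
        using x by (intro continuous_map_pairedI)
          (auto simp: rem_def remainder_def LG_def intro: continuous_map_from_subtopology)
      have "continuous_map rem euclideanreal (\<lambda>w. E (x, w))"
        using continuous_map_compose[OF rem_KF E_cont] by (simp add: o_def)
      then have "(\<lambda>w. E (x, w)) \<in> borel_measurable (borel_of rem)" by (rule continuous_map_borel_of_measurable)
      then have rec_meas: "(\<lambda>w. recession \<Omega> p F G \<Phi> (x, w)) \<in> borel_measurable (borel_of rem)"
        by (rule measurable_cong[THEN iffD1, rotated]) (simp add: rec x space_borel_of)
      have q2': "q2 \<in> \<kappa>2 (jF x) \<rightarrow>\<^sub>M borel_of rem" by (simp add: measurable_cong_sets[OF sets_\<kappa>2 refl])
      have m1: "(\<lambda>y. recession \<Omega> p F G \<Phi> (x, q2 y)) \<in> borel_measurable (\<kappa>2 (jF x))"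
        by (rule measurable_compose[OF q2' rec_meas])
      have m2: "(\<lambda>y. g (jF x, y)) \<in> borel_measurable (\<kappa>2 (jF x))"
        unfolding measurable_cong_sets[OF sets_\<kappa>2 refl] by (rule g_sec)
      have eq: "AE y in \<kappa>2 (jF x). recession \<Omega> p F G \<Phi> (x, q2 y) = g (jF x, y)"
        using \<kappa>2_R[of "jF x"]
        by eventually_elim (simp add: q2_def R_def g_def rec x R_rem jF_K inv_F)
      have "integrable (\<kappa>2 (jF x)) (\<lambda>y. g (jF x, y))"
        by (rule \<kappa>2.integrable_const_bound[OF _ m2]) (use g_bd in auto)
      then show ?thesis
        unfolding \<nu>inf_def integrable_distr_eq[OF q2' rec_meas] integral_distr[OF q2' rec_meas]
        using integrable_cong_AE[OF m1 m2 eq] integral_cong_AE[OF m1 m2 eq] by simp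
    qed
    have "AE x in l. integrable (\<nu>inf x) (\<lambda>w. recession \<Omega> p F G \<Phi> (x, w))"
      by (rule AE_I2) (simp add: space_l \<nu>inf_int)
    moreover have int_g2: "integrable l' (\<lambda>t. LINT y|\<kappa>2 t. g (t, y))" using main_g by blast
    have "integrable l (\<lambda>x. LINT w|\<nu>inf x. recession \<Omega> p F G \<Phi> (x, w))"
      using int_l(1)[OF int_g2] by (rule Bochner_Integration.integrable_cong[THEN iffD1, rotated 2])
        (simp_all add: space_l \<nu>inf_int)
    moreover have "(LINT x|l. LINT w|\<nu>inf x. recession \<Omega> p F G \<Phi> (x, w)) = (LINT t|l'. LINT y|\<kappa>2 t. g (t, y))"
      using int_l(2)[OF int_g2] Bochner_Integration.integral_cong[of l l "\<lambda>x. LINT w|\<nu>inf x. recession \<Omega> p F G \<Phi> (x, w)"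
        "\<lambda>x. LINT y|\<kappa>2 (jF x). g (jF x, y)"] by (simp add: space_l \<nu>inf_int)
    moreover have "(LINT x|\<mu>. \<Phi> (x, u k x)) = (LINT x|\<mu>. g (e x, v k x) / W (v k x))" for k
      by (rule Bochner_Integration.integral_cong) (simp_all add: space_\<mu> \<Phi>_u)
    ultimately show ?thesis using main_g eq1 by simp
  qed
  have "AE x in \<mu>. prob_space (\<nu> x)" by (rule AE_I2) (rule prob_kernel(1)[OF \<nu>])
  moreover have "AE x in l. prob_space (\<nu>inf x)" by (rule AE_I2) (rule prob_kernel(1)[OF \<nu>inf])
  ultimately show ?thesis
    using r fam1 sets_l fin_l fam2 unfolding KF_def rem_def
    by (intro exI[of _ r] exI[of _ \<nu>] exI[of _ l] exI[of _ \<nu>inf] conjI) (assumption | rule ballI, erule limit)+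
qed

end
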